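(* Assume that the coefficients $b,\sigma,f,\Phi$ are continuous in $(t,u)$; that for each $u$ the map $A(t,\lambda,u)=(-G^Tf,\,Gb,\,G\sigma)(t,\lambda,u)$ is uniformly Lipschitz in $\lambda=(x,y,z)$ with $A(\cdot,\lambda,u)\in\mathcal H^2$ on $[0,T]$ for each $\lambda$; that $b,\sigma,f$ are Lipschitz in $(x,y,z)$ uniformly in $(t,u)$ and $\Phi$ is Lipschitz; and that, for all $t,u$, $\lambda=(x,y,z)$, $\bar\lambda=(\bar x,\bar y,\bar z)$, the monotonicity inequalities $\langle A(t,\lambda,u)-A(t,\bar\lambda,u),\lambda-\bar\lambda\rangle\le-\beta_1|G(x-\bar x)|^2-\beta_2(|G^T(y-\bar y)|^2+|G^T(z-\bar z)|^2)$ and $\langle\Phi(x)-\Phi(\bar x),G(x-\bar x)\rangle\ge\mu_1|G(x-\bar x)|^2$ hold with constants $\beta_1,\beta_2,\mu_1\ge0$ such that $\beta_1+\beta_2>0$, $\beta_2+\mu_1>0$, and $\beta_2>0$ if $n>1$. Then the cost functional $J(t,x;u)$, for any $u\in\mathcal U_{t,T}$, and the value function $W(t,x)$ are monotonic in the following sense: for each $x,\bar x\in\mathbb R^n$, $t\in[0,T]$, (i) $\langle J(t,x;u)-J(t,\bar x;u),\,G(x-\bar x)\rangle\ge0$, $P$-a.s.; (ii) $\langle W(t,x)-W(t,\bar x),\,G(x-\bar x)\rangle\ge0$.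
   Context: Let $T>0$, let $(\Omega,\mathcal F,P)$ be the classical Wiener space: $\Omega=C_0([0,T];\mathbb{R}^d)$, $P$ Wiener measure, $\mathcal F$ the completed Borel $\sigma$-algebra, $B_s(\omega)=\omega_s$, and $\mathcal F_s=\sigma\{B_r,r\le s\}\vee\mathcal N_P$ ($\mathcal N_P$ the $P$-null sets), $\mathbb F=(\mathcal F_s)$. $\mathcal S^2$ denotes $\mathbb F$-adapted continuous processes with square-integrable supremum; $\mathcal H^2$ the $\mathbb F$-progressively measurable processes in $L^2(dt\otimes dP)$. $U$ is a compact metric space; $\mathcal U_{t,s}$ is the set of $U$-valued $\mathbb F$-progressively measurable processes on $[t,s]$. Coefficients: deterministic maps $b,\sigma,f:[0,T]\times\mathbb R^n\times\mathbb R\times\mathbb R^d\times U\to\mathbb R^n,\ \mathbb R^{n\times d},\ \mathbb R$ respectively, and $\Phi:\mathbb R^n\to\mathbb R$, continuous in $(t,u)$. Fix a full-rank $1\times n$ matrix $G$; for $\lambda=(x,y,z)$ put $A(t,\lambda,u)=(-G^Tf,Gb,G\sigma)(t,\lambda,u)$. For each $u$: $A(t,\lambda,u)$ is uniformly Lipschitz in $\lambda$ and $A(\cdot,\lambda,u)\in\mathcal H^2$ on $[0,T]$ for each $\lambda$; $\Phi$ is Lipschitz. For all $t,u,\lambda=(x,y,z),\bar\lambda=(\bar x,\bar y,\bar z)$, with $\hat x=x-\bar x$ etc.: (i) $\langle A(t,\lambda,u)-A(t,\bar\lambda,u),\lambda-\bar\lambda\rangle\le-\beta_1|G\hat x|^2-\beta_2(|G^T\hat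 y|^2+|G^T\hat z|^2)$; (ii) $\langle\Phi(x)-\Phi(\bar x),G\hat x\rangle\ge\mu_1|G\hat x|^2$; where $\beta_1,\beta_2,\mu_1\ge0$, $\beta_1+\beta_2>0$, $\beta_2+\mu_1>0$, and $\beta_2>0$ if $n>1$. There is $K\ge0$ with $|l(t,x_1,y_1,z_1,u)-l(t,x_2,y_2,z_2,u)|\le K(|x_1-x_2|+|y_1-y_2|+|z_1-z_2|)$ for $l=b,\sigma,f$, and $|\Phi(x_1)-\Phi(x_2)|\le K|x_1-x_2|$. For $u\in\mathcal U_{t,T}$, $x\in\mathbb R^n$, let $(X^{t,x;u},Y^{t,x;u},Z^{t,x;u})\in\mathcal S^2\times\mathcal S^2\times\mathcal H^2$ be the unique solution on $[t,T]$ of $dX_s=b(s,X_s,Y_s,Z_s,u_s)ds+\sigma(s,X_s,Y_s,Z_s,u_s)dB_s$, $dY_s=-f(s,X_s,Y_s,Z_s,u_s)ds+Z_sdB_s$, $X_t=x$, $Y_T=\Phi(X_T)$. Put $J(t,x;u)=Y_t^{t,x;u}$ and $W(t,x)=\operatorname{ess\,sup}_{u\in\mathcal U_{t,T}}J(t,x;u)$; $W$ is a deterministic function. *)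

theory Defs
  imports "HOL-Probability.Probability"
begin

section \<open>Classical Wiener space\<close>

type_synonym 'd path = "real \<Rightarrow> real^'d"

text \<open>\<open>C\<^sub>0([0,T];\<real>\<^sup>d)\<close> with the supremum metric; paths are extensional, i.e. \<open>undefined\<close> off
  \<open>[0,T]\<close>.\<close>

definition wiener_space :: "real \<Rightarrow> ('d::finite path) metric" where
  "wiener_space T =
     submetric (cfunspace (top_of_set {0..T}) euclidean_metric) {\<omega>. \<omega> 0 = 0}"

definition wiener_borel :: "real \<Rightarrow> ('d::finite path) measure" where
  "wiener_borel T =
     sigma (mspace (wiener_space T)) {A. openin (mtopology_of (wiener_space T)) A}"

definition raw_filtration :: "('d::finite path) measure \<Rightarrow> real \<Rightarrow> ('d path) measure" where
  "raw_filtration P s =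
     sigma (space P) {(\<lambda>\<omega>. \<omega> r) -` A \<inter> space P | r A. r \<in> {0..s} \<and> A \<in> sets borel}"

text \<open>Wiener measure is characterised as the law on path space under which the coordinate process
  is a \<open>d\<close>-dimensional Brownian motion: \<open>B\<^sub>t - B\<^sub>s\<close> is independent of \<open>\<sigma>{B\<^sub>r. r \<le> s}\<close> and is
  \<open>N(0, (t-s) I\<^sub>d)\<close>-distributed, the latter expressed through independent Gaussian components.\<close>

definition wiener_measure :: "real \<Rightarrow> ('d::finite path) measure \<Rightarrow> bool" where
  "wiener_measure T P \<longleftrightarrow>
     prob_space P \<and> space P = mspace (wiener_space T) \<and> sets P = sets (wiener_borel T) \<and>
     (\<forall>s t. 0 \<le> s \<and> s < t \<and> t \<le> T \<longrightarrow>
        (\<forall>j. distributed P lborel (\<lambda>\<omega>. (\<omega> t - \<omega> s) $ j) (normal_density 0 (sqrt (t - s)))) \<and>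
        prob_space.indep_vars P (\<lambda>_. borel) (\<lambda>j \<omega>. (\<omega> t - \<omega> s) $ j) UNIV \<and>
        prob_space.indep_set P
          (sets (raw_filtration P s))
          {(\<lambda>\<omega>. \<omega> t - \<omega> s) -` A \<inter> space P | A. A \<in> sets borel})"

text \<open>Throughout, \<open>P\<close> lives on the Borel sets of path space, and the probability space of the
  setting, with the completed \<open>\<sigma>\<close>-algebra, is \<open>completion P\<close>.\<close>

definition wiener_filtration :: "('d::finite path) measure \<Rightarrow> real \<Rightarrow> ('d path) measure" where
  "wiener_filtration P s =
     sigma (space P)
       ({(\<lambda>\<omega>. \<omega> r) -` A \<inter> space P | r A. r \<in> {0..s} \<and> A \<in> sets borel}
        \<union> null_sets (completion P))"

section \<open>Spaces of processes on \<open>[t,s]\<close>\<close>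

definition progressive ::
  "('d::finite path) measure \<Rightarrow> real \<Rightarrow> real \<Rightarrow> (real \<Rightarrow> 'd path \<Rightarrow> 'b::topological_space) \<Rightarrow> bool"
where
  "progressive P t s X \<longleftrightarrow>
     (\<forall>s'\<in>{t..s}. (\<lambda>(r, \<omega>). X r \<omega>)
        \<in> borel_measurable (restrict_space borel {t..s'} \<Otimes>\<^sub>M wiener_filtration P s'))"

definition adapted_continuous ::
  "('d::finite path) measure \<Rightarrow> real \<Rightarrow> real \<Rightarrow> (real \<Rightarrow> 'd path \<Rightarrow> 'b::topological_space) \<Rightarrow> bool"
where
  "adapted_continuous P t s X \<longleftrightarrow>
     (\<forall>r\<in>{t..s}. X r \<in> borel_measurable (wiener_filtration P r)) \<and>
     (\<forall>\<omega>\<in>space P. continuous_on {t..s} (\<lambda>r. X r \<omega>))"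

definition S2 ::
  "('d::finite path) measure \<Rightarrow> real \<Rightarrow> real \<Rightarrow> (real \<Rightarrow> 'd path \<Rightarrow> 'b::real_normed_vector) set"
where
  "S2 P t s = {X. adapted_continuous P t s X \<and>
     (\<integral>\<^sup>+\<omega>. (SUP r\<in>{t..s}. ennreal ((norm (X r \<omega>))\<^sup>2)) \<partial>completion P) < \<infinity>}"

definition L2_dt_dP ::
  "('d::finite path) measure \<Rightarrow> real \<Rightarrow> real \<Rightarrow> (real \<Rightarrow> 'd path \<Rightarrow> 'b::real_normed_vector) \<Rightarrow> ennreal"
where
  "L2_dt_dP P t s X =
     (\<integral>\<^sup>+(r, \<omega>). ennreal ((norm (X r \<omega>))\<^sup>2)
        \<partial>(restrict_space lborel {t..s} \<Otimes>\<^sub>M completion P))"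

definition H2 ::
  "('d::finite path) measure \<Rightarrow> real \<Rightarrow> real \<Rightarrow> (real \<Rightarrow> 'd path \<Rightarrow> 'b::real_normed_vector) set"
where
  "H2 P t s = {X. progressive P t s X \<and> L2_dt_dP P t s X < \<infinity>}"

definition controls ::
  "('d::finite path) measure \<Rightarrow> 'u::metric_space set \<Rightarrow> real \<Rightarrow> real \<Rightarrow> (real \<Rightarrow> 'd path \<Rightarrow> 'u) set"
where
  "controls P U t s =
     {u. progressive P t s u \<and> (\<forall>r\<in>{t..s}. \<forall>\<omega>\<in>space P. u r \<omega> \<in> U)}"

section \<open>Ito integral with respect to the coordinate process\<close>

text \<open>A simple integrand is \<open>\<Sum>i<N. \<xi>\<^sub>i 1\<^bsub>(\<tau>\<^sub>i, \<tau>\<^sub>i\<^sub>+\<^sub>1]\<^esub>\<close> with \<open>\<xi>\<^sub>i\<close> bounded and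
  \<open>\<F>\<^bsub>\<tau>\<^sub>i\<^esub>\<close>-measurable.\<close>

definition simple_integrand ::
  "('d::finite path) measure \<Rightarrow> real \<Rightarrow> real \<Rightarrow> nat \<Rightarrow> (nat \<Rightarrow> real) \<Rightarrow> (nat \<Rightarrow> 'd path \<Rightarrow> real^'d) \<Rightarrow> bool"
where
  "simple_integrand P t s N \<tau> \<xi> \<longleftrightarrow>
     t \<le> \<tau> 0 \<and> \<tau> N \<le> s \<and> (\<forall>i<N. \<tau> i \<le> \<tau> (Suc i)) \<and>
     (\<forall>i<N. \<xi> i \<in> borel_measurable (wiener_filtration P (\<tau> i)) \<and>
            (\<exists>C. \<forall>\<omega>\<in>space P. norm (\<xi> i \<omega>) \<le> C))"

definition simple_process ::
  "nat \<Rightarrow> (nat \<Rightarrow> real) \<Rightarrow> (nat \<Rightarrow> 'd path \<Rightarrow> real^'d) \<Rightarrow> real \<Rightarrow> 'd::finite path \<Rightarrow> real^'d"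
where
  "simple_process N \<tau> \<xi> r \<omega> = (\<Sum>i<N. indicator {\<tau> i<..\<tau> (Suc i)} r *\<^sub>R \<xi> i \<omega>)"

definition simple_integral ::
  "nat \<Rightarrow> (nat \<Rightarrow> real) \<Rightarrow> (nat \<Rightarrow> 'd path \<Rightarrow> real^'d) \<Rightarrow> real \<Rightarrow> 'd::finite path \<Rightarrow> real"
where
  "simple_integral N \<tau> \<xi> r \<omega> = (\<Sum>i<N. \<xi> i \<omega> \<bullet> (\<omega> (min (\<tau> (Suc i)) r) - \<omega> (min (\<tau> i) r)))"

text \<open>\<open>has_ito_integral P t s H I\<close>: the continuous process \<open>I\<^sub>r = \<integral>\<^sub>t\<^sup>r H dB\<close>, \<open>r \<in> [t,s]\<close>, of the
  row-vector valued \<open>H \<in> \<H>\<^sup>2\<close>, as the \<open>L\<^sup>2\<close> limit of the integrals of simple integrands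
  converging to \<open>H\<close>. It determines \<open>I\<close> up to indistinguishability.\<close>

definition has_ito_integral ::
  "('d::finite path) measure \<Rightarrow> real \<Rightarrow> real
     \<Rightarrow> (real \<Rightarrow> 'd path \<Rightarrow> real^'d) \<Rightarrow> (real \<Rightarrow> 'd path \<Rightarrow> real) \<Rightarrow> bool"
where
  "has_ito_integral P t s H I \<longleftrightarrow>
     H \<in> H2 P t s \<and> adapted_continuous P t s I \<and>
     (\<exists>N \<tau> \<xi>. (\<forall>k. simple_integrand P t s (N k) (\<tau> k) (\<xi> k)) \<and>
        (\<lambda>k. L2_dt_dP P t s (\<lambda>r \<omega>. H r \<omega> - simple_process (N k) (\<tau> k) (\<xi> k) r \<omega>))
           \<longlonglongrightarrow> 0 \<and>
        (\<forall>r\<in>{t..s}.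
           (\<lambda>k. \<integral>\<^sup>+\<omega>. ennreal ((I r \<omega> - simple_integral (N k) (\<tau> k) (\<xi> k) r \<omega>)\<^sup>2)
                  \<partial>completion P) \<longlonglongrightarrow> 0))"

section \<open>The controlled forward-backward equation\<close>

definition fbsde_solution ::
  "real \<Rightarrow> ('d::finite path) measure
     \<Rightarrow> (real \<Rightarrow> real^'n \<Rightarrow> real \<Rightarrow> real^'d \<Rightarrow> 'u \<Rightarrow> real^'n::finite)
     \<Rightarrow> (real \<Rightarrow> real^'n \<Rightarrow> real \<Rightarrow> real^'d \<Rightarrow> 'u \<Rightarrow> real^'d^'n)
     \<Rightarrow> (real \<Rightarrow> real^'n \<Rightarrow> real \<Rightarrow> real^'d \<Rightarrow> 'u \<Rightarrow> real)
     \<Rightarrow> (real^'n \<Rightarrow> real)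
     \<Rightarrow> real \<Rightarrow> real^'n \<Rightarrow> (real \<Rightarrow> 'd path \<Rightarrow> 'u)
     \<Rightarrow> (real \<Rightarrow> 'd path \<Rightarrow> real^'n) \<Rightarrow> (real \<Rightarrow> 'd path \<Rightarrow> real) \<Rightarrow> (real \<Rightarrow> 'd path \<Rightarrow> real^'d) \<Rightarrow> bool"
where
  "fbsde_solution T P b \<sigma> f \<Phi> t x u X Y Z \<longleftrightarrow>
     X \<in> S2 P t T \<and> Y \<in> S2 P t T \<and> Z \<in> H2 P t T \<and>
     (\<exists>I L.
        (\<forall>i. has_ito_integral P t T (\<lambda>r \<omega>. \<sigma> r (X r \<omega>) (Y r \<omega>) (Z r \<omega>) (u r \<omega>) $ i) (I i)) \<and>
        has_ito_integral P t T Z L \<and>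
        (AE \<omega> in completion P. \<forall>s\<in>{t..T}.
           X s \<omega> = X t \<omega> + (LBINT r:{t..s}. b r (X r \<omega>) (Y r \<omega>) (Z r \<omega>) (u r \<omega>)) + (\<chi> i. I i s \<omega>) \<and>
           Y s \<omega> = Y t \<omega> - (LBINT r:{t..s}. f r (X r \<omega>) (Y r \<omega>) (Z r \<omega>) (u r \<omega>)) + L s \<omega>)) \<and>
     (AE \<omega> in completion P. X t \<omega> = x) \<and>
     (AE \<omega> in completion P. Y T \<omega> = \<Phi> (X T \<omega>))"

text \<open>\<open>J(t,x;u) = Y\<^sub>t\<^bsup>t,x;u\<^esup>\<close>; here \<open>Y t x u\<close> is the process \<open>Y\<^bsup>t,x;u\<^esup>\<close>.\<close>

definition cost_functional ::
  "(real \<Rightarrow> real^'n \<Rightarrow> (real \<Rightarrow> 'd path \<Rightarrow> 'u) \<Rightarrow> real \<Rightarrow> 'd path \<Rightarrow> real)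
     \<Rightarrow> real \<Rightarrow> real^'n::finite \<Rightarrow> (real \<Rightarrow> 'd::finite path \<Rightarrow> 'u) \<Rightarrow> 'd path \<Rightarrow> real"
where
  "cost_functional Y t x u = Y t x u t"

definition is_ess_sup :: "'a measure \<Rightarrow> 'i set \<Rightarrow> ('i \<Rightarrow> 'a \<Rightarrow> real) \<Rightarrow> ('a \<Rightarrow> real) \<Rightarrow> bool" where
  "is_ess_sup M A \<xi> \<eta> \<longleftrightarrow>
     \<eta> \<in> borel_measurable M \<and> (\<forall>i\<in>A. AE \<omega> in M. \<xi> i \<omega> \<le> \<eta> \<omega>) \<and>
     (\<forall>\<eta>'\<in>borel_measurable M. (\<forall>i\<in>A. AE \<omega> in M. \<xi> i \<omega> \<le> \<eta>' \<omega>) \<longrightarrow> (AE \<omega> in M. \<eta> \<omega> \<le> \<eta>' \<omega>))"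

section \<open>Coefficients\<close>

definition lipschitz_xyz ::
  "real \<Rightarrow> 'u set \<Rightarrow> real
     \<Rightarrow> (real \<Rightarrow> 'x::real_normed_vector \<Rightarrow> real \<Rightarrow> 'z::real_normed_vector \<Rightarrow> 'u \<Rightarrow> 'v::real_normed_vector)
     \<Rightarrow> bool"
where
  "lipschitz_xyz T U K l \<longleftrightarrow>
     (\<forall>t\<in>{0..T}. \<forall>u\<in>U. \<forall>x\<^sub>1 x\<^sub>2 y\<^sub>1 y\<^sub>2 z\<^sub>1 z\<^sub>2.
        norm (l t x\<^sub>1 y\<^sub>1 z\<^sub>1 u - l t x\<^sub>2 y\<^sub>2 z\<^sub>2 u)
          \<le> K * (norm (x\<^sub>1 - x\<^sub>2) + \<bar>y\<^sub>1 - y\<^sub>2\<bar> + norm (z\<^sub>1 - z\<^sub>2)))"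

text \<open>\<open>A = (-G\<^sup>T f, G b, G \<sigma>)\<close>. The second and third components are a \<open>1 \<times> 1\<close> and a \<open>1 \<times> d\<close>
  matrix, identified with elements of \<open>\<real>\<close> and \<open>\<real>\<^sup>d\<close> by taking row \<open>1\<close>.\<close>

definition coeff_A ::
  "real^'n^1
     \<Rightarrow> (real \<Rightarrow> real^'n \<Rightarrow> real \<Rightarrow> real^'d \<Rightarrow> 'u \<Rightarrow> real^'n::finite)
     \<Rightarrow> (real \<Rightarrow> real^'n \<Rightarrow> real \<Rightarrow> real^'d \<Rightarrow> 'u \<Rightarrow> real^'d^'n)
     \<Rightarrow> (real \<Rightarrow> real^'n \<Rightarrow> real \<Rightarrow> real^'d::finite \<Rightarrow> 'u \<Rightarrow> real)
     \<Rightarrow> real \<Rightarrow> (real^'n) \<times> real \<times> (real^'d) \<Rightarrow> 'u \<Rightarrow> (real^'n) \<times> real \<times> (real^'d)"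
where
  "coeff_A G b \<sigma> f t v u = (case v of (x, y, z) \<Rightarrow>
     (- (transpose G *v vec (f t x y z u)), (G *v b t x y z u) $ 1, (G ** \<sigma> t x y z u) $ 1))"

end

theory Submission
  imports Defs
begin

text \<open>
  Fix a control and let \<open>(X, Y, Z)\<close>, \<open>(X', Y', Z')\<close> solve the system from the initial values
  \<open>x\<close>, \<open>x'\<close>. Put \<open>\<xi> = G (X - X')\<close> and \<open>\<eta> = Y - Y'\<close>. By Ito's product rule the drift of \<open>\<xi> \<eta>\<close> is
  \<open>\<langle>A(s, \<lambda>, u) - A(s, \<lambda>', u), \<lambda> - \<lambda>'\<rangle>\<close>, which is nonpositive by monotonicity, and its terminal
  value \<open>(\<Phi>(X\<^sub>T) - \<Phi>(X'\<^sub>T)) G (X\<^sub>T - X'\<^sub>T)\<close> is nonnegative. So \<open>\<xi>\<^sub>t \<eta>\<^sub>t\<close> dominates the conditional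
  expectation of a nonnegative variable given \<open>\<F>\<^sub>t\<close>, and \<open>\<xi>\<^sub>t = G (x - x')\<close> is deterministic. This is
  the claim for the cost (\<open>fbsde_solution_monotone\<close>). It compares the costs control by control,
  hence also their essential suprema.

  The conditional expectation is replaced by expectations over events \<open>A \<in> \<F>\<^sub>t\<close>, so the product rule
  is needed only in expectation (\<open>expected_product_formula\<close>), and no pathwise stochastic calculus
  is involved. Both processes are split into a drift and a martingale part.
  Drift times drift is the product rule for primitives. In drift times martingale, say \<open>c\<close> and \<open>M\<close>, the
  drift at time \<open>s\<close> is known at time \<open>s\<close>, so \<open>M\<^sub>s\<close> may be replaced by \<open>M\<^sub>T\<close> in the expectation of
  \<open>\<integral> c\<^sub>s M\<^sub>s ds\<close> (\<open>martingale_drift_orthogonal\<close>). Martingale times martingale is the Ito isometry,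
  localised to \<open>A\<close> and polarised (\<open>ito_isometry\<close>).

  Isometry and martingale property come from simple integrands, where they express that the
  increments of the coordinate process are centred, have covariance \<open>(t - s) I\<close>, and are independent
  of the past even after the past is augmented by the null sets (\<open>increment_indep_augmented\<close>). They
  pass to the \<open>L\<^sup>2\<close> limit that defines the integral (\<open>integral_inner_tendsto\<close>).

  What remains is measurability of the drifts \<open>b(s, X\<^sub>s, Y\<^sub>s, Z\<^sub>s, u\<^sub>s)\<close> and \<open>f(s, X\<^sub>s, Y\<^sub>s, Z\<^sub>s, u\<^sub>s)\<close>,
  jointly and at fixed times. The coefficients are continuous in the control and jointly continuous
  in the other variables, and a compact control set is separable (\<open>caratheodory_measurable\<close>).
\<close>

section \<open>Square-integrable functions\<close>

text \<open>
  Functions are not identified when they agree almost everywhere, since processes are evaluated at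
  individual times and paths.
\<close>

definition sqint :: "'a measure \<Rightarrow> ('a \<Rightarrow> 'b::euclidean_space) \<Rightarrow> bool" where
  "sqint M f \<longleftrightarrow> f \<in> borel_measurable M \<and> integrable M (\<lambda>x. (norm (f x))\<^sup>2)"

lemma sqint_measurable [measurable_dest]: "sqint M f \<Longrightarrow> f \<in> borel_measurable M"
  by (simp add: sqint_def)

lemma sqint_integrable_norm_sq: "sqint M f \<Longrightarrow> integrable M (\<lambda>x. (norm (f x))\<^sup>2)"
  by (simp add: sqint_def)

lemma sqint_iff_nn:
  fixes f :: "'a \<Rightarrow> 'b::euclidean_space"
  assumes "f \<in> borel_measurable M"
  shows "sqint M f \<longleftrightarrow> (\<integral>\<^sup>+x. ennreal ((norm (f x))\<^sup>2) \<partial>M) < \<infinity>"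
  using assms by (auto simp: sqint_def integrable_iff_bounded)

lemma norm_mult_le_half_squares: "a * b \<le> (a\<^sup>2 + b\<^sup>2) / 2" for a b :: real
  using sum_squares_bound[of a b] by simp

lemma sqint_integrable_norm_mult:
  assumes f: "sqint M f" and g: "sqint M g"
  shows "integrable M (\<lambda>x. norm (f x) * norm (g x))"
proof (rule Bochner_Integration.integrable_bound)
  show "integrable M (\<lambda>x. ((norm (f x))\<^sup>2 + (norm (g x))\<^sup>2) / 2)"
    using f g by (simp add: sqint_def)
  show "(\<lambda>x. norm (f x) * norm (g x)) \<in> borel_measurable M"
    using f g by measurable
  show "AE x in M. norm (norm (f x) * norm (g x)) \<le> norm (((norm (f x))\<^sup>2 + (norm (g x))\<^sup>2) / 2)"
    by (rule AE_I2) (use norm_mult_le_half_squares in auto)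
qed

lemma sqint_integrable_inner:
  assumes f: "sqint M f" and g: "sqint M g"
  shows "integrable M (\<lambda>x. f x \<bullet> g x)"
proof (rule Bochner_Integration.integrable_bound[OF sqint_integrable_norm_mult[OF f g]])
  show "(\<lambda>x. f x \<bullet> g x) \<in> borel_measurable M"
    using f g by measurable
  show "AE x in M. norm (f x \<bullet> g x) \<le> norm (norm (f x) * norm (g x))"
    by (rule AE_I2) (use Cauchy_Schwarz_ineq2 in auto)
qed

lemma sqint_integrable_mult:
  fixes f g :: "'a \<Rightarrow> real"
  shows "sqint M f \<Longrightarrow> sqint M g \<Longrightarrow> integrable M (\<lambda>x. f x * g x)"
  using sqint_integrable_inner[of M f g] by simp

lemma integrable_weight:
  fixes w :: "'a \<Rightarrow> real" and f :: "'a \<Rightarrow> 'b::{banach, second_countable_topology}"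
  assumes f: "integrable M f" and w: "w \<in> borel_measurable M" and b: "AE x in M. \<bar>w x\<bar> \<le> c"
  shows "integrable M (\<lambda>x. w x *\<^sub>R f x)"
proof (rule Bochner_Integration.integrable_bound)
  show "integrable M (\<lambda>x. c *\<^sub>R f x)" using f by simp
  show "(\<lambda>x. w x *\<^sub>R f x) \<in> borel_measurable M" using f w by measurable
  show "AE x in M. norm (w x *\<^sub>R f x) \<le> norm (c *\<^sub>R f x)"
    using b by eventually_elim (auto intro!: mult_right_mono)
qed

lemma sqint_bound:
  fixes f :: "'a \<Rightarrow> 'b::euclidean_space" and g :: "'a \<Rightarrow> 'c::euclidean_space"
  assumes g: "sqint M g" and f: "f \<in> borel_measurable M"
    and b: "AE x in M. norm (f x) \<le> norm (g x)"
  shows "sqint M f"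
  unfolding sqint_def
proof
  show "integrable M (\<lambda>x. (norm (f x))\<^sup>2)"
  proof (rule Bochner_Integration.integrable_bound[OF sqint_integrable_norm_sq[OF g]])
    show "(\<lambda>x. (norm (f x))\<^sup>2) \<in> borel_measurable M" using f by measurable
    show "AE x in M. norm ((norm (f x))\<^sup>2) \<le> norm ((norm (g x))\<^sup>2)"
      using b by eventually_elim (auto intro!: power_mono)
  qed
qed fact

lemma sqint_norm: "sqint M f \<Longrightarrow> sqint M (\<lambda>x. norm (f x))"
  by (rule sqint_bound[of M f]) auto

lemma sqint_scaleR: "sqint M f \<Longrightarrow> sqint M (\<lambda>x. c *\<^sub>R f x)"
  by (auto simp: sqint_def power_mult_distrib)

lemma sqint_cmult: fixes f :: "'a \<Rightarrow> real" shows "sqint M f \<Longrightarrow> sqint M (\<lambda>x. c * f x)"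
  using sqint_scaleR[of M f c] by simp

lemma sqint_add:
  assumes f: "sqint M f" and g: "sqint M g" shows "sqint M (\<lambda>x. f x + g x)"
  unfolding sqint_def
proof
  show m: "(\<lambda>x. f x + g x) \<in> borel_measurable M" using f g by measurable
  show "integrable M (\<lambda>x. (norm (f x + g x))\<^sup>2)"
  proof (rule Bochner_Integration.integrable_bound)
    show "integrable M (\<lambda>x. 2 * (norm (f x))\<^sup>2 + 2 * (norm (g x))\<^sup>2)"
      using f g by (simp add: sqint_def)
    show "AE x in M. norm ((norm (f x + g x))\<^sup>2) \<le> norm (2 * (norm (f x))\<^sup>2 + 2 * (norm (g x))\<^sup>2)"
    proof (rule AE_I2)
      fix x
      have "(norm (f x + g x))\<^sup>2 \<le> (norm (f x) + norm (g x))\<^sup>2"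
        by (intro power_mono norm_triangle_ineq norm_ge_zero)
      also have "\<dots> \<le> 2 * (norm (f x))\<^sup>2 + 2 * (norm (g x))\<^sup>2"
        using sum_squares_bound[of "norm (f x)" "norm (g x)"] by (simp add: power2_sum)
      finally show "norm ((norm (f x + g x))\<^sup>2) \<le> norm (2 * (norm (f x))\<^sup>2 + 2 * (norm (g x))\<^sup>2)"
        by simp
    qed
  qed (use m in measurable)
qed

lemma sqint_diff: "sqint M f \<Longrightarrow> sqint M g \<Longrightarrow> sqint M (\<lambda>x. f x - g x)"
  using sqint_add[of M f "\<lambda>x. (-1) *\<^sub>R g x"] sqint_scaleR[of M g "-1"] by simp

lemma sqint_zero [simp]: "sqint M (\<lambda>x. 0)"
  by (simp add: sqint_def)

lemma sqint_sum: "(\<And>i. i \<in> I \<Longrightarrow> sqint M (f i)) \<Longrightarrow> sqint M (\<lambda>x. \<Sum>i\<in>I. f i x)"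
  by (induction I rule: infinite_finite_induct) (auto intro: sqint_add)

lemma sqint_weight:
  assumes f: "sqint M f" and w: "w \<in> borel_measurable M" and b: "AE x in M. \<bar>w x\<bar> \<le> c"
  shows "sqint M (\<lambda>x. w x *\<^sub>R f x)"
proof (rule sqint_bound[OF sqint_scaleR[OF f, of c]])
  show "(\<lambda>x. w x *\<^sub>R f x) \<in> borel_measurable M" using f w by measurable
  show "AE x in M. norm (w x *\<^sub>R f x) \<le> norm (c *\<^sub>R f x)"
    using b by eventually_elim (auto intro!: mult_right_mono)
qed

lemma (in finite_measure) sqint_const [simp]: "sqint M (\<lambda>x. c)"
  by (simp add: sqint_def)

lemma (in finite_measure) sqint_bounded:
  assumes "f \<in> borel_measurable M" "AE x in M. norm (f x) \<le> c"
  shows "sqint M f"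
proof (rule sqint_bound[OF sqint_const[of c]])
  show "AE x in M. norm (f x) \<le> norm c" using assms(2) by eventually_elim auto
qed fact

lemma (in finite_measure) sqint_integrable:
  assumes f: "sqint M f" shows "integrable M f"
proof -
  have "integrable M (\<lambda>x. norm (f x) * norm (1::real))"
    by (rule sqint_integrable_norm_mult[OF f sqint_const])
  then show ?thesis using f by (simp add: sqint_def integrable_norm_iff)
qed

lemma sqint_Cauchy_Schwarz:
  assumes f: "sqint M f" and g: "sqint M g"
  shows "(\<integral>x. norm (f x) * norm (g x) \<partial>M) \<le> sqrt (\<integral>x. (norm (f x))\<^sup>2 \<partial>M) * sqrt (\<integral>x. (norm (g x))\<^sup>2 \<partial>M)"
proof -
  let ?I = "\<integral>x. norm (f x) * norm (g x) \<partial>M"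
  let ?a = "\<integral>x. (norm (f x))\<^sup>2 \<partial>M" and ?b = "\<integral>x. (norm (g x))\<^sup>2 \<partial>M"
  have I0: "?I \<ge> 0" by simp
  have "(\<integral>\<^sup>+x. ennreal (norm (f x)) * ennreal (norm (g x)) \<partial>M)\<^sup>2
      \<le> (\<integral>\<^sup>+x. (ennreal (norm (f x)))\<^sup>2 \<partial>M) * (\<integral>\<^sup>+x. (ennreal (norm (g x)))\<^sup>2 \<partial>M)"
    using sqint_measurable[OF f] sqint_measurable[OF g] by (intro Cauchy_Schwarz_nn_integral) auto
  also have "(\<integral>\<^sup>+x. (ennreal (norm (f x)))\<^sup>2 \<partial>M) = ennreal ?a"
    using f by (simp add: ennreal_power nn_integral_eq_integral sqint_def)
  also have "(\<integral>\<^sup>+x. (ennreal (norm (g x)))\<^sup>2 \<partial>M) = ennreal ?b"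
    using g by (simp add: ennreal_power nn_integral_eq_integral sqint_def)
  also have "(\<integral>\<^sup>+x. ennreal (norm (f x)) * ennreal (norm (g x)) \<partial>M) = ennreal ?I"
    using sqint_integrable_norm_mult[OF f g]
    by (simp add: ennreal_mult[symmetric] nn_integral_eq_integral)
  finally have "ennreal (?I\<^sup>2) \<le> ennreal (?a * ?b)"
    using I0 by (simp add: ennreal_power ennreal_mult)
  then have "?I\<^sup>2 \<le> ?a * ?b" by (simp add: ennreal_le_iff)
  then have "?I \<le> sqrt (?a * ?b)" by (rule real_le_rsqrt)
  then show ?thesis by (simp add: real_sqrt_mult)
qed

lemma sqint_weighted_Cauchy_Schwarz:
  assumes f: "sqint M f" and g: "sqint M g"
    and w: "w \<in> borel_measurable M" "AE x in M. \<bar>w x\<bar> \<le> 1"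
  shows "\<bar>\<integral>x. w x * (f x \<bullet> g x) \<partial>M\<bar> \<le> sqrt (\<integral>x. (norm (f x))\<^sup>2 \<partial>M) * sqrt (\<integral>x. (norm (g x))\<^sup>2 \<partial>M)"
proof -
  have "\<bar>\<integral>x. w x * (f x \<bullet> g x) \<partial>M\<bar> \<le> (\<integral>x. norm (f x) * norm (g x) \<partial>M)"
  proof (rule order.trans[OF integral_abs_bound integral_mono_AE])
    show "integrable M (\<lambda>x. \<bar>w x * (f x \<bullet> g x)\<bar>)"
      using integrable_weight[OF sqint_integrable_inner[OF f g] w] by simp
    show "integrable M (\<lambda>x. norm (f x) * norm (g x))"
      by (rule sqint_integrable_norm_mult[OF f g])
    show "AE x in M. \<bar>w x * (f x \<bullet> g x)\<bar> \<le> norm (f x) * norm (g x)"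
      using w(2)
    proof eventually_elim
      case (elim x)
      have "\<bar>w x * (f x \<bullet> g x)\<bar> \<le> 1 * (norm (f x) * norm (g x))"
        unfolding abs_mult by (intro mult_mono elim Cauchy_Schwarz_ineq2) auto
      then show ?case by simp
    qed
  qed
  also note sqint_Cauchy_Schwarz[OF f g]
  finally show ?thesis .
qed

text \<open>
  Writing \<open>fs k = f - (f - fs k)\<close> and likewise for \<open>gs k\<close>, the error is a sum of three pairings, each
  with an \<open>L\<^sup>2\<close>-small factor. The weight \<open>w\<close> serves to restrict the pairing to an event.
\<close>

lemma integral_inner_tendsto:
  assumes f: "sqint M f" "\<And>k. sqint M (fs k)"
    and g: "sqint M g" "\<And>k. sqint M (gs k)"
    and w: "w \<in> borel_measurable M" "AE x in M. \<bar>w x\<bar> \<le> 1"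
    and fl: "(\<lambda>k. \<integral>\<^sup>+x. ennreal ((norm (f x - fs k x))\<^sup>2) \<partial>M) \<longlonglongrightarrow> 0"
    and gl: "(\<lambda>k. \<integral>\<^sup>+x. ennreal ((norm (g x - gs k x))\<^sup>2) \<partial>M) \<longlonglongrightarrow> 0"
  shows "(\<lambda>k. \<integral>x. w x * (fs k x \<bullet> gs k x) \<partial>M) \<longlonglongrightarrow> (\<integral>x. w x * (f x \<bullet> g x) \<partial>M)"
proof -
  define N where "N h = sqrt (\<integral>x. (norm (h x))\<^sup>2 \<partial>M)" for h :: "_ \<Rightarrow> 'b"
  define df where "df k x = f x - fs k x" for k x
  define dg where "dg k x = g x - gs k x" for k x
  have sdf: "sqint M (df k)" for k unfolding df_def using f by (intro sqint_diff)
  have sdg: "sqint M (dg k)" for k unfolding dg_def using g by (intro sqint_diff)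
  have lim: "(\<lambda>k. N (h k)) \<longlonglongrightarrow> 0" if "\<And>k. sqint M (h k)"
    "(\<lambda>k. \<integral>\<^sup>+x. ennreal ((norm (h k x))\<^sup>2) \<partial>M) \<longlonglongrightarrow> 0" for h
  proof -
    have "(\<lambda>k. ennreal (\<integral>x. (norm (h k x))\<^sup>2 \<partial>M)) \<longlonglongrightarrow> ennreal 0"
      using that(2) by (simp add: nn_integral_eq_integral sqint_integrable_norm_sq that(1))
    then have "(\<lambda>k. \<integral>x. (norm (h k x))\<^sup>2 \<partial>M) \<longlonglongrightarrow> 0"
      by (subst (asm) tendsto_ennreal_iff) auto
    then show ?thesis unfolding N_def using tendsto_real_sqrt by fastforce
  qed
  have Nf: "(\<lambda>k. N (df k)) \<longlonglongrightarrow> 0" by (rule lim[OF sdf]) (use fl in \<open>simp add: df_def\<close>)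
  have Ng: "(\<lambda>k. N (dg k)) \<longlonglongrightarrow> 0" by (rule lim[OF sdg]) (use gl in \<open>simp add: dg_def\<close>)
  have int: "integrable M (\<lambda>x. w x * (a x \<bullet> b x))" if "sqint M a" "sqint M b" for a b :: "_ \<Rightarrow> 'b"
    using integrable_weight[OF sqint_integrable_inner[OF that] w] by simp
  have eq: "(\<integral>x. w x * (fs k x \<bullet> gs k x) \<partial>M) = (\<integral>x. w x * (f x \<bullet> g x) \<partial>M)
      - (\<integral>x. w x * (df k x \<bullet> g x) \<partial>M) - (\<integral>x. w x * (f x \<bullet> dg k x) \<partial>M)
      + (\<integral>x. w x * (df k x \<bullet> dg k x) \<partial>M)" for k
  proof -
    have "(\<integral>x. w x * (fs k x \<bullet> gs k x) \<partial>M) = (\<integral>x. w x * (f x \<bullet> g x)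
      - w x * (df k x \<bullet> g x) - w x * (f x \<bullet> dg k x) + w x * (df k x \<bullet> dg k x) \<partial>M)"
      by (rule Bochner_Integration.integral_cong) (auto simp: df_def dg_def algebra_simps)
    also have "\<dots> = (\<integral>x. w x * (f x \<bullet> g x) \<partial>M)
      - (\<integral>x. w x * (df k x \<bullet> g x) \<partial>M) - (\<integral>x. w x * (f x \<bullet> dg k x) \<partial>M)
      + (\<integral>x. w x * (df k x \<bullet> dg k x) \<partial>M)"
      by (simp add: int f g sdf sdg)
    finally show ?thesis .
  qed
  have z: "(\<lambda>k. \<integral>x. w x * (a k x \<bullet> b k x) \<partial>M) \<longlonglongrightarrow> 0"
    if "\<And>k. sqint M (a k)" "\<And>k. sqint M (b k)" "(\<lambda>k. N (a k) * N (b k)) \<longlonglongrightarrow> 0" for a b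
  proof (rule Lim_null_comparison[OF _ that(3)], intro always_eventually allI)
    fix k show "norm (\<integral>x. w x * (a k x \<bullet> b k x) \<partial>M) \<le> N (a k) * N (b k)"
      unfolding N_def using sqint_weighted_Cauchy_Schwarz[OF that(1,2) w] by simp
  qed
  have "(\<lambda>k. \<integral>x. w x * (df k x \<bullet> g x) \<partial>M) \<longlonglongrightarrow> 0"
    by (rule z) (use sdf g Nf tendsto_mult_left_zero in auto)
  moreover have "(\<lambda>k. \<integral>x. w x * (f x \<bullet> dg k x) \<partial>M) \<longlonglongrightarrow> 0"
    by (rule z) (use sdg f Ng tendsto_mult_right_zero in auto)
  moreover have "(\<lambda>k. \<integral>x. w x * (df k x \<bullet> dg k x) \<partial>M) \<longlonglongrightarrow> 0"
    by (rule z) (use sdf sdg Nf Ng tendsto_mult_zero in auto)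
  ultimately have "(\<lambda>k. (\<integral>x. w x * (f x \<bullet> g x) \<partial>M)
      - (\<integral>x. w x * (df k x \<bullet> g x) \<partial>M) - (\<integral>x. w x * (f x \<bullet> dg k x) \<partial>M)
      + (\<integral>x. w x * (df k x \<bullet> dg k x) \<partial>M)) \<longlonglongrightarrow> (\<integral>x. w x * (f x \<bullet> g x) \<partial>M) - 0 - 0 + 0"
    by (intro tendsto_intros)
  then show ?thesis by (simp add: eq)
qed

section \<open>The augmented Brownian filtration\<close>

lemma borel_measurable_vec_iff:
  fixes f :: "'a \<Rightarrow> real^'d::finite"
  shows "f \<in> borel_measurable M \<longleftrightarrow> (\<forall>j. (\<lambda>x. f x $ j) \<in> borel_measurable M)"
  by (subst borel_measurable_euclidean_space) (auto simp: Basis_vec_def inner_axis)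

lemma Int_stable_preimages: "Int_stable {f -` A \<inter> S | A. A \<in> sets M}"
proof (rule Int_stableI, clarify)
  fix A B assume "A \<in> sets M" "B \<in> sets M"
  then show "\<exists>C. f -` A \<inter> S \<inter> (f -` B \<inter> S) = f -` C \<inter> S \<and> C \<in> sets M"
    by (intro exI[of _ "A \<inter> B"]) auto
qed

locale wiener_measure_space =
  fixes T :: real and P :: "('d::finite path) measure"
  assumes wiener: "wiener_measure T P"
begin

lemma prob_space_P: "prob_space P"
  using wiener by (simp add: wiener_measure_def)

sublocale C: prob_space "completion P"
  by (rule prob_space.prob_space_completion[OF prob_space_P])

lemma path_zero: "\<omega> \<in> space P \<Longrightarrow> \<omega> 0 = 0"
  using wiener by (auto simp: wiener_measure_def wiener_space_def)

lemma increment_distributed: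
  "0 \<le> s \<Longrightarrow> s < t \<Longrightarrow> t \<le> T \<Longrightarrow>
    distributed P lborel (\<lambda>\<omega>. (\<omega> t - \<omega> s) $ j) (normal_density 0 (sqrt (t - s)))"
  and increment_components_indep:
  "0 \<le> s \<Longrightarrow> s < t \<Longrightarrow> t \<le> T \<Longrightarrow>
    prob_space.indep_vars P (\<lambda>_. borel) (\<lambda>j \<omega>. (\<omega> t - \<omega> s) $ j) UNIV"
  and increment_indep_raw:
  "0 \<le> s \<Longrightarrow> s < t \<Longrightarrow> t \<le> T \<Longrightarrow>
    prob_space.indep_set P (sets (raw_filtration P s))
      {(\<lambda>\<omega>. \<omega> t - \<omega> s) -` A \<inter> space P | A. A \<in> sets borel}"
  using wiener unfolding wiener_measure_def by blast+

lemma increment_measurable_P: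
  assumes "0 \<le> s" "s < t" "t \<le> T"
  shows "(\<lambda>\<omega>. \<omega> t - \<omega> s) \<in> borel_measurable P"
  unfolding borel_measurable_vec_iff
  using distributed_measurable[OF increment_distributed[OF assms]] by (simp cong: measurable_cong_sets)

text \<open>
  The law of the increments determines the coordinates, because paths start at \<open>0\<close>.
\<close>

lemma coordinate_measurable_P:
  assumes "0 \<le> r" "r \<le> T" shows "(\<lambda>\<omega>. \<omega> r) \<in> borel_measurable P"
proof (cases "r = 0")
  case True
  then show ?thesis by (subst measurable_cong[where g="\<lambda>_. 0"]) (auto simp: path_zero)
next
  case False
  then have "(\<lambda>\<omega>. \<omega> r - \<omega> 0) \<in> borel_measurable P"
    using assms by (intro increment_measurable_P) auto
  then show ?thesis by (subst measurable_cong[where g="\<lambda>\<omega>. \<omega> r - \<omega> 0"]) (auto simp: path_zero)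
qed

lemma space_filtration [simp]: "space (wiener_filtration P s) = space P"
  unfolding wiener_filtration_def by (rule space_measure_of_conv)

lemma sets_raw_filtration:
  "sets (raw_filtration P s) =
     sigma_sets (space P) {(\<lambda>\<omega>. \<omega> r) -` A \<inter> space P | r A. r \<in> {0..s} \<and> A \<in> sets borel}"
  unfolding raw_filtration_def by (rule sets_measure_of) auto

lemma sets_filtration:
  "sets (wiener_filtration P s) =
     sigma_sets (space P)
       ({(\<lambda>\<omega>. \<omega> r) -` A \<inter> space P | r A. r \<in> {0..s} \<and> A \<in> sets borel}
        \<union> null_sets (completion P))"
  unfolding wiener_filtration_def
  by (rule sets_measure_of) (use sets.sets_into_space[of _ "completion P"] in \<open>auto simp: null_sets_def\<close>)

lemma filtration_mono:
  assumes "r \<le> s" shows "sets (wiener_filtration P r) \<subseteq> sets (wiener_filtration P s)"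
  unfolding sets_filtration
proof (rule sigma_sets_mono', rule Un_mono)
  show "{(\<lambda>\<omega>. \<omega> q) -` A \<inter> space P | q A. q \<in> {0..r} \<and> A \<in> sets borel}
    \<subseteq> {(\<lambda>\<omega>. \<omega> q) -` A \<inter> space P | q A. q \<in> {0..s} \<and> A \<in> sets borel}"
  proof clarify
    fix q and A :: "(real^'d) set" assume "q \<in> {0..r}" and A: "A \<in> sets borel"
    then have "q \<in> {0..s}" using assms by auto
    with A show "\<exists>q' A'. (\<lambda>\<omega>. \<omega> q) -` A \<inter> space P = (\<lambda>\<omega>. \<omega> q') -` A' \<inter> space P \<and> q' \<in> {0..s} \<and> A' \<in> sets borel"
      by (intro exI[of _ q] exI[of _ A] conjI refl)
  qed
qed auto

lemma filtration_subset_completion: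
  assumes "s \<le> T" shows "sets (wiener_filtration P s) \<subseteq> sets (completion P)"
proof -
  have "sigma_sets (space (completion P))
       ({(\<lambda>\<omega>. \<omega> r) -` A \<inter> space P | r A. r \<in> {0..s} \<and> A \<in> sets borel}
        \<union> null_sets (completion P)) \<subseteq> sets (completion P)"
    using assms measurable_sets[OF coordinate_measurable_P]
    by (intro sets.sigma_sets_subset) auto
  then show ?thesis by (simp add: sets_filtration)
qed

lemma measurable_filtration_mono:
  "f \<in> measurable (wiener_filtration P r) N \<Longrightarrow> r \<le> s \<Longrightarrow> f \<in> measurable (wiener_filtration P s) N"
  using filtration_mono[of r s] by (auto simp: measurable_def)

lemma measurable_filtration_completion:
  "f \<in> measurable (wiener_filtration P r) N \<Longrightarrow> r \<le> T \<Longrightarrow> f \<in> measurable (completion P) N"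
  using filtration_subset_completion[of r] by (auto simp: measurable_def)

lemma coordinate_adapted:
  assumes "0 \<le> r" "r \<le> s" shows "(\<lambda>\<omega>. \<omega> r) \<in> borel_measurable (wiener_filtration P s)"
proof (rule measurableI)
  fix A :: "(real^'d) set" assume "A \<in> sets borel"
  then show "(\<lambda>\<omega>. \<omega> r) -` A \<inter> space (wiener_filtration P s) \<in> sets (wiener_filtration P s)"
    unfolding sets_filtration space_filtration using assms by (intro sigma_sets.Basic) auto
qed auto

lemma increment_adapted:
  assumes "0 \<le> r" "r \<le> r'" "r' \<le> s"
  shows "(\<lambda>\<omega>. \<omega> r' - \<omega> r) \<in> borel_measurable (wiener_filtration P s)"
  by (intro borel_measurable_diff coordinate_adapted) (use assms in auto)

text \<open>
  The events that agree with an event of the raw filtration up to a null set form a \<open>\<sigma>\<close>-algebra,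
  and it contains the generators.
\<close>

lemma augmented_event_approx:
  assumes "A \<in> sets (wiener_filtration P s)"
  shows "\<exists>A0\<in>sets (raw_filtration P s). (A - A0) \<union> (A0 - A) \<in> null_sets (completion P)"
  using assms unfolding sets_filtration
proof induction
  case (Basic a)
  then show ?case
  proof
    assume "a \<in> null_sets (completion P)"
    then show ?thesis by (intro bexI[of _ "{}"]) auto
  next
    assume "a \<in> {(\<lambda>\<omega>. \<omega> r) -` A \<inter> space P | r A. r \<in> {0..s} \<and> A \<in> sets borel}"
    then have "a \<in> sets (raw_filtration P s)"
      unfolding sets_raw_filtration by (rule sigma_sets.Basic)
    then show ?thesis by (intro bexI[of _ a]) auto
  qed
next
  case Empty
  then show ?case by (intro bexI[of _ "{}"]) auto
next
  case (Compl a)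
  then obtain A0 where A0: "A0 \<in> sets (raw_filtration P s)" "(a - A0) \<union> (A0 - a) \<in> null_sets (completion P)"
    by auto
  have "space (raw_filtration P s) = space P"
    by (simp add: raw_filtration_def space_measure_of_conv)
  then have "space P - A0 \<in> sets (raw_filtration P s)" using A0(1) by (metis sets.compl_sets)
  moreover have "(space P - a - (space P - A0)) \<union> (space P - A0 - (space P - a)) \<in> null_sets (completion P)"
    by (rule null_sets_completion_subset[OF _ A0(2)]) auto
  ultimately show ?case by blast
next
  case (Union a)
  from Union.IH have "\<exists>A0. \<forall>i. A0 i \<in> sets (raw_filtration P s) \<and>
    (a i - A0 i) \<union> (A0 i - a i) \<in> null_sets (completion P)"
    unfolding Bex_def by (rule choice[OF allI])
  then obtain A0 where A0: "\<And>i. A0 i \<in> sets (raw_filtration P s)"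
    "\<And>i. (a i - A0 i) \<union> (A0 i - a i) \<in> null_sets (completion P)"
    by auto
  have N: "(\<Union>i. (a i - A0 i) \<union> (A0 i - a i)) \<in> null_sets (completion P)"
    using A0(2) by (intro null_sets_UN') auto
  have "(\<Union>i. a i) - (\<Union>i. A0 i) \<union> ((\<Union>i. A0 i) - (\<Union>i. a i)) \<in> null_sets (completion P)"
    by (rule null_sets_completion_subset[OF _ N]) auto
  then show ?case using A0(1) by (intro bexI[of _ "\<Union>i. A0 i"]) auto
qed

text \<open>
  Changing the past event by a null set alters neither side of the product formula.
\<close>

lemma increment_indep_augmented:
  assumes st: "0 \<le> s" "s < t" "t \<le> T"
  shows "C.indep_set (sets (wiener_filtration P s))
      {(\<lambda>\<omega>. \<omega> t - \<omega> s) -` A \<inter> space P | A. A \<in> sets borel}"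
proof (rule C.indep_setI)
  interpret P: prob_space P by (rule prob_space_P)
  show "sets (wiener_filtration P s) \<subseteq> C.events"
    using st by (intro filtration_subset_completion) auto
  show "{(\<lambda>\<omega>. \<omega> t - \<omega> s) -` A \<inter> space P | A. A \<in> sets borel} \<subseteq> C.events"
    using measurable_sets[OF increment_measurable_P[OF st]] by auto
  fix a b assume a: "a \<in> sets (wiener_filtration P s)"
    and b: "b \<in> {(\<lambda>\<omega>. \<omega> t - \<omega> s) -` A \<inter> space P | A. A \<in> sets borel}"
  note ind = increment_indep_raw[OF st]
  obtain A0 where A0: "A0 \<in> sets (raw_filtration P s)" "(a - A0) \<union> (A0 - a) \<in> null_sets (completion P)"
    using augmented_event_approx[OF a] by auto
  have A0P: "A0 \<in> sets P" using P.indep_setD_ev1[OF ind] A0(1) by auto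
  have bP: "b \<in> sets P" using P.indep_setD_ev2[OF ind] b by auto
  have aC: "a \<in> sets (completion P)" using a filtration_subset_completion[of s] st by auto
  have AE: "AE \<omega> in completion P. \<omega> \<in> a \<longleftrightarrow> \<omega> \<in> A0"
    using AE_not_in[OF A0(2)] by eventually_elim auto
  have "C.prob (a \<inter> b) = C.prob (A0 \<inter> b)"
  proof (rule C.finite_measure_eq_AE)
    show "AE \<omega> in completion P. \<omega> \<in> a \<inter> b \<longleftrightarrow> \<omega> \<in> A0 \<inter> b" using AE by eventually_elim simp
  qed (use aC A0P bP in auto)
  also have "\<dots> = P.prob (A0 \<inter> b)"
    by (rule measure_completion[OF sets.Int[OF A0P bP]])
  also have "\<dots> = P.prob A0 * P.prob b"
    by (rule P.indep_setD[OF ind A0(1) b])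
  also have "P.prob A0 = C.prob A0"
    by (rule measure_completion[OF A0P, symmetric])
  also have "C.prob A0 = C.prob a"
    by (rule C.finite_measure_eq_AE) (use AE aC A0P in \<open>auto elim: eventually_mono\<close>)
  finally show "C.prob (a \<inter> b) = C.prob a * C.prob b" using bP by simp
qed

lemma increment_indep_var:
  fixes \<zeta> :: "'d path \<Rightarrow> real" and \<phi> :: "real^'d \<Rightarrow> real"
  assumes st: "0 \<le> s" "s < t" "t \<le> T"
    and \<zeta>: "\<zeta> \<in> borel_measurable (wiener_filtration P s)" and \<phi>: "\<phi> \<in> borel_measurable borel"
  shows "C.indep_var borel \<zeta> borel (\<lambda>\<omega>. \<phi> (\<omega> t - \<omega> s))"
  unfolding C.indep_var_eq
proof (intro conjI)
  have D: "(\<lambda>\<omega>. \<omega> t - \<omega> s) \<in> borel_measurable P" by (rule increment_measurable_P[OF st])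
  show "\<zeta> \<in> borel_measurable (completion P)"
    using measurable_filtration_completion[OF \<zeta>] st by simp
  show "(\<lambda>\<omega>. \<phi> (\<omega> t - \<omega> s)) \<in> borel_measurable (completion P)"
    by (intro measurable_completion measurable_compose[OF D \<phi>])
  let ?Z = "{\<zeta> -` A \<inter> space (completion P) |A. A \<in> sets borel}"
  let ?D = "{(\<lambda>\<omega>. \<phi> (\<omega> t - \<omega> s)) -` A \<inter> space (completion P) |A. A \<in> sets borel}"
  have Z: "?Z \<subseteq> sets (wiener_filtration P s)"
    using measurable_sets[OF \<zeta>] by auto
  have D': "?D \<subseteq> {(\<lambda>\<omega>. \<omega> t - \<omega> s) -` A \<inter> space P | A. A \<in> sets borel}"
  proof safe
    fix A :: "real set" assume A: "A \<in> sets borel"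
    show "\<exists>A'. (\<lambda>\<omega>. \<phi> (\<omega> t - \<omega> s)) -` A \<inter> space (completion P) = (\<lambda>\<omega>. \<omega> t - \<omega> s) -` A' \<inter> space P \<and> A' \<in> sets borel"
      by (rule exI[of _ "\<phi> -` A"]) (use measurable_sets[OF \<phi> A] in auto)
  qed
  have "C.indep_set ?Z ?D"
  proof (rule C.indep_setI)
    note ind = increment_indep_augmented[OF st]
    show "?Z \<subseteq> C.events" using C.indep_setD_ev1[OF ind] Z by (rule order.trans[rotated])
    show "?D \<subseteq> C.events" using C.indep_setD_ev2[OF ind] D' by (rule order.trans[rotated])
    show "C.prob (a \<inter> b) = C.prob a * C.prob b" if "a \<in> ?Z" "b \<in> ?D" for a b
      using C.indep_setD[OF ind] subsetD[OF Z that(1)] subsetD[OF D' that(2)] .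
  qed
  then show "C.indep_set (sigma_sets (space (completion P)) ?Z) (sigma_sets (space (completion P)) ?D)"
    by (rule C.indep_set_sigma_sets) (rule Int_stable_preimages)+
qed

end

section \<open>Moments of products of increments\<close>

context wiener_measure_space begin

lemma increment_measurable:
  assumes "0 \<le> s" "s \<le> t" "t \<le> T"
  shows "(\<lambda>\<omega>. \<omega> t - \<omega> s) \<in> borel_measurable (completion P)"
  using increment_adapted[OF assms(1,2) order.refl] assms(3) by (rule measurable_filtration_completion)

lemma increment_first_moment:
  assumes st: "0 \<le> s" "s < t" "t \<le> T"
  shows "integrable (completion P) (\<lambda>\<omega>. (\<omega> t - \<omega> s) $ j)" (is "?int")
    and "C.expectation (\<lambda>\<omega>. (\<omega> t - \<omega> s) $ j) = 0" (is "?eq")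
proof -
  interpret P: prob_space P by (rule prob_space_P)
  note D = increment_distributed[OF st, of j]
  have m: "(\<lambda>\<omega>. (\<omega> t - \<omega> s) $ j) \<in> borel_measurable P"
    using distributed_measurable[OF D] by (simp cong: measurable_cong_sets)
  have "integrable lborel (\<lambda>x. normal_density 0 (sqrt (t - s)) x * x)"
    using st by (intro integrable_normal_moment_nz_1) auto
  then have "integrable P (\<lambda>\<omega>. (\<omega> t - \<omega> s) $ j)"
    using distributed_integrable[OF D, of "\<lambda>x. x"] by simp
  then show ?int using integrable_completion[OF m] by simp
  show ?eq using integral_completion[OF m] P.normal_distributed_expectation[OF _ D] st by simp
qed

lemma increment_second_moment:
  assumes st: "0 \<le> s" "s < t" "t \<le> T"
  shows "integrable (completion P) (\<lambda>\<omega>. (\<omega> t - \<omega> s) $ i * (\<omega> t - \<omega> s) $ j)" (is "?int")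
    and "C.expectation (\<lambda>\<omega>. (\<omega> t - \<omega> s) $ i * (\<omega> t - \<omega> s) $ j) = (if i = j then t - s else 0)" (is "?eq")
proof -
  interpret P: prob_space P by (rule prob_space_P)
  note D = increment_distributed[OF st]
  have m: "(\<lambda>\<omega>. (\<omega> t - \<omega> s) $ j) \<in> borel_measurable P" for j
    using distributed_measurable[OF D] by (simp cong: measurable_cong_sets)
  have mm: "(\<lambda>\<omega>. (\<omega> t - \<omega> s) $ i * (\<omega> t - \<omega> s) $ j) \<in> borel_measurable P"
    by (intro borel_measurable_times m)
  have int1: "integrable P (\<lambda>\<omega>. (\<omega> t - \<omega> s) $ j)" for j
    using increment_first_moment(1)[OF st] integrable_completion[OF m] by simp
  have e0: "P.expectation (\<lambda>\<omega>. (\<omega> t - \<omega> s) $ j) = 0" for j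
    using increment_first_moment(2)[OF st] integral_completion[OF m] by simp
  have "integrable P (\<lambda>\<omega>. (\<omega> t - \<omega> s) $ i * (\<omega> t - \<omega> s) $ j) \<and>
    P.expectation (\<lambda>\<omega>. (\<omega> t - \<omega> s) $ i * (\<omega> t - \<omega> s) $ j) = (if i = j then t - s else 0)"
  proof (cases "i = j")
    case True
    have "integrable lborel (\<lambda>x. normal_density 0 (sqrt (t - s)) x * (x - 0) ^ 2)"
      using st by (intro integrable_normal_moment) auto
    then have "integrable P (\<lambda>\<omega>. ((\<omega> t - \<omega> s) $ j)\<^sup>2)"
      using distributed_integrable[OF D[of j], of "\<lambda>x. x\<^sup>2"] by simp
    moreover have "P.expectation (\<lambda>\<omega>. ((\<omega> t - \<omega> s) $ j)\<^sup>2) = t - s"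
      using P.normal_distributed_variance[OF _ D[of j]] st e0[of j] by simp
    ultimately show ?thesis using True by (simp add: power2_eq_square)
  next
    case False
    have ind: "P.indep_vars (\<lambda>_. borel) (\<lambda>j \<omega>. (\<omega> t - \<omega> s) $ j) {i, j}"
      by (rule P.indep_vars_subset[OF increment_components_indep[OF st]]) simp
    show ?thesis
      using P.indep_vars_lebesgue_integral[OF _ ind int1] P.indep_vars_integrable[OF _ ind int1] e0 False
      by simp
  qed
  then show ?int ?eq using integrable_completion[OF mm] integral_completion[OF mm] by simp_all
qed

lemma sqint_increment:
  assumes "0 \<le> s" "s \<le> t" "t \<le> T"
  shows "sqint (completion P) (\<lambda>\<omega>. \<omega> t - \<omega> s)"
proof (cases "s = t")
  case False
  then have st: "0 \<le> s" "s < t" "t \<le> T" using assms by auto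
  have "(norm x)\<^sup>2 = (\<Sum>i\<in>UNIV. x $ i * x $ i)" for x :: "real^'d"
    by (simp add: power2_norm_eq_inner inner_vec_def)
  then show ?thesis
    unfolding sqint_def using increment_measurable[OF assms] increment_second_moment(1)[OF st] by simp
qed simp

lemma expectation_adapted_inner_increment:
  fixes \<zeta> :: "'d path \<Rightarrow> real^'d"
  assumes st: "0 \<le> s" "s \<le> t" "t \<le> T"
    and \<zeta>: "\<zeta> \<in> borel_measurable (wiener_filtration P s)" "integrable (completion P) \<zeta>"
  shows "C.expectation (\<lambda>\<omega>. \<zeta> \<omega> \<bullet> (\<omega> t - \<omega> s)) = 0"
proof (cases "s = t")
  case False
  then have st: "0 \<le> s" "s < t" "t \<le> T" using st by auto
  have ind: "C.indep_var borel (\<lambda>\<omega>. \<zeta> \<omega> $ j) borel (\<lambda>\<omega>. (\<omega> t - \<omega> s) $ j)" for j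
    using \<zeta>(1) by (intro increment_indep_var[OF st, where \<phi>="\<lambda>x. x $ j"])
      (auto simp: borel_measurable_vec_iff intro!: borel_measurable_nth)
  have int: "integrable (completion P) (\<lambda>\<omega>. \<zeta> \<omega> $ j)" for j
    using integrable_inner_left[OF \<zeta>(2), of "axis j 1"] by (simp add: inner_axis)
  have "C.expectation (\<lambda>\<omega>. \<Sum>j\<in>UNIV. \<zeta> \<omega> $ j * (\<omega> t - \<omega> s) $ j) = 0"
    using C.indep_var_lebesgue_integral[OF ind int increment_first_moment(1)[OF st]]
      C.indep_var_integrable[OF ind int increment_first_moment(1)[OF st]]
      increment_first_moment(2)[OF st]
    by (subst Bochner_Integration.integral_sum) auto
  then show ?thesis by (simp add: inner_vec_def)
qed simp

definition bounded_adapted :: "real \<Rightarrow> ('d path \<Rightarrow> real^'d) \<Rightarrow> bool" where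
  "bounded_adapted s \<xi> \<longleftrightarrow>
     \<xi> \<in> borel_measurable (wiener_filtration P s) \<and> (\<exists>C. \<forall>\<omega>\<in>space P. norm (\<xi> \<omega>) \<le> C)"

lemma bounded_adapted_mono: "bounded_adapted s \<xi> \<Longrightarrow> s \<le> t \<Longrightarrow> bounded_adapted t \<xi>"
  unfolding bounded_adapted_def using measurable_filtration_mono by blast

lemma bounded_adapted_sqint:
  assumes "bounded_adapted s \<xi>" "s \<le> T" shows "sqint (completion P) \<xi>"
proof -
  from assms obtain C where "\<forall>\<omega>\<in>space P. norm (\<xi> \<omega>) \<le> C" by (auto simp: bounded_adapted_def)
  then have "AE \<omega> in completion P. norm (\<xi> \<omega>) \<le> C" by (intro AE_I2) simp
  moreover have "\<xi> \<in> borel_measurable (completion P)"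
    using assms unfolding bounded_adapted_def by (blast intro: measurable_filtration_completion)
  ultimately show ?thesis by (intro C.sqint_bounded)
qed

lemma sqint_bounded_inner_increment:
  assumes "bounded_adapted s \<xi>" and st: "s \<le> T" "0 \<le> r" "r \<le> t" "t \<le> T"
  shows "sqint (completion P) (\<lambda>\<omega>. \<xi> \<omega> \<bullet> (\<omega> t - \<omega> r))"
proof -
  from assms obtain C where C: "\<forall>\<omega>\<in>space P. norm (\<xi> \<omega>) \<le> C" by (auto simp: bounded_adapted_def)
  show ?thesis
  proof (rule sqint_bound[OF sqint_scaleR[OF sqint_increment[OF st(2-4)], of C]])
    show "(\<lambda>\<omega>. \<xi> \<omega> \<bullet> (\<omega> t - \<omega> r)) \<in> borel_measurable (completion P)"
      using sqint_measurable[OF bounded_adapted_sqint[OF assms(1,2)]] increment_measurable[OF st(2-4)]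
      by (rule borel_measurable_inner)
    show "AE \<omega> in completion P. norm (\<xi> \<omega> \<bullet> (\<omega> t - \<omega> r)) \<le> norm (C *\<^sub>R (\<omega> t - \<omega> r))"
    proof (rule AE_I2)
      fix \<omega> assume "\<omega> \<in> space (completion P)"
      then have "norm (\<xi> \<omega>) \<le> \<bar>C\<bar>" using C by fastforce
      then show "norm (\<xi> \<omega> \<bullet> (\<omega> t - \<omega> r)) \<le> norm (C *\<^sub>R (\<omega> t - \<omega> r))"
        using Cauchy_Schwarz_ineq2[of "\<xi> \<omega>" "\<omega> t - \<omega> r"] mult_right_mono[of "norm (\<xi> \<omega>)" "\<bar>C\<bar>" "norm (\<omega> t - \<omega> r)"]
        by simp
    qed
  qed
qed

text \<open>
  The basic martingale estimate: the factor \<open>\<eta> \<xi>\<close> is known when the increment starts.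
\<close>

lemma expectation_adapted_mult_increment:
  fixes \<eta> :: "'d path \<Rightarrow> real"
  assumes st: "0 \<le> s" "s \<le> t" "t \<le> T"
    and \<eta>: "\<eta> \<in> borel_measurable (wiener_filtration P s)" "sqint (completion P) \<eta>"
    and \<xi>: "bounded_adapted s \<xi>"
  shows "C.expectation (\<lambda>\<omega>. \<eta> \<omega> * (\<xi> \<omega> \<bullet> (\<omega> t - \<omega> s))) = 0"
proof -
  from \<xi> obtain C where C: "\<forall>\<omega>\<in>space P. norm (\<xi> \<omega>) \<le> C" by (auto simp: bounded_adapted_def)
  have \<xi>m: "\<xi> \<in> borel_measurable (wiener_filtration P s)" using \<xi> by (simp add: bounded_adapted_def)
  have "integrable (completion P) (\<lambda>\<omega>. \<eta> \<omega> *\<^sub>R \<xi> \<omega>)"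
  proof (rule Bochner_Integration.integrable_bound)
    show "integrable (completion P) (\<lambda>\<omega>. C * \<eta> \<omega>)" using C.sqint_integrable[OF \<eta>(2)] by simp
    show "(\<lambda>\<omega>. \<eta> \<omega> *\<^sub>R \<xi> \<omega>) \<in> borel_measurable (completion P)"
      using \<eta>(1) \<xi>m st by (intro borel_measurable_scaleR measurable_filtration_completion[of _ s]) auto
    show "AE \<omega> in completion P. norm (\<eta> \<omega> *\<^sub>R \<xi> \<omega>) \<le> norm (C * \<eta> \<omega>)"
    proof (rule AE_I2)
      fix \<omega> assume "\<omega> \<in> space (completion P)"
      then have "norm (\<xi> \<omega>) \<le> \<bar>C\<bar>" using C by fastforce
      then show "norm (\<eta> \<omega> *\<^sub>R \<xi> \<omega>) \<le> norm (C * \<eta> \<omega>)"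
        using mult_right_mono[of "norm (\<xi> \<omega>)" "\<bar>C\<bar>" "\<bar>\<eta> \<omega>\<bar>"] by (simp add: abs_mult mult.commute)
    qed
  qed
  then have "C.expectation (\<lambda>\<omega>. (\<eta> \<omega> *\<^sub>R \<xi> \<omega>) \<bullet> (\<omega> t - \<omega> s)) = 0"
    using \<eta>(1) \<xi>m by (intro expectation_adapted_inner_increment[OF st] borel_measurable_scaleR)
  then show ?thesis by simp
qed

lemma bounded_inner_increment_adapted:
  assumes "bounded_adapted s \<xi>" "0 \<le> r" "r \<le> t" "s \<le> q" "t \<le> q"
  shows "(\<lambda>\<omega>. \<xi> \<omega> \<bullet> (\<omega> t - \<omega> r)) \<in> borel_measurable (wiener_filtration P q)"
proof (intro borel_measurable_inner increment_adapted)
  show "\<xi> \<in> borel_measurable (wiener_filtration P q)"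
    using assms(1,4) unfolding bounded_adapted_def by (blast intro: measurable_filtration_mono)
qed (use assms in auto)

text \<open>
  Everything except the later increment is known at time \<open>s'\<close>.
\<close>

lemma expectation_increment_products_disjoint:
  assumes \<xi>: "bounded_adapted s \<xi>" and \<xi>': "bounded_adapted s' \<xi>'"
    and o: "s \<le> s'" "0 \<le> r" "r \<le> e" "e \<le> s'" "s' \<le> e'" "e' \<le> T"
  shows "C.expectation (\<lambda>\<omega>. (\<xi> \<omega> \<bullet> (\<omega> e - \<omega> r)) * (\<xi>' \<omega> \<bullet> (\<omega> e' - \<omega> s'))) = 0"
proof (rule expectation_adapted_mult_increment)
  show "(\<lambda>\<omega>. \<xi> \<omega> \<bullet> (\<omega> e - \<omega> r)) \<in> borel_measurable (wiener_filtration P s')"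
    using o by (intro bounded_inner_increment_adapted[OF \<xi>]) auto
  show "sqint (completion P) (\<lambda>\<omega>. \<xi> \<omega> \<bullet> (\<omega> e - \<omega> r))"
    using o by (intro sqint_bounded_inner_increment[OF \<xi>]) auto
qed (use o \<xi>' in auto)

lemma expectation_increment_products_same:
  assumes \<xi>: "bounded_adapted s \<xi>" and \<xi>': "bounded_adapted s \<xi>'"
    and o: "0 \<le> s" "s \<le> e" "e \<le> T"
  shows "C.expectation (\<lambda>\<omega>. (\<xi> \<omega> \<bullet> (\<omega> e - \<omega> s)) * (\<xi>' \<omega> \<bullet> (\<omega> e - \<omega> s)))
       = (e - s) * C.expectation (\<lambda>\<omega>. \<xi> \<omega> \<bullet> \<xi>' \<omega>)"
proof (cases "s = e")
  case False
  then have st: "0 \<le> s" "s < e" "e \<le> T" using o by auto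
  have sT: "s \<le> T" using o by auto
  have m: "(\<lambda>\<omega>. \<xi> \<omega> $ i) \<in> borel_measurable (wiener_filtration P s)"
    "(\<lambda>\<omega>. \<xi>' \<omega> $ i) \<in> borel_measurable (wiener_filtration P s)" for i
    using \<xi> \<xi>' by (auto simp: bounded_adapted_def borel_measurable_vec_iff)
  have sq: "sqint (completion P) (\<lambda>\<omega>. \<zeta> \<omega> $ i)" if "bounded_adapted s \<zeta>" for \<zeta> i
  proof (rule sqint_bound[OF bounded_adapted_sqint[OF that sT]])
    show "(\<lambda>\<omega>. \<zeta> \<omega> $ i) \<in> borel_measurable (completion P)"
      using sqint_measurable[OF bounded_adapted_sqint[OF that sT]] by (auto simp: borel_measurable_vec_iff)
  qed (use component_le_norm_cart in auto)
  have w: "integrable (completion P) (\<lambda>\<omega>. \<xi> \<omega> $ i * \<xi>' \<omega> $ j)" for i j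
    by (intro sqint_integrable_mult sq \<xi> \<xi>')
  have ind: "C.indep_var borel (\<lambda>\<omega>. \<xi> \<omega> $ i * \<xi>' \<omega> $ j) borel (\<lambda>\<omega>. (\<omega> e - \<omega> s) $ i * (\<omega> e - \<omega> s) $ j)" for i j
    by (intro increment_indep_var[OF st, where \<phi>="\<lambda>x. x $ i * x $ j"] borel_measurable_times m borel_measurable_nth)
  note I = C.indep_var_integrable[OF ind w increment_second_moment(1)[OF st]]
  have "C.expectation (\<lambda>\<omega>. (\<xi> \<omega> \<bullet> (\<omega> e - \<omega> s)) * (\<xi>' \<omega> \<bullet> (\<omega> e - \<omega> s)))
    = C.expectation (\<lambda>\<omega>. \<Sum>i\<in>UNIV. \<Sum>j\<in>UNIV. (\<xi> \<omega> $ i * \<xi>' \<omega> $ j) * ((\<omega> e - \<omega> s) $ i * (\<omega> e - \<omega> s) $ j))"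
    by (simp add: inner_vec_def sum_product algebra_simps)
  also have "\<dots> = (\<Sum>i\<in>UNIV. \<Sum>j\<in>UNIV. C.expectation (\<lambda>\<omega>. \<xi> \<omega> $ i * \<xi>' \<omega> $ j) * (if i = j then e - s else 0))"
    using I C.indep_var_lebesgue_integral[OF ind w increment_second_moment(1)[OF st]] increment_second_moment(2)[OF st]
    by (simp add: Bochner_Integration.integral_sum)
  also have "\<dots> = (e - s) * (\<Sum>i\<in>UNIV. C.expectation (\<lambda>\<omega>. \<xi> \<omega> $ i * \<xi>' \<omega> $ i))"
    by (simp add: if_distrib sum_distrib_left mult.commute cong: if_cong)
  also have "(\<Sum>i\<in>UNIV. C.expectation (\<lambda>\<omega>. \<xi> \<omega> $ i * \<xi>' \<omega> $ i)) = C.expectation (\<lambda>\<omega>. \<xi> \<omega> \<bullet> \<xi>' \<omega>)"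
    using w by (simp add: inner_vec_def Bochner_Integration.integral_sum)
  finally show ?thesis .
qed simp

lemma expectation_increment_products_common_start:
  assumes \<xi>: "bounded_adapted s \<xi>" and \<xi>': "bounded_adapted s \<xi>'"
    and o: "0 \<le> s" "s \<le> e" "e \<le> e'" "e' \<le> T"
  shows "C.expectation (\<lambda>\<omega>. (\<xi> \<omega> \<bullet> (\<omega> e - \<omega> s)) * (\<xi>' \<omega> \<bullet> (\<omega> e' - \<omega> s)))
       = (e - s) * C.expectation (\<lambda>\<omega>. \<xi> \<omega> \<bullet> \<xi>' \<omega>)"
proof -
  have sq: "sqint (completion P) (\<lambda>\<omega>. \<zeta> \<omega> \<bullet> (\<omega> q - \<omega> p))"
    if "bounded_adapted s \<zeta>" "s \<le> p" "p \<le> q" "q \<le> T" for \<zeta> p q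
    using that o by (intro sqint_bounded_inner_increment[of s]) auto
  have "C.expectation (\<lambda>\<omega>. (\<xi> \<omega> \<bullet> (\<omega> e - \<omega> s)) * (\<xi>' \<omega> \<bullet> (\<omega> e' - \<omega> s)))
    = C.expectation (\<lambda>\<omega>. (\<xi> \<omega> \<bullet> (\<omega> e - \<omega> s)) * (\<xi>' \<omega> \<bullet> (\<omega> e - \<omega> s))
        + (\<xi> \<omega> \<bullet> (\<omega> e - \<omega> s)) * (\<xi>' \<omega> \<bullet> (\<omega> e' - \<omega> e)))"
    by (rule Bochner_Integration.integral_cong) (auto simp: algebra_simps inner_diff_right)
  also have "\<dots> = C.expectation (\<lambda>\<omega>. (\<xi> \<omega> \<bullet> (\<omega> e - \<omega> s)) * (\<xi>' \<omega> \<bullet> (\<omega> e - \<omega> s)))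
    + C.expectation (\<lambda>\<omega>. (\<xi> \<omega> \<bullet> (\<omega> e - \<omega> s)) * (\<xi>' \<omega> \<bullet> (\<omega> e' - \<omega> e)))"
    using o by (intro Bochner_Integration.integral_add sqint_integrable_mult sq \<xi> \<xi>') auto
  also have "\<dots> = (e - s) * C.expectation (\<lambda>\<omega>. \<xi> \<omega> \<bullet> \<xi>' \<omega>) + 0"
    using o by (intro arg_cong2[where f="(+)"] expectation_increment_products_same[OF \<xi> \<xi>']
      expectation_increment_products_disjoint[OF \<xi> bounded_adapted_mono[OF \<xi>']]) auto
  finally show ?thesis by simp
qed

text \<open>
  The first increment is cut at \<open>s'\<close>. Its part before \<open>s'\<close> contributes nothing, and the rest starts
  together with the second increment.
\<close>

lemma expectation_increment_products_ordered:
  assumes \<xi>: "bounded_adapted s \<xi>" and \<xi>': "bounded_adapted s' \<xi>'"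
    and o: "0 \<le> s" "s \<le> e" "e \<le> T" "s' \<le> e'" "e' \<le> T" "s \<le> s'"
  shows "C.expectation (\<lambda>\<omega>. (\<xi> \<omega> \<bullet> (\<omega> e - \<omega> s)) * (\<xi>' \<omega> \<bullet> (\<omega> e' - \<omega> s')))
       = max 0 (min e e' - max s s') * C.expectation (\<lambda>\<omega>. \<xi> \<omega> \<bullet> \<xi>' \<omega>)"
proof (cases "e \<le> s'")
  case True
  then show ?thesis
    using expectation_increment_products_disjoint[OF \<xi> \<xi>' o(6) o(1) o(2) True o(4,5)] o by simp
next
  case False
  have b: "bounded_adapted s' \<xi>" using bounded_adapted_mono[OF \<xi>] o by simp
  have s': "0 \<le> s'" "s' \<le> T" using o by auto
  have "C.expectation (\<lambda>\<omega>. (\<xi> \<omega> \<bullet> (\<omega> e - \<omega> s)) * (\<xi>' \<omega> \<bullet> (\<omega> e' - \<omega> s')))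
    = C.expectation (\<lambda>\<omega>. (\<xi> \<omega> \<bullet> (\<omega> s' - \<omega> s)) * (\<xi>' \<omega> \<bullet> (\<omega> e' - \<omega> s'))
        + (\<xi> \<omega> \<bullet> (\<omega> e - \<omega> s')) * (\<xi>' \<omega> \<bullet> (\<omega> e' - \<omega> s')))"
    by (rule Bochner_Integration.integral_cong) (auto simp: algebra_simps inner_diff_right)
  also have "\<dots> = C.expectation (\<lambda>\<omega>. (\<xi> \<omega> \<bullet> (\<omega> s' - \<omega> s)) * (\<xi>' \<omega> \<bullet> (\<omega> e' - \<omega> s')))
        + C.expectation (\<lambda>\<omega>. (\<xi> \<omega> \<bullet> (\<omega> e - \<omega> s')) * (\<xi>' \<omega> \<bullet> (\<omega> e' - \<omega> s')))"
    using o False s' by (intro Bochner_Integration.integral_add sqint_integrable_mult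
      sqint_bounded_inner_increment[OF b] sqint_bounded_inner_increment[OF \<xi>']) auto
  also have "C.expectation (\<lambda>\<omega>. (\<xi> \<omega> \<bullet> (\<omega> s' - \<omega> s)) * (\<xi>' \<omega> \<bullet> (\<omega> e' - \<omega> s'))) = 0"
    using o by (intro expectation_increment_products_disjoint[OF \<xi> \<xi>']) auto
  also have "C.expectation (\<lambda>\<omega>. (\<xi> \<omega> \<bullet> (\<omega> e - \<omega> s')) * (\<xi>' \<omega> \<bullet> (\<omega> e' - \<omega> s')))
    = (min e e' - s') * C.expectation (\<lambda>\<omega>. \<xi> \<omega> \<bullet> \<xi>' \<omega>)"
  proof (cases "e \<le> e'")
    case True
    then show ?thesis
      using expectation_increment_products_common_start[OF b \<xi>' s'(1) _ True] False o by simp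
  next
    case F: False
    then show ?thesis
      using expectation_increment_products_common_start[OF \<xi>' b s'(1), of e' e] False o
      by (simp add: mult.commute inner_commute)
  qed
  finally show ?thesis using False o by simp
qed

text \<open>
  Only the overlap of the two intervals contributes. Handling arbitrary pairs of intervals gives
  the isometry for two simple integrands on different partitions without a common refinement.
\<close>

lemma expectation_increment_products:
  assumes \<xi>: "bounded_adapted s \<xi>" and \<xi>': "bounded_adapted s' \<xi>'"
    and o: "0 \<le> s" "s \<le> e" "e \<le> T" "0 \<le> s'" "s' \<le> e'" "e' \<le> T"
  shows "C.expectation (\<lambda>\<omega>. (\<xi> \<omega> \<bullet> (\<omega> e - \<omega> s)) * (\<xi>' \<omega> \<bullet> (\<omega> e' - \<omega> s')))
       = max 0 (min e e' - max s s') * C.expectation (\<lambda>\<omega>. \<xi> \<omega> \<bullet> \<xi>' \<omega>)"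
proof (cases "s \<le> s'")
  case True
  show ?thesis
    by (rule expectation_increment_products_ordered[OF \<xi> \<xi>' o(1,2,3,5,6) True])
next
  case False
  then have "s' \<le> s" by simp
  from expectation_increment_products_ordered[OF \<xi>' \<xi> o(4,5,6,2,3) this]
  show ?thesis by (simp add: mult.commute inner_commute min.commute max.commute)
qed

end

section \<open>Time and path together; the isometry for simple integrands\<close>

lemma (in pair_sigma_finite) integral_product_mult:
  fixes g :: "'a \<Rightarrow> real" and h :: "'b \<Rightarrow> real"
  assumes g: "integrable M1 g" and h: "integrable M2 h"
  shows "integrable (M1 \<Otimes>\<^sub>M M2) (\<lambda>p. g (fst p) * h (snd p))"
    and "(\<integral>p. g (fst p) * h (snd p) \<partial>(M1 \<Otimes>\<^sub>M M2)) = (\<integral>x. g x \<partial>M1) * (\<integral>y. h y \<partial>M2)"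
proof -
  have [measurable]: "g \<in> borel_measurable M1" "h \<in> borel_measurable M2" using g h by auto
  show int: "integrable (M1 \<Otimes>\<^sub>M M2) (\<lambda>p. g (fst p) * h (snd p))"
    by (rule Fubini_integrable) (use g h in \<open>auto simp: abs_mult\<close>)
  show "(\<integral>p. g (fst p) * h (snd p) \<partial>(M1 \<Otimes>\<^sub>M M2)) = (\<integral>x. g x \<partial>M1) * (\<integral>y. h y \<partial>M2)"
    using integral_fst'[OF int] by simp
qed

lemma integral_double_sum:
  fixes f :: "'i \<Rightarrow> 'j \<Rightarrow> 'a \<Rightarrow> real"
  assumes f: "\<And>i j. i \<in> I \<Longrightarrow> j \<in> J \<Longrightarrow> integrable M (f i j)"
  shows "(\<integral>x. (\<Sum>i\<in>I. \<Sum>j\<in>J. f i j x) \<partial>M) = (\<Sum>i\<in>I. \<Sum>j\<in>J. \<integral>x. f i j x \<partial>M)"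
proof -
  have "(\<integral>x. (\<Sum>i\<in>I. \<Sum>j\<in>J. f i j x) \<partial>M) = (\<Sum>i\<in>I. \<integral>x. (\<Sum>j\<in>J. f i j x) \<partial>M)"
    by (rule Bochner_Integration.integral_sum) (intro Bochner_Integration.integrable_sum f)
  also have "\<dots> = (\<Sum>i\<in>I. \<Sum>j\<in>J. \<integral>x. f i j x \<partial>M)"
    by (intro sum.cong refl Bochner_Integration.integral_sum f)
  finally show ?thesis .
qed

context wiener_measure_space begin

definition time_measure :: "real \<Rightarrow> real measure" where
  "time_measure t = restrict_space lborel {t..T}"

abbreviation time_path :: "real \<Rightarrow> (real \<times> 'd path) measure" where
  "time_path t \<equiv> time_measure t \<Otimes>\<^sub>M completion P"

lemma space_time_measure [simp]: "space (time_measure t) = {t..T}"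
  by (simp add: time_measure_def space_restrict_space)

lemma sets_time_measure: "sets (time_measure t) = sets (restrict_space borel {t..T})"
  unfolding time_measure_def by (rule restrict_space_sets_cong) simp_all

lemma measurable_time_measure_borel: "f \<in> borel_measurable borel \<Longrightarrow> f \<in> borel_measurable (time_measure t)"
  unfolding time_measure_def by (intro measurable_restrict_space1) simp

lemma finite_measure_time_measure: "finite_measure (time_measure t)"
  by (rule finite_measureI) (simp add: time_measure_def emeasure_restrict_space space_restrict_space emeasure_lborel_Icc_eq)

lemma integral_time_measure:
  "integral\<^sup>L (time_measure t) (f :: real \<Rightarrow> 'b::euclidean_space) = (LBINT r:{t..T}. f r)"
  unfolding time_measure_def set_lebesgue_integral_def by (simp add: integral_restrict_space)

sublocale TM: finite_measure "time_measure t" for t by (rule finite_measure_time_measure)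
sublocale TP: pair_sigma_finite "time_measure t" "completion P" for t ..

lemma finite_measure_time_path: "finite_measure (time_path t)"
  by (rule finite_measure_pair_measure) unfold_locales

sublocale Q: finite_measure "time_path t" for t by (rule finite_measure_time_path)

lemma integral_indicator_interval:
  assumes "t \<le> a" "b \<le> T"
  shows "(\<integral>r. indicator {a<..b} r \<partial>time_measure t) = max 0 (b - a)"
proof -
  have "(\<integral>r. indicator {a<..b} r \<partial>time_measure t) = (LBINT r. indicator {t..T} r *\<^sub>R indicator {a<..b} r :: real)"
    unfolding time_measure_def by (subst integral_restrict_space) simp_all
  also have "\<dots> = (LBINT r. indicator {a<..b} r :: real)"
    by (rule Bochner_Integration.integral_cong) (use assms in \<open>auto split: split_indicator\<close>)
  also have "\<dots> = max 0 (b - a)" by (cases "a \<le> b") (simp_all add: measure_def)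
  finally show ?thesis .
qed

lemma measurable_pair_filtration_time_path:
  assumes "f \<in> measurable (restrict_space borel {t..T} \<Otimes>\<^sub>M wiener_filtration P T) N"
  shows "f \<in> measurable (time_path t) N"
proof -
  have "(\<lambda>x. x) \<in> measurable (completion P) (wiener_filtration P T)"
    by (rule measurable_filtration_completion[of _ T]) auto
  moreover have "(\<lambda>x. x) \<in> measurable (time_measure t) (restrict_space borel {t..T})"
    by (rule measurable_ident_sets[OF sets_time_measure])
  ultimately have "(\<lambda>p. (fst p, snd p)) \<in> measurable (time_path t) (restrict_space borel {t..T} \<Otimes>\<^sub>M wiener_filtration P T)"
    by (intro measurable_Pair measurable_compose[OF measurable_fst] measurable_compose[OF measurable_snd])
  from measurable_compose[OF this assms] show ?thesis by simp
qed

lemma progressive_measurable_time_path: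
  assumes "progressive P t T X" "t \<le> T"
  shows "(\<lambda>p. X (fst p) (snd p)) \<in> borel_measurable (time_path t)"
proof -
  have "T \<in> {t..T}" using assms(2) by simp
  from assms(1)[unfolded progressive_def, THEN bspec, OF this]
  have "(\<lambda>(r, \<omega>). X r \<omega>) \<in> borel_measurable (time_path t)"
    by (rule measurable_pair_filtration_time_path)
  then show ?thesis unfolding case_prod_unfold .
qed

lemma H2_sqint:
  fixes H :: "real \<Rightarrow> 'd path \<Rightarrow> 'b::euclidean_space"
  assumes "H \<in> H2 P t T" "t \<le> T"
  shows "sqint (time_path t) (\<lambda>p. H (fst p) (snd p))"
proof -
  have "progressive P t T H" and "L2_dt_dP P t T H < \<infinity>" using assms(1) by (simp_all add: H2_def)
  then show ?thesis
    by (subst sqint_iff_nn[OF progressive_measurable_time_path[OF _ assms(2)]])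
      (simp_all add: L2_dt_dP_def case_prod_unfold time_measure_def)
qed

lemma simple_integrand_bounds:
  assumes s: "simple_integrand P t T N \<tau> \<xi>" and t: "0 \<le> t"
  shows "i \<le> N \<Longrightarrow> t \<le> \<tau> i" "i \<le> N \<Longrightarrow> \<tau> i \<le> T" "i < N \<Longrightarrow> \<tau> i \<le> \<tau> (Suc i)"
    "i < N \<Longrightarrow> bounded_adapted (\<tau> i) (\<xi> i)"
proof -
  have incr: "\<tau> i \<le> \<tau> (Suc i)" if "i < N" for i using s that by (auto simp: simple_integrand_def)
  have mono: "\<tau> i \<le> \<tau> j" if "i \<le> j" "j \<le> N" for i j
    using that
  proof (induction rule: dec_induct)
    case (step k)
    then show ?case using incr[of k] by linarith
  qed simp
  show "i \<le> N \<Longrightarrow> t \<le> \<tau> i" using mono[of 0 i] s by (auto simp: simple_integrand_def)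
  show "i \<le> N \<Longrightarrow> \<tau> i \<le> T" using mono[of i N] s by (auto simp: simple_integrand_def)
  show "i < N \<Longrightarrow> \<tau> i \<le> \<tau> (Suc i)" by (rule incr)
  show "i < N \<Longrightarrow> bounded_adapted (\<tau> i) (\<xi> i)"
    using s by (auto simp: simple_integrand_def bounded_adapted_def)
qed

lemma sqint_simple_integral:
  assumes s: "simple_integrand P t T N \<tau> \<xi>" and t: "0 \<le> t" "t \<le> r" "r \<le> T"
  shows "sqint (completion P) (simple_integral N \<tau> \<xi> r)"
  unfolding simple_integral_def[abs_def]
proof (rule sqint_sum)
  note b = simple_integrand_bounds[OF s t(1)]
  fix i assume i: "i \<in> {..<N}"
  have "t \<le> \<tau> i" "t \<le> \<tau> (Suc i)" "\<tau> i \<le> \<tau> (Suc i)" "\<tau> i \<le> T" using b i by auto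
  then show "sqint (completion P) (\<lambda>\<omega>. \<xi> i \<omega> \<bullet> (\<omega> (min (\<tau> (Suc i)) r) - \<omega> (min (\<tau> i) r)))"
    using b(4)[of i] i t by (intro sqint_bounded_inner_increment[of "\<tau> i"]) auto
qed

lemma sqint_simple_process:
  assumes s: "simple_integrand P t T N \<tau> \<xi>" and t: "0 \<le> t"
  shows "sqint (time_path t) (\<lambda>p. simple_process N \<tau> \<xi> (fst p) (snd p))"
  unfolding simple_process_def
proof (rule sqint_sum)
  fix i assume i: "i \<in> {..<N}"
  note b = simple_integrand_bounds[OF s t]
  have ba: "bounded_adapted (\<tau> i) (\<xi> i)" "\<tau> i \<le> T" using b i by auto
  obtain C where C: "\<forall>\<omega>\<in>space P. norm (\<xi> i \<omega>) \<le> C" using ba by (auto simp: bounded_adapted_def)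
  have m: "\<xi> i \<in> borel_measurable (completion P)" by (rule sqint_measurable[OF bounded_adapted_sqint[OF ba]])
  have ind: "(indicator {\<tau> i<..\<tau> (Suc i)} :: real \<Rightarrow> real) \<in> borel_measurable (time_measure t)"
    by (intro measurable_time_measure_borel borel_measurable_indicator) simp
  show "sqint (time_path t) (\<lambda>p. indicator {\<tau> i<..\<tau> (Suc i)} (fst p) *\<^sub>R \<xi> i (snd p))"
  proof (rule Q.sqint_bounded)
    show "(\<lambda>p. indicator {\<tau> i<..\<tau> (Suc i)} (fst p) *\<^sub>R \<xi> i (snd p)) \<in> borel_measurable (time_path t)"
      by (intro borel_measurable_scaleR measurable_compose[OF measurable_fst ind] measurable_compose[OF measurable_snd m])
    show "AE p in time_path t. norm (indicator {\<tau> i<..\<tau> (Suc i)} (fst p) *\<^sub>R \<xi> i (snd p)) \<le> \<bar>C\<bar>"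
    proof (rule AE_I2)
      fix p assume "p \<in> space (time_path t)"
      then have "norm (\<xi> i (snd p)) \<le> \<bar>C\<bar>" using C by (force simp: space_pair_measure)
      then show "norm (indicator {\<tau> i<..\<tau> (Suc i)} (fst p) *\<^sub>R \<xi> i (snd p)) \<le> \<bar>C\<bar>"
        by (auto split: split_indicator)
    qed
  qed
qed

lemma indicator_event_measurable:
  assumes "A \<in> sets (wiener_filtration P s)"
  shows "(indicator A :: 'd path \<Rightarrow> real) \<in> borel_measurable (wiener_filtration P s)"
  using assms by simp

lemma bounded_adapted_indicator:
  assumes "bounded_adapted s \<xi>" "A \<in> sets (wiener_filtration P s)"
  shows "bounded_adapted s (\<lambda>\<omega>. indicator A \<omega> *\<^sub>R \<xi> \<omega>)"
  unfolding bounded_adapted_def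
proof
  show "(\<lambda>\<omega>. indicator A \<omega> *\<^sub>R \<xi> \<omega>) \<in> borel_measurable (wiener_filtration P s)"
    using assms by (intro borel_measurable_scaleR indicator_event_measurable) (auto simp: bounded_adapted_def)
  obtain C where C: "\<forall>\<omega>\<in>space P. norm (\<xi> \<omega>) \<le> C" using assms by (auto simp: bounded_adapted_def)
  show "\<exists>C. \<forall>\<omega>\<in>space P. norm (indicator A \<omega> *\<^sub>R \<xi> \<omega>) \<le> C"
    using C by (intro exI[of _ "\<bar>C\<bar>"]) (force split: split_indicator)
qed

text \<open>
  Both sides are double sums over pairs of partition intervals, and each pair contributes the
  length of its overlap times \<open>E[1\<^sub>A \<xi>\<^sub>i \<bullet> \<xi>'\<^sub>j]\<close>. The indicator of \<open>A\<close> is absorbed into \<open>\<xi>\<^sub>i\<close>, which stays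
  adapted because \<open>A\<close> belongs to the initial \<open>\<sigma>\<close>-algebra.
\<close>

lemma simple_isometry:
  assumes t: "0 \<le> t" "t \<le> T" and A: "A \<in> sets (wiener_filtration P t)"
    and s: "simple_integrand P t T N \<tau> \<xi>" and s': "simple_integrand P t T N' \<tau>' \<xi>'"
  shows "C.expectation (\<lambda>\<omega>. indicator A \<omega> * (simple_integral N \<tau> \<xi> T \<omega> * simple_integral N' \<tau>' \<xi>' T \<omega>))
    = (\<integral>p. indicator A (snd p) * (simple_process N \<tau> \<xi> (fst p) (snd p) \<bullet> simple_process N' \<tau>' \<xi>' (fst p) (snd p)) \<partial>time_path t)"
proof -
  note b = simple_integrand_bounds[OF s t(1)] and b' = simple_integrand_bounds[OF s' t(1)]
  define D where "D i \<omega> = \<omega> (\<tau> (Suc i)) - \<omega> (\<tau> i)" for i and \<omega> :: "'d path"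
  define D' where "D' i \<omega> = \<omega> (\<tau>' (Suc i)) - \<omega> (\<tau>' i)" for i and \<omega> :: "'d path"
  define L where "L i j = max 0 (min (\<tau> (Suc i)) (\<tau>' (Suc j)) - max (\<tau> i) (\<tau>' j))" for i j
  define a where "a i \<omega> = indicator A \<omega> *\<^sub>R \<xi> i \<omega>" for i \<omega>
  have ba: "bounded_adapted (\<tau> i) (a i)" if "i < N" for i
    unfolding a_def using b[of i] that A filtration_mono[of t "\<tau> i"]
    by (intro bounded_adapted_indicator) auto
  have tt: "0 \<le> \<tau> i" "\<tau> i \<le> T" "\<tau> i \<le> \<tau> (Suc i)" "\<tau> (Suc i) \<le> T" "t \<le> \<tau> i" if "i < N" for i
    using b(1,2,3)[of i] b(2)[of "Suc i"] that t by auto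
  have tt': "0 \<le> \<tau>' i" "\<tau>' i \<le> T" "\<tau>' i \<le> \<tau>' (Suc i)" "\<tau>' (Suc i) \<le> T" "t \<le> \<tau>' i" if "i < N'" for i
    using b'(1,2,3)[of i] b'(2)[of "Suc i"] that t by auto
  have S: "simple_integral N \<tau> \<xi> T \<omega> = (\<Sum>i<N. \<xi> i \<omega> \<bullet> D i \<omega>)" for \<omega>
    unfolding simple_integral_def D_def by (rule sum.cong) (use tt in \<open>auto simp: min_absorb1\<close>)
  have S': "simple_integral N' \<tau>' \<xi>' T \<omega> = (\<Sum>i<N'. \<xi>' i \<omega> \<bullet> D' i \<omega>)" for \<omega>
    unfolding simple_integral_def D'_def by (rule sum.cong) (use tt' in \<open>auto simp: min_absorb1\<close>)
  have int: "integrable (completion P) (\<lambda>\<omega>. (a i \<omega> \<bullet> D i \<omega>) * (\<xi>' j \<omega> \<bullet> D' j \<omega>))" if "i < N" "j < N'" for i j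
    unfolding D_def D'_def using tt[OF that(1)] tt'[OF that(2)]
    by (intro sqint_integrable_mult sqint_bounded_inner_increment[OF ba[OF that(1)]]
      sqint_bounded_inner_increment[OF b'(4)[OF that(2)]]) auto
  have e: "C.expectation (\<lambda>\<omega>. (a i \<omega> \<bullet> D i \<omega>) * (\<xi>' j \<omega> \<bullet> D' j \<omega>))
      = L i j * C.expectation (\<lambda>\<omega>. a i \<omega> \<bullet> \<xi>' j \<omega>)" if "i < N" "j < N'" for i j
    unfolding D_def D'_def L_def using tt[OF that(1)] tt'[OF that(2)]
    by (intro expectation_increment_products[OF ba[OF that(1)] b'(4)[OF that(2)]]) auto
  have aint: "integrable (completion P) (\<lambda>\<omega>. a i \<omega> \<bullet> \<xi>' j \<omega>)" if "i < N" "j < N'" for i j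
    using tt[OF that(1)] tt'[OF that(2)]
    by (intro sqint_integrable_inner bounded_adapted_sqint[OF ba[OF that(1)]]
      bounded_adapted_sqint[OF b'(4)[OF that(2)]]) auto
  define g :: "nat \<Rightarrow> nat \<Rightarrow> real \<Rightarrow> real" where
    "g i j = indicator {max (\<tau> i) (\<tau>' j)<..min (\<tau> (Suc i)) (\<tau>' (Suc j))}" for i j
  have gint: "integrable (time_measure t) (g i j)" for i j
    unfolding g_def
    by (rule TM.integrable_const_bound[where B=1]) (auto intro!: measurable_time_measure_borel)
  have gL: "integral\<^sup>L (time_measure t) (g i j) = L i j" if "i < N" "j < N'" for i j
    unfolding g_def L_def using tt[OF that(1)] tt'[OF that(2)]
    by (intro integral_indicator_interval) auto
  have "C.expectation (\<lambda>\<omega>. indicator A \<omega> * (simple_integral N \<tau> \<xi> T \<omega> * simple_integral N' \<tau>' \<xi>' T \<omega>))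
     = C.expectation (\<lambda>\<omega>. \<Sum>i<N. \<Sum>j<N'. (a i \<omega> \<bullet> D i \<omega>) * (\<xi>' j \<omega> \<bullet> D' j \<omega>))"
    by (rule Bochner_Integration.integral_cong[OF refl])
      (simp only: S S' sum_product, simp only: sum_distrib_left a_def inner_scaleR_left mult.assoc)
  also have "\<dots> = (\<Sum>i<N. \<Sum>j<N'. C.expectation (\<lambda>\<omega>. (a i \<omega> \<bullet> D i \<omega>) * (\<xi>' j \<omega> \<bullet> D' j \<omega>)))"
    by (rule integral_double_sum) (use int in simp)
  also have "\<dots> = (\<Sum>i<N. \<Sum>j<N'. L i j * C.expectation (\<lambda>\<omega>. a i \<omega> \<bullet> \<xi>' j \<omega>))"
    using e by simp
  also have "\<dots> = (\<Sum>i<N. \<Sum>j<N'. \<integral>p. g i j (fst p) * (a i (snd p) \<bullet> \<xi>' j (snd p)) \<partial>time_path t)"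
  proof (intro sum.cong refl)
    fix i j assume "i \<in> {..<N}" "j \<in> {..<N'}"
    then have ij: "i < N" "j < N'" by auto
    show "L i j * C.expectation (\<lambda>\<omega>. a i \<omega> \<bullet> \<xi>' j \<omega>) = (\<integral>p. g i j (fst p) * (a i (snd p) \<bullet> \<xi>' j (snd p)) \<partial>time_path t)"
      using TP.integral_product_mult(2)[OF gint aint[OF ij]] gL[OF ij] by simp
  qed
  also have "\<dots> = (\<integral>p. (\<Sum>i<N. \<Sum>j<N'. g i j (fst p) * (a i (snd p) \<bullet> \<xi>' j (snd p))) \<partial>time_path t)"
    by (rule integral_double_sum[symmetric]) (use TP.integral_product_mult(1)[OF gint aint] in simp)
  also have "\<dots> = (\<integral>p. indicator A (snd p) * (simple_process N \<tau> \<xi> (fst p) (snd p) \<bullet> simple_process N' \<tau>' \<xi>' (fst p) (snd p)) \<partial>time_path t)"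
  proof (rule Bochner_Integration.integral_cong[OF refl])
    fix p :: "real \<times> 'd path"
    have gi: "g i j r = indicator {\<tau> i<..\<tau> (Suc i)} r * indicator {\<tau>' j<..\<tau>' (Suc j)} r" for i j r
      unfolding g_def by (auto split: split_indicator)
    show "(\<Sum>i<N. \<Sum>j<N'. g i j (fst p) * (a i (snd p) \<bullet> \<xi>' j (snd p)))
      = indicator A (snd p) * (simple_process N \<tau> \<xi> (fst p) (snd p) \<bullet> simple_process N' \<tau>' \<xi>' (fst p) (snd p))"
      unfolding simple_process_def inner_sum_left
      unfolding inner_sum_right sum_distrib_left gi a_def inner_scaleR_left inner_scaleR_right
      by (intro sum.cong refl) (simp only: ac_simps)
  qed
  finally show ?thesis .
qed

end

section \<open>Isometry and martingale property of the Ito integral\<close>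

context wiener_measure_space begin

lemma has_ito_integralE:
  assumes I: "has_ito_integral P t T H I" and t: "0 \<le> t"
  obtains N \<tau> \<xi> where
    "\<And>k. simple_integrand P t T (N k) (\<tau> k) (\<xi> k)"
    "(\<lambda>k. \<integral>\<^sup>+p. ennreal ((norm (H (fst p) (snd p) - simple_process (N k) (\<tau> k) (\<xi> k) (fst p) (snd p)))\<^sup>2) \<partial>time_path t) \<longlonglongrightarrow> 0"
    "\<And>r. r \<in> {t..T} \<Longrightarrow> (\<lambda>k. \<integral>\<^sup>+\<omega>. ennreal ((norm (I r \<omega> - simple_integral (N k) (\<tau> k) (\<xi> k) r \<omega>))\<^sup>2) \<partial>completion P) \<longlonglongrightarrow> 0"
proof -
  from I obtain N \<tau> \<xi> where
    *: "\<forall>k. simple_integrand P t T (N k) (\<tau> k) (\<xi> k)"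
    "(\<lambda>k. L2_dt_dP P t T (\<lambda>r \<omega>. H r \<omega> - simple_process (N k) (\<tau> k) (\<xi> k) r \<omega>)) \<longlonglongrightarrow> 0"
    "\<forall>r\<in>{t..T}. (\<lambda>k. \<integral>\<^sup>+\<omega>. ennreal ((I r \<omega> - simple_integral (N k) (\<tau> k) (\<xi> k) r \<omega>)\<^sup>2) \<partial>completion P) \<longlonglongrightarrow> 0"
    unfolding has_ito_integral_def by blast
  show ?thesis
  proof (rule that)
    show "\<And>k. simple_integrand P t T (N k) (\<tau> k) (\<xi> k)" using *(1) by blast
    show "(\<lambda>k. \<integral>\<^sup>+p. ennreal ((norm (H (fst p) (snd p) - simple_process (N k) (\<tau> k) (\<xi> k) (fst p) (snd p)))\<^sup>2) \<partial>time_path t) \<longlonglongrightarrow> 0"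
      using *(2) by (simp add: L2_dt_dP_def case_prod_unfold time_measure_def)
    show "(\<lambda>k. \<integral>\<^sup>+\<omega>. ennreal ((norm (I r \<omega> - simple_integral (N k) (\<tau> k) (\<xi> k) r \<omega>))\<^sup>2) \<partial>completion P) \<longlonglongrightarrow> 0"
      if "r \<in> {t..T}" for r using *(3) that by simp
  qed
qed

lemma has_ito_integral_adapted:
  "has_ito_integral P t T H I \<Longrightarrow> t \<le> r \<Longrightarrow> r \<le> T \<Longrightarrow> I r \<in> borel_measurable (wiener_filtration P r)"
  by (simp add: has_ito_integral_def adapted_continuous_def)

lemma has_ito_integral_sqint_integrand:
  "has_ito_integral P t T H I \<Longrightarrow> t \<le> T \<Longrightarrow> sqint (time_path t) (\<lambda>p. H (fst p) (snd p))"
  unfolding has_ito_integral_def by (intro H2_sqint) simp_all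

text \<open>
  A simple integral at finite \<open>L\<^sup>2\<close> distance exists along the approximating sequence.
\<close>

lemma sqint_ito_integral:
  assumes I: "has_ito_integral P t T H I" and t: "0 \<le> t" "t \<le> r" "r \<le> T"
  shows "sqint (completion P) (I r)"
proof -
  obtain N \<tau> \<xi> where s: "\<And>k. simple_integrand P t T (N k) (\<tau> k) (\<xi> k)"
    and l: "\<And>r. r \<in> {t..T} \<Longrightarrow> (\<lambda>k. \<integral>\<^sup>+\<omega>. ennreal ((norm (I r \<omega> - simple_integral (N k) (\<tau> k) (\<xi> k) r \<omega>))\<^sup>2) \<partial>completion P) \<longlonglongrightarrow> 0"
    by (rule has_ito_integralE[OF I t(1)]) blast
  have rm: "r \<in> {t..T}" using t by auto
  have "eventually (\<lambda>k. (\<integral>\<^sup>+\<omega>. ennreal ((norm (I r \<omega> - simple_integral (N k) (\<tau> k) (\<xi> k) r \<omega>))\<^sup>2) \<partial>completion P) < 1) sequentially"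
    by (rule order_tendstoD(2)[OF l[OF rm]]) simp
  then obtain k where k: "(\<integral>\<^sup>+\<omega>. ennreal ((norm (I r \<omega> - simple_integral (N k) (\<tau> k) (\<xi> k) r \<omega>))\<^sup>2) \<partial>completion P) < 1"
    by (rule eventually_happens'[OF sequentially_bot, THEN exE])
  have S: "sqint (completion P) (simple_integral (N k) (\<tau> k) (\<xi> k) r)"
    by (rule sqint_simple_integral[OF s t])
  have m: "I r \<in> borel_measurable (completion P)"
    by (rule measurable_filtration_completion[OF has_ito_integral_adapted[OF I t(2,3)] t(3)])
  have D: "sqint (completion P) (\<lambda>\<omega>. I r \<omega> - simple_integral (N k) (\<tau> k) (\<xi> k) r \<omega>)"
    using k by (subst sqint_iff_nn[OF borel_measurable_diff[OF m sqint_measurable[OF S]]]) (auto elim: less_trans)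
  show ?thesis using sqint_add[OF D S] by simp
qed

lemma ito_isometry:
  assumes I: "has_ito_integral P t T H I" and I': "has_ito_integral P t T H' I'"
    and t: "0 \<le> t" "t \<le> T" and A: "A \<in> sets (wiener_filtration P t)"
  shows "C.expectation (\<lambda>\<omega>. indicator A \<omega> * (I T \<omega> * I' T \<omega>))
    = (\<integral>p. indicator A (snd p) * (H (fst p) (snd p) \<bullet> H' (fst p) (snd p)) \<partial>time_path t)"
proof -
  obtain N \<tau> \<xi> where s: "\<And>k. simple_integrand P t T (N k) (\<tau> k) (\<xi> k)"
    and h: "(\<lambda>k. \<integral>\<^sup>+p. ennreal ((norm (H (fst p) (snd p) - simple_process (N k) (\<tau> k) (\<xi> k) (fst p) (snd p)))\<^sup>2) \<partial>time_path t) \<longlonglongrightarrow> 0"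
    and l: "\<And>r. r \<in> {t..T} \<Longrightarrow> (\<lambda>k. \<integral>\<^sup>+\<omega>. ennreal ((norm (I r \<omega> - simple_integral (N k) (\<tau> k) (\<xi> k) r \<omega>))\<^sup>2) \<partial>completion P) \<longlonglongrightarrow> 0"
    by (rule has_ito_integralE[OF I t(1)]) blast
  obtain N' \<tau>' \<xi>' where s': "\<And>k. simple_integrand P t T (N' k) (\<tau>' k) (\<xi>' k)"
    and h': "(\<lambda>k. \<integral>\<^sup>+p. ennreal ((norm (H' (fst p) (snd p) - simple_process (N' k) (\<tau>' k) (\<xi>' k) (fst p) (snd p)))\<^sup>2) \<partial>time_path t) \<longlonglongrightarrow> 0"
    and l': "\<And>r. r \<in> {t..T} \<Longrightarrow> (\<lambda>k. \<integral>\<^sup>+\<omega>. ennreal ((norm (I' r \<omega> - simple_integral (N' k) (\<tau>' k) (\<xi>' k) r \<omega>))\<^sup>2) \<partial>completion P) \<longlonglongrightarrow> 0"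
    by (rule has_ito_integralE[OF I' t(1)]) blast
  have Tm: "T \<in> {t..T}" using t by auto
  have Am: "(indicator A :: _ \<Rightarrow> real) \<in> borel_measurable (completion P)"
    using subsetD[OF filtration_subset_completion[OF t(2)] A] by simp
  have b: "\<bar>indicator A x\<bar> \<le> (1::real)" for x by (simp split: split_indicator)
  have "(\<lambda>k. C.expectation (\<lambda>\<omega>. indicator A \<omega> *
      (simple_integral (N k) (\<tau> k) (\<xi> k) T \<omega> \<bullet> simple_integral (N' k) (\<tau>' k) (\<xi>' k) T \<omega>)))
    \<longlonglongrightarrow> C.expectation (\<lambda>\<omega>. indicator A \<omega> * (I T \<omega> \<bullet> I' T \<omega>))"
    by (rule integral_inner_tendsto[OF sqint_ito_integral[OF I t order.refl] sqint_simple_integral[OF s t order.refl]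
      sqint_ito_integral[OF I' t order.refl] sqint_simple_integral[OF s' t order.refl] Am AE_I2[OF b] l[OF Tm] l'[OF Tm]])
  moreover have "(\<lambda>k. \<integral>p. indicator A (snd p) *
      (simple_process (N k) (\<tau> k) (\<xi> k) (fst p) (snd p) \<bullet> simple_process (N' k) (\<tau>' k) (\<xi>' k) (fst p) (snd p)) \<partial>time_path t)
    \<longlonglongrightarrow> (\<integral>p. indicator A (snd p) * (H (fst p) (snd p) \<bullet> H' (fst p) (snd p)) \<partial>time_path t)"
    by (rule integral_inner_tendsto[OF has_ito_integral_sqint_integrand[OF I t(2)] sqint_simple_process[OF s t(1)]
      has_ito_integral_sqint_integrand[OF I' t(2)] sqint_simple_process[OF s' t(1)]
      measurable_compose[OF measurable_snd Am] AE_I2[OF b] h h'])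
  ultimately show ?thesis
    using simple_isometry[OF t A s s'] by (simp add: LIMSEQ_unique)
qed

lemma simple_integral_martingale:
  assumes s: "simple_integrand P t T N \<tau> \<xi>" and t: "0 \<le> t" "t \<le> r" "r \<le> q" "q \<le> T"
    and \<zeta>: "\<zeta> \<in> borel_measurable (wiener_filtration P r)" "sqint (completion P) \<zeta>"
  shows "C.expectation (\<lambda>\<omega>. \<zeta> \<omega> * (simple_integral N \<tau> \<xi> q \<omega> - simple_integral N \<tau> \<xi> r \<omega>)) = 0"
proof -
  note b = simple_integrand_bounds[OF s t(1)]
  define \<Delta> where "\<Delta> i \<omega> = \<xi> i \<omega> \<bullet> (\<omega> (min (\<tau> (Suc i)) q) - \<omega> (min (\<tau> i) q))
    - \<xi> i \<omega> \<bullet> (\<omega> (min (\<tau> (Suc i)) r) - \<omega> (min (\<tau> i) r))" for i \<omega>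
  have "integrable (completion P) (\<lambda>\<omega>. \<zeta> \<omega> * \<Delta> i \<omega>) \<and> C.expectation (\<lambda>\<omega>. \<zeta> \<omega> * \<Delta> i \<omega>) = 0" if i: "i < N" for i
  proof -
    have o: "t \<le> \<tau> i" "\<tau> i \<le> \<tau> (Suc i)" "\<tau> (Suc i) \<le> T" using b(1)[of i] b(2)[of "Suc i"] b(3)[of i] i by auto
    \<comment> \<open>Over \<open>(r, q]\<close> only the part \<open>(p, p']\<close> of the \<open>i\<close>-th interval contributes, and both
      \<open>\<zeta>\<close> and \<open>\<xi> i\<close> are known at time \<open>p\<close>.\<close>
    define p where "p = max (\<tau> i) r"
    define p' where "p' = max p (min (\<tau> (Suc i)) q)"
    have eq: "\<Delta> i \<omega> = (if \<tau> i < q \<and> r < \<tau> (Suc i) then \<xi> i \<omega> \<bullet> (\<omega> p' - \<omega> p) else 0)" for \<omega>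
      unfolding \<Delta>_def p_def p'_def using o t
      by (auto simp: min_def max_def inner_diff_right)
    have pp: "r \<le> p" "\<tau> i \<le> p" "p \<le> p'" "p' \<le> T" "p \<le> T" "0 \<le> p"
      unfolding p_def p'_def using o t by auto
    have ba: "bounded_adapted p (\<xi> i)" using bounded_adapted_mono[OF b(4)[OF i] pp(2)] .
    have "integrable (completion P) (\<lambda>\<omega>. \<zeta> \<omega> * (\<xi> i \<omega> \<bullet> (\<omega> p' - \<omega> p)))"
      using pp by (intro sqint_integrable_mult \<zeta>(2) sqint_bounded_inner_increment[OF ba]) auto
    moreover have "C.expectation (\<lambda>\<omega>. \<zeta> \<omega> * (\<xi> i \<omega> \<bullet> (\<omega> p' - \<omega> p))) = 0"
      by (rule expectation_adapted_mult_increment[OF pp(6,3,4) measurable_filtration_mono[OF \<zeta>(1) pp(1)] \<zeta>(2) ba])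
    ultimately show ?thesis unfolding eq by (cases "\<tau> i < q \<and> r < \<tau> (Suc i)") auto
  qed
  then have "C.expectation (\<lambda>\<omega>. \<Sum>i<N. \<zeta> \<omega> * \<Delta> i \<omega>) = 0"
    by (subst Bochner_Integration.integral_sum) auto
  moreover have "\<zeta> \<omega> * (simple_integral N \<tau> \<xi> q \<omega> - simple_integral N \<tau> \<xi> r \<omega>) = (\<Sum>i<N. \<zeta> \<omega> * \<Delta> i \<omega>)" for \<omega>
    unfolding simple_integral_def \<Delta>_def sum_subtractf[symmetric] sum_distrib_left ..
  ultimately show ?thesis by simp
qed

text \<open>
  The factor \<open>\<zeta>\<close> is kept fixed while the simple integrals converge in \<open>L\<^sup>2\<close>.
\<close>

lemma ito_martingale:
  assumes I: "has_ito_integral P t T H I" and t: "0 \<le> t" "t \<le> r" "r \<le> q" "q \<le> T"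
    and \<zeta>: "\<zeta> \<in> borel_measurable (wiener_filtration P r)" "sqint (completion P) \<zeta>"
  shows "C.expectation (\<lambda>\<omega>. \<zeta> \<omega> * (I q \<omega> - I r \<omega>)) = 0"
proof -
  obtain N \<tau> \<xi> where s: "\<And>k. simple_integrand P t T (N k) (\<tau> k) (\<xi> k)"
    and l: "\<And>r. r \<in> {t..T} \<Longrightarrow> (\<lambda>k. \<integral>\<^sup>+\<omega>. ennreal ((norm (I r \<omega> - simple_integral (N k) (\<tau> k) (\<xi> k) r \<omega>))\<^sup>2) \<partial>completion P) \<longlonglongrightarrow> 0"
    by (rule has_ito_integralE[OF I t(1)]) blast
  have tq: "t \<le> q" "r \<le> T" using t by auto
  have lim: "(\<lambda>k. C.expectation (\<lambda>\<omega>. \<zeta> \<omega> * simple_integral (N k) (\<tau> k) (\<xi> k) v \<omega>)) \<longlonglongrightarrow> C.expectation (\<lambda>\<omega>. \<zeta> \<omega> * I v \<omega>)"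
    if v: "t \<le> v" "v \<le> T" for v
  proof -
    have "(\<lambda>k. C.expectation (\<lambda>\<omega>. 1 * (\<zeta> \<omega> \<bullet> simple_integral (N k) (\<tau> k) (\<xi> k) v \<omega>))) \<longlonglongrightarrow> C.expectation (\<lambda>\<omega>. 1 * (\<zeta> \<omega> \<bullet> I v \<omega>))"
    proof (rule integral_inner_tendsto[OF \<zeta>(2) \<zeta>(2) sqint_ito_integral[OF I t(1) v] sqint_simple_integral[OF s t(1) v]])
      show "(\<lambda>k. \<integral>\<^sup>+\<omega>. ennreal ((norm (I v \<omega> - simple_integral (N k) (\<tau> k) (\<xi> k) v \<omega>))\<^sup>2) \<partial>completion P) \<longlonglongrightarrow> 0"
        using l[of v] v by auto
    qed auto
    then show ?thesis by simp
  qed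
  have int: "integrable (completion P) (\<lambda>\<omega>. \<zeta> \<omega> * I v \<omega>)"
    "integrable (completion P) (\<lambda>\<omega>. \<zeta> \<omega> * simple_integral (N k) (\<tau> k) (\<xi> k) v \<omega>)" if "t \<le> v" "v \<le> T" for v k
    using that by (auto intro!: sqint_integrable_mult \<zeta> sqint_ito_integral[OF I t(1)] sqint_simple_integral[OF s t(1)])
  have "C.expectation (\<lambda>\<omega>. \<zeta> \<omega> * simple_integral (N k) (\<tau> k) (\<xi> k) q \<omega>)
    = C.expectation (\<lambda>\<omega>. \<zeta> \<omega> * simple_integral (N k) (\<tau> k) (\<xi> k) r \<omega>)" for k
    using simple_integral_martingale[OF s t \<zeta>] int(2)[OF tq(1) t(4)] int(2)[OF t(2) tq(2)]
    by (simp add: right_diff_distrib)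
  then have "C.expectation (\<lambda>\<omega>. \<zeta> \<omega> * I q \<omega>) = C.expectation (\<lambda>\<omega>. \<zeta> \<omega> * I r \<omega>)"
    using lim[OF tq(1) t(4)] lim[OF t(2) tq(2)] by (simp add: LIMSEQ_unique)
  then show ?thesis
    using int(1)[OF tq(1) t(4)] int(1)[OF t(2) tq(2)] by (simp add: right_diff_distrib)
qed

end

section \<open>Measurability of processes and of coefficients along them\<close>

text \<open>
  The ambient metric space of controls need not be separable, but its compact subset is.
\<close>

lemma compact_dense_sequence:
  fixes U :: "'u::metric_space set"
  assumes U: "compact U" "U \<noteq> {}"
  obtains c :: "nat \<Rightarrow> 'u" where "\<And>i. c i \<in> U" "\<And>v e. v \<in> U \<Longrightarrow> e > 0 \<Longrightarrow> \<exists>i. dist (c i) v < e"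
proof -
  have "\<exists>C. C \<subseteq> U \<and> finite C \<and> U \<subseteq> (\<Union>x\<in>C. ball x (1 / real (Suc n)))" for n
    by (rule compactE_image[OF U(1), of U "\<lambda>x. ball x (1 / real (Suc n))"]) auto
  then obtain C where C: "\<And>n. C n \<subseteq> U" "\<And>n. finite (C n)" "\<And>n. U \<subseteq> (\<Union>x\<in>C n. ball x (1 / real (Suc n)))"
    by metis
  define D where "D = (\<Union>n. C n)"
  have D: "countable D" unfolding D_def using C(2) by (simp add: countable_finite)
  have "D \<noteq> {}" using C(3)[of 0] U(2) unfolding D_def by auto
  have r: "range (from_nat_into D) = D" by (rule range_from_nat_into[OF \<open>D \<noteq> {}\<close> D])
  show thesis
  proof (rule that[of "from_nat_into D"])
    show "from_nat_into D i \<in> U" for i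
      using r C(1) unfolding D_def by blast
    fix v and e :: real assume v: "v \<in> U" and e: "e > 0"
    obtain n where n: "1 / real (Suc n) < e" using nat_approx_posE[OF e] by blast
    obtain x where x: "x \<in> C n" "dist x v < 1 / real (Suc n)" using C(3)[of n] v by auto
    have "x \<in> D" unfolding D_def using x(1) by blast
    then have "x \<in> range (from_nat_into D)" unfolding r .
    then obtain i where "x = from_nat_into D i" by blast
    with x n show "\<exists>i. dist (from_nat_into D i) v < e" by (intro exI[of _ i]) auto
  qed
qed

text \<open>
  The pair \<open>(h, u)\<close> need not be Borel measurable, since the space of controls is not assumed to be
  second countable. So the control is replaced by the first member of a dense sequence that lies
  within \<open>1 / (n + 1)\<close> of it. This takes countably many values, and \<open>n\<close> tends to infinity.
\<close>

lemma caratheodory_measurable: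
  fixes g :: "'w::topological_space \<Rightarrow> 'u::metric_space \<Rightarrow> 'v::metric_space"
  assumes U: "compact U" "U \<noteq> {}"
    and gw: "\<And>v. v \<in> U \<Longrightarrow> continuous_on S (\<lambda>w. g w v)"
    and gu: "\<And>w. w \<in> S \<Longrightarrow> continuous_on U (g w)"
    and h: "h \<in> borel_measurable M" "\<And>p. p \<in> space M \<Longrightarrow> h p \<in> S"
    and u: "u \<in> borel_measurable M" "\<And>p. p \<in> space M \<Longrightarrow> u p \<in> U"
  shows "(\<lambda>p. g (h p) (u p)) \<in> borel_measurable M"
proof -
  obtain c :: "nat \<Rightarrow> 'u" where c: "\<And>i. c i \<in> U" "\<And>v e. v \<in> U \<Longrightarrow> e > 0 \<Longrightarrow> \<exists>i. dist (c i) v < e"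
    by (rule compact_dense_sequence[OF U]) blast
  define k where "k n p = (LEAST i. dist (c i) (u p) < 1 / real (Suc n))" for n p
  have kd: "dist (c (k n p)) (u p) < 1 / real (Suc n)" if "p \<in> space M" for n p
    unfolding k_def by (rule LeastI_ex) (use c(2)[OF u(2)[OF that]] in simp)
  have "(\<lambda>p. dist (c i) (u p)) \<in> borel_measurable M" for i
    by (rule measurable_compose[OF u(1)]) (intro borel_measurable_continuous_onI continuous_intros)
  then have km: "k n \<in> measurable M (count_space UNIV)" for n
    unfolding k_def by (intro measurable_Least) measurable
  have hm: "(\<lambda>p. g (h p) v) \<in> borel_measurable M" if "v \<in> U" for v
  proof -
    have "h \<in> measurable M (restrict_space borel S)" using h by (intro measurable_restrict_space2) auto
    from measurable_compose[OF this borel_measurable_continuous_on_restrict[OF gw[OF that]]] show ?thesis .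
  qed
  show ?thesis
  proof (rule borel_measurable_LIMSEQ_metric)
    show "(\<lambda>p. g (h p) (c (k n p))) \<in> borel_measurable M" for n
      by (rule measurable_compose_countable[OF hm[OF c(1)] km])
    fix p assume p: "p \<in> space M"
    have "(\<lambda>n. c (k n p)) \<longlonglongrightarrow> u p"
    proof (rule metric_LIMSEQ_I)
      fix r :: real assume "r > 0"
      then obtain N where N: "1 / real (Suc N) < r" using nat_approx_posE by blast
      have "dist (c (k n p)) (u p) < r" if "N \<le> n" for n
      proof -
        have "1 / real (Suc n) \<le> 1 / real (Suc N)" using that by (intro divide_left_mono) auto
        then show ?thesis using kd[OF p, of n] N by linarith
      qed
      then show "\<exists>N. \<forall>n\<ge>N. dist (c (k n p)) (u p) < r" by blast
    qed
    then show "(\<lambda>n. g (h p) (c (k n p))) \<longlonglongrightarrow> g (h p) (u p)"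
      by (rule continuous_on_tendsto_compose[OF gu[OF h(2)[OF p]]]) (use u(2)[OF p] c(1) in auto)
  qed
qed

text \<open>
  Continuity in time alone suffices because the Lipschitz constant in the other variables is uniform
  in time.
\<close>

lemma lipschitz_xyz_continuous:
  fixes \<beta> :: "real \<Rightarrow> 'x::real_normed_vector \<Rightarrow> real \<Rightarrow> 'z::real_normed_vector \<Rightarrow> 'u \<Rightarrow> 'v::real_normed_vector"
  assumes L: "lipschitz_xyz T U K \<beta>" and v: "v \<in> U"
    and c: "\<And>x y z. continuous_on {0..T} (\<lambda>t. \<beta> t x y z v)"
  shows "continuous_on ({0..T} \<times> UNIV) (\<lambda>(t, x, y, z). \<beta> t x y z v)"
  unfolding continuous_on_def
proof clarify
  fix t :: real and x :: 'x and y :: real and z :: 'z assume t: "t \<in> {0..T}"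
  let ?F = "at (t, x, y, z) within {0..T} \<times> UNIV"
  let ?R = "\<lambda>p. K * (norm (fst (snd p) - x) + \<bar>fst (snd (snd p)) - y\<bar> + norm (snd (snd (snd p)) - z))
      + norm (\<beta> (fst p) x y z v - \<beta> t x y z v)"
  have id: "((\<lambda>p. p) \<longlongrightarrow> (t, x, y, z)) ?F" by (rule tendsto_ident_at)
  have ev: "eventually (\<lambda>p. fst p \<in> {0..T}) ?F"
    unfolding eventually_at_filter by (rule always_eventually) auto
  have ft: "(fst \<longlongrightarrow> t) ?F" using tendsto_fst[OF id] by simp
  have "((\<lambda>p. \<beta> (fst p) x y z v) \<longlongrightarrow> \<beta> t x y z v) ?F"
    by (rule continuous_on_tendsto_compose[OF c ft t ev])
  then have "((\<lambda>p. norm (\<beta> (fst p) x y z v - \<beta> t x y z v)) \<longlongrightarrow> norm (\<beta> t x y z v - \<beta> t x y z v)) ?F"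
    by (intro tendsto_intros)
  moreover have "((\<lambda>p. K * (norm (fst (snd p) - x) + \<bar>fst (snd (snd p)) - y\<bar> + norm (snd (snd (snd p)) - z)))
     \<longlongrightarrow> K * (norm (fst (snd (t, x, y, z)) - x) + \<bar>fst (snd (snd (t, x, y, z))) - y\<bar> + norm (snd (snd (snd (t, x, y, z))) - z))) ?F"
    by (intro tendsto_intros id)
  ultimately have R: "(?R \<longlongrightarrow> 0) ?F" using tendsto_add by fastforce
  have "((\<lambda>p. (case p of (t, x, y, z) \<Rightarrow> \<beta> t x y z v) - \<beta> t x y z v) \<longlongrightarrow> 0) ?F"
  proof (rule Lim_null_comparison[OF _ R])
    have "norm ((case p of (t, x, y, z) \<Rightarrow> \<beta> t x y z v) - \<beta> t x y z v) \<le> ?R p" if p: "fst p \<in> {0..T}" for p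
    proof -
      obtain t' x' y' z' where pe: "p = (t', x', y', z')" by (metis prod.exhaust)
      have "norm (\<beta> t' x' y' z' v - \<beta> t' x y z v) \<le> K * (norm (x' - x) + \<bar>y' - y\<bar> + norm (z' - z))"
        using L v p unfolding lipschitz_xyz_def pe by simp
      moreover have "norm (\<beta> t' x' y' z' v - \<beta> t x y z v)
        \<le> norm (\<beta> t' x' y' z' v - \<beta> t' x y z v) + norm (\<beta> t' x y z v - \<beta> t x y z v)"
        using norm_triangle_ineq[of "\<beta> t' x' y' z' v - \<beta> t' x y z v" "\<beta> t' x y z v - \<beta> t x y z v"] by simp
      ultimately show ?thesis unfolding pe by simp
    qed
    then show "eventually (\<lambda>p. norm ((case p of (t, x, y, z) \<Rightarrow> \<beta> t x y z v) - \<beta> t x y z v) \<le> ?R p) ?F"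
      by (rule eventually_mono[OF ev])
  qed
  then show "((\<lambda>(t, x, y, z). \<beta> t x y z v) \<longlongrightarrow> \<beta> t x y z v) ?F"
    by (simp add: LIM_zero_iff)
qed

lemma coefficient_measurable:
  fixes \<beta> :: "real \<Rightarrow> real^'n::finite \<Rightarrow> real \<Rightarrow> real^'d::finite \<Rightarrow> 'u::metric_space \<Rightarrow> 'v::real_normed_vector"
  assumes U: "compact U" "U \<noteq> {}" and L: "lipschitz_xyz T U K \<beta>"
    and c: "\<And>x y z. continuous_on ({0..T} \<times> U) (\<lambda>(t, u). \<beta> t x y z u)"
    and m: "\<rho> \<in> borel_measurable M" "X \<in> borel_measurable M" "Y \<in> borel_measurable M" "Z \<in> borel_measurable M"
    and \<rho>: "\<And>p. p \<in> space M \<Longrightarrow> \<rho> p \<in> {0..T}"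
    and u: "u \<in> borel_measurable M" "\<And>p. p \<in> space M \<Longrightarrow> u p \<in> U"
  shows "(\<lambda>p. \<beta> (\<rho> p) (X p) (Y p) (Z p) (u p)) \<in> borel_measurable M"
proof -
  have ct: "continuous_on {0..T} (\<lambda>t. \<beta> t x y z v)" if "v \<in> U" for x y z v
  proof -
    have "continuous_on {0..T} (\<lambda>t. (t, v))" by (intro continuous_intros)
    from continuous_on_compose2[OF c[of x y z] this] that show ?thesis by auto
  qed
  have cu: "continuous_on U (\<lambda>v. \<beta> t x y z v)" if "t \<in> {0..T}" for x y z t
  proof -
    have "continuous_on U (\<lambda>v. (t, v))" by (intro continuous_intros)
    moreover have "(\<lambda>v. (t, v)) ` U \<subseteq> {0..T} \<times> U" using that by auto
    ultimately show ?thesis using continuous_on_compose2[OF c[of x y z]] by fastforce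
  qed
  have "(\<lambda>p. (\<lambda>w v. case w of (t, x, y, z) \<Rightarrow> \<beta> t x y z v) (\<rho> p, X p, Y p, Z p) (u p)) \<in> borel_measurable M"
  proof (rule caratheodory_measurable[OF U, where S="{0..T} \<times> UNIV"])
    show "continuous_on ({0..T} \<times> UNIV) (\<lambda>w. case w of (t, x, y, z) \<Rightarrow> \<beta> t x y z v)" if "v \<in> U" for v
      by (rule lipschitz_xyz_continuous[OF L that ct[OF that]])
    show "continuous_on U (\<lambda>v. case w of (t, x, y, z) \<Rightarrow> \<beta> t x y z v)" if "w \<in> {0..T} \<times> UNIV" for w
      using that cu by auto
    show "(\<lambda>p. (\<rho> p, X p, Y p, Z p)) \<in> borel_measurable M" by (intro borel_measurable_Pair m)
  qed (use \<rho> u in auto)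
  then show ?thesis by simp
qed

lemma coefficient_linear_growth:
  fixes \<beta> :: "real \<Rightarrow> 'x::real_normed_vector \<Rightarrow> real \<Rightarrow> 'z::real_normed_vector \<Rightarrow> 'u::metric_space \<Rightarrow> 'v::real_normed_vector"
  assumes U: "compact U" and L: "lipschitz_xyz T U K \<beta>"
    and c: "\<And>x y z. continuous_on ({0..T} \<times> U) (\<lambda>(t, u). \<beta> t x y z u)"
  obtains C where "C \<ge> 0" "\<And>t x y z v. t \<in> {0..T} \<Longrightarrow> v \<in> U \<Longrightarrow>
    norm (\<beta> t x y z v) \<le> C + K * (norm x + \<bar>y\<bar> + norm z)"
proof -
  have "compact ((\<lambda>(t, v). \<beta> t 0 0 0 v) ` ({0..T} \<times> U))"
    by (intro compact_continuous_image c compact_Times U compact_Icc)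
  then obtain C where C': "\<forall>w\<in>(\<lambda>(t, v). \<beta> t 0 0 0 v) ` ({0..T} \<times> U). norm w \<le> C"
    using bounded_iff compact_imp_bounded by blast
  have C: "norm (\<beta> t 0 0 0 v) \<le> C" if "t \<in> {0..T}" "v \<in> U" for t v
    using C' that by auto
  show thesis
  proof (rule that[of "\<bar>C\<bar>"])
    fix t x y z v assume tv: "t \<in> {0..T}" "v \<in> U"
    then have "norm (\<beta> t x y z v - \<beta> t 0 0 0 v) \<le> K * (norm (x - 0) + \<bar>y - 0\<bar> + norm (z - 0))"
      using L unfolding lipschitz_xyz_def by blast
    then show "norm (\<beta> t x y z v) \<le> \<bar>C\<bar> + K * (norm x + \<bar>y\<bar> + norm z)"
      using C[OF tv] norm_triangle_sub[of "\<beta> t x y z v" "\<beta> t 0 0 0 v"] by simp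
  qed simp
qed

lemma floor_grid_tendsto: "(\<lambda>n. real_of_int \<lfloor>real (Suc n) * r\<rfloor> / real (Suc n)) \<longlonglongrightarrow> r"
proof (rule LIMSEQ_I)
  fix e :: real assume "e > 0"
  then obtain N where N: "1 / real (Suc N) < e" using nat_approx_posE by blast
  have "norm (real_of_int \<lfloor>real (Suc n) * r\<rfloor> / real (Suc n) - r) < e" if n: "N \<le> n" for n
  proof -
    let ?m = "real (Suc n)"
    have "real_of_int \<lfloor>?m * r\<rfloor> \<le> ?m * r" "?m * r < real_of_int \<lfloor>?m * r\<rfloor> + 1" by linarith+
    then have "real_of_int \<lfloor>?m * r\<rfloor> / ?m \<le> r" "r < real_of_int \<lfloor>?m * r\<rfloor> / ?m + 1 / ?m"
      by (simp_all add: field_simps)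
    moreover have "1 / ?m \<le> 1 / real (Suc N)" using n by (intro divide_left_mono) auto
    ultimately show ?thesis using N unfolding real_norm_def by linarith
  qed
  then show "\<exists>N. \<forall>n\<ge>N. norm (real_of_int \<lfloor>real (Suc n) * r\<rfloor> / real (Suc n) - r) < e" by blast
qed

context wiener_measure_space begin

text \<open>
  Freezing the time argument at the points of a grid gives a countable gluing of measurable maps,
  and path continuity identifies the limit.
\<close>

lemma adapted_continuous_measurable:
  fixes X :: "real \<Rightarrow> 'd path \<Rightarrow> 'b::metric_space"
  assumes X: "adapted_continuous P t T X" and t: "t \<le> T"
  shows "(\<lambda>p. X (fst p) (snd p)) \<in> borel_measurable (time_path t)"
proof (rule borel_measurable_LIMSEQ_metric)
  define gr where "gr n i = max t (min T (real_of_int i / real (Suc n)))" for n :: nat and i :: int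
  have gr: "t \<le> gr n i" "gr n i \<le> T" for n i unfolding gr_def using t by auto
  have Xm: "X r \<in> borel_measurable (completion P)" if "t \<le> r" "r \<le> T" for r
    using X that measurable_filtration_completion[of "X r" r] unfolding adapted_continuous_def by simp
  have fl: "(\<lambda>p. \<lfloor>real (Suc n) * fst p\<rfloor>) \<in> measurable (time_path t) (count_space UNIV)" for n
    by (rule measurable_compose[OF measurable_fst], rule measurable_compose[OF _ measurable_real_floor])
      (intro measurable_time_measure_borel borel_measurable_times borel_measurable_const measurable_ident_sets refl)
  show "(\<lambda>p. X (gr n \<lfloor>real (Suc n) * fst p\<rfloor>) (snd p)) \<in> borel_measurable (time_path t)" for n
    by (rule measurable_compose_countable[where g="\<lambda>p. \<lfloor>real (Suc n) * fst p\<rfloor>", OF measurable_compose[OF measurable_snd Xm[OF gr]] fl])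
  fix p assume "p \<in> space (time_path t)"
  then have p: "fst p \<in> {t..T}" "snd p \<in> space P" by (auto simp: space_pair_measure)
  have "(\<lambda>n. max t (min T (real_of_int \<lfloor>real (Suc n) * fst p\<rfloor> / real (Suc n)))) \<longlonglongrightarrow> max t (min T (fst p))"
    by (intro tendsto_intros floor_grid_tendsto)
  then have "(\<lambda>n. gr n \<lfloor>real (Suc n) * fst p\<rfloor>) \<longlonglongrightarrow> fst p"
    using p(1) unfolding gr_def by simp
  then show "(\<lambda>n. X (gr n \<lfloor>real (Suc n) * fst p\<rfloor>) (snd p)) \<longlonglongrightarrow> X (fst p) (snd p)"
  proof (rule continuous_on_tendsto_compose[where s="{t..T}" and f="\<lambda>r. X r (snd p)", rotated])
    show "continuous_on {t..T} (\<lambda>r. X r (snd p))" using X p(2) unfolding adapted_continuous_def by blast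
  qed (use p gr in auto)
qed

lemma progressive_section:
  assumes Z: "progressive P t T Z" and s: "t \<le> s" "s \<le> T"
  shows "Z s \<in> borel_measurable (wiener_filtration P s)"
proof -
  have "s \<in> {t..T}" using s by simp
  from Z[unfolded progressive_def, THEN bspec, OF this]
  have m: "(\<lambda>(r, \<omega>). Z r \<omega>) \<in> borel_measurable (restrict_space borel {t..s} \<Otimes>\<^sub>M wiener_filtration P s)" .
  have "(\<lambda>\<omega>. (s, \<omega>)) \<in> measurable (wiener_filtration P s) (restrict_space borel {t..s} \<Otimes>\<^sub>M wiener_filtration P s)"
    by (rule measurable_Pair1') (use s in \<open>simp add: space_restrict_space\<close>)
  from measurable_compose[OF this m] show ?thesis by simp
qed

lemma S2_sqint_section:
  fixes X :: "real \<Rightarrow> 'd path \<Rightarrow> 'b::euclidean_space"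
  assumes X: "X \<in> S2 P t T" and r: "t \<le> r" "r \<le> T"
  shows "sqint (completion P) (X r)"
proof -
  have "X r \<in> borel_measurable (wiener_filtration P r)" using X r unfolding S2_def adapted_continuous_def by simp
  then have m: "X r \<in> borel_measurable (completion P)" by (rule measurable_filtration_completion[OF _ r(2)])
  have "(\<integral>\<^sup>+\<omega>. ennreal ((norm (X r \<omega>))\<^sup>2) \<partial>completion P)
    \<le> (\<integral>\<^sup>+\<omega>. (SUP r\<in>{t..T}. ennreal ((norm (X r \<omega>))\<^sup>2)) \<partial>completion P)"
    by (intro nn_integral_mono SUP_upper) (use r in auto)
  also have "\<dots> < \<infinity>" using X unfolding S2_def by simp
  finally show ?thesis using sqint_iff_nn[OF m] by simp
qed

lemma S2_sqint_time_path:
  fixes X :: "real \<Rightarrow> 'd path \<Rightarrow> 'b::euclidean_space"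
  assumes X: "X \<in> S2 P t T" and t: "t \<le> T"
  shows "sqint (time_path t) (\<lambda>p. X (fst p) (snd p))"
proof -
  have "adapted_continuous P t T X" using X unfolding S2_def by simp
  then have m: "(\<lambda>p. X (fst p) (snd p)) \<in> borel_measurable (time_path t)"
    by (rule adapted_continuous_measurable[OF _ t])
  let ?S = "\<integral>\<^sup>+\<omega>. (SUP r\<in>{t..T}. ennreal ((norm (X r \<omega>))\<^sup>2)) \<partial>completion P"
  have "(\<integral>\<^sup>+p. ennreal ((norm (X (fst p) (snd p)))\<^sup>2) \<partial>time_path t)
    = (\<integral>\<^sup>+r. \<integral>\<^sup>+\<omega>. ennreal ((norm (X r \<omega>))\<^sup>2) \<partial>completion P \<partial>time_measure t)"
    by (subst C.nn_integral_fst[symmetric]) (use m in auto)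
  also have "\<dots> \<le> (\<integral>\<^sup>+r. ?S \<partial>time_measure t)"
    by (intro nn_integral_mono SUP_upper) auto
  also have "\<dots> = ?S * emeasure (time_measure t) (space (time_measure t))" by (rule nn_integral_const)
  also have "\<dots> < \<infinity>"
  proof -
    have "?S < top" using X unfolding S2_def by simp
    moreover have "emeasure (time_measure t) (space (time_measure t)) < top"
      by (simp add: less_top[symmetric])
    ultimately show ?thesis unfolding infinity_ennreal_def ennreal_mult_less_top by blast
  qed
  finally show ?thesis using sqint_iff_nn[OF m] by simp
qed

end

section \<open>Drifts and square-integrable martingales\<close>

context wiener_measure_space begin

lemma primitive_time_measure:
  assumes "s \<le> T"
  shows "(LBINT r:{t..s}. a r :: real) = (\<integral>r. indicator {..s} r * a r \<partial>time_measure t)"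
  unfolding integral_time_measure set_lebesgue_integral_def
  by (rule Bochner_Integration.integral_cong[OF refl]) (use assms in \<open>auto split: split_indicator\<close>)

lemma primitive_measurable:
  fixes a :: "real \<Rightarrow> real"
  assumes a: "integrable (time_measure t) a"
  shows "(\<lambda>s. \<integral>r. indicator {..s} r * a r \<partial>time_measure t) \<in> borel_measurable (time_measure t)"
proof -
  have am: "a \<in> borel_measurable (time_measure t)" using a by simp
  have m1: "(\<lambda>x. x) \<in> borel_measurable (time_measure t)"
    by (intro measurable_time_measure_borel measurable_ident_sets refl)
  have f: "(\<lambda>p. fst p) \<in> borel_measurable (time_measure t \<Otimes>\<^sub>M time_measure t)"
    "(\<lambda>p. snd p) \<in> borel_measurable (time_measure t \<Otimes>\<^sub>M time_measure t)"
    by (rule measurable_compose[OF measurable_fst m1], rule measurable_compose[OF measurable_snd m1])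
  have "(\<lambda>p. (if snd p \<le> fst p then a (snd p) else 0)) \<in> borel_measurable (time_measure t \<Otimes>\<^sub>M time_measure t)"
    by (intro measurable_If measurable_compose[OF measurable_snd am] borel_measurable_const borel_measurable_le f)
  then have "(\<lambda>s. \<integral>r. (if r \<le> s then a r else 0) \<partial>time_measure t) \<in> borel_measurable (time_measure t)"
    by (intro TM.borel_measurable_lebesgue_integral[of _ _ t]) (simp add: case_prod_unfold)
  moreover have "(if r \<le> s then a r else 0) = indicator {..s} r * a r" for r s by (simp split: split_indicator)
  ultimately show ?thesis by simp
qed

lemma primitive_bound:
  fixes a :: "real \<Rightarrow> real"
  assumes a: "integrable (time_measure t) a"
  shows "\<bar>\<integral>r. indicator {..s} r * a r \<partial>time_measure t\<bar> \<le> (\<integral>r. \<bar>a r\<bar> \<partial>time_measure t)"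
proof (rule order.trans[OF integral_abs_bound integral_mono'])
  show "integrable (time_measure t) (\<lambda>r. \<bar>a r\<bar>)" using a by simp
qed (auto split: split_indicator)

lemma primitive_mult_integrable:
  fixes a c :: "real \<Rightarrow> real"
  assumes a: "integrable (time_measure t) a" and c: "integrable (time_measure t) c"
  shows "integrable (time_measure t) (\<lambda>s. (\<integral>r. indicator {..s} r * a r \<partial>time_measure t) * c s)"
  using integrable_weight[OF c primitive_measurable[OF a], of "\<integral>r. \<bar>a r\<bar> \<partial>time_measure t"]
    primitive_bound[OF a] by simp

lemma integrable_product_real:
  fixes a c :: "real \<Rightarrow> real"
  assumes a: "integrable (time_measure t) a" and c: "integrable (time_measure t) (c :: real \<Rightarrow> real)"
  shows "integrable (time_measure t \<Otimes>\<^sub>M time_measure t) (\<lambda>p. a (fst p) * c (snd p))"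
proof -
  interpret TT: pair_sigma_finite "time_measure t" "time_measure t" ..
  show ?thesis by (rule TT.integral_product_mult(1)[OF a c])
qed

lemma AE_time_measure_neq: "AE r in time_measure t. r \<noteq> s"
proof -
  have "AE r in lborel. r \<noteq> s" using AE_lborel_singleton by fastforce
  then show ?thesis unfolding time_measure_def by (subst AE_restrict_space_iff) auto
qed

text \<open>
  This is the product rule for two absolutely continuous functions in integrated form. The square
  \<open>[t,T]\<^sup>2\<close> is cut along its diagonal, which is a null set.
\<close>

lemma integral_product_eq_primitives:
  fixes a c :: "real \<Rightarrow> real"
  assumes a: "integrable (time_measure t) a" and c: "integrable (time_measure t) c"
  shows "(\<integral>r. a r \<partial>time_measure t) * (\<integral>r. c r \<partial>time_measure t)
    = (\<integral>s. (\<integral>r. indicator {..s} r * a r \<partial>time_measure t) * c s \<partial>time_measure t)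
    + (\<integral>s. (\<integral>r. indicator {..s} r * c r \<partial>time_measure t) * a s \<partial>time_measure t)"
proof -
  let ?m = "time_measure t"
  interpret TT: pair_sigma_finite ?m ?m ..
  have ac: "integrable (?m \<Otimes>\<^sub>M ?m) (\<lambda>p. c (fst p) * a (snd p))" by (rule integrable_product_real[OF c a])
  have m1: "(\<lambda>x. x) \<in> borel_measurable ?m"
    by (intro measurable_time_measure_borel measurable_ident_sets refl)
  have "{p \<in> space (?m \<Otimes>\<^sub>M ?m). snd p \<le> fst p} \<in> sets (?m \<Otimes>\<^sub>M ?m)"
    by (intro borel_measurable_le measurable_compose[OF measurable_fst m1] measurable_compose[OF measurable_snd m1])
  then have S: "{p \<in> space (?m \<Otimes>\<^sub>M ?m). snd p \<le> fst p} \<in> sets (?m \<Otimes>\<^sub>M ?m)" .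
  define low where "low p = (if snd p \<le> fst p then c (fst p) * a (snd p) else 0)" for p
  define up where "up p = (if snd p \<le> fst p then 0 else c (fst p) * a (snd p))" for p
  have lowi: "integrable (?m \<Otimes>\<^sub>M ?m) low"
    unfolding low_def
    by (rule Bochner_Integration.integrable_bound[OF ac]) (use S ac in \<open>auto intro!: measurable_If\<close>)
  have upi: "integrable (?m \<Otimes>\<^sub>M ?m) up"
    unfolding up_def
    by (rule Bochner_Integration.integrable_bound[OF ac]) (use S ac in \<open>auto intro!: measurable_If\<close>)
  have "(\<integral>r. a r \<partial>?m) * (\<integral>r. c r \<partial>?m) = (\<integral>p. c (fst p) * a (snd p) \<partial>(?m \<Otimes>\<^sub>M ?m))"
    using TT.integral_product_mult(2)[OF c a] by (simp add: mult.commute)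
  also have "\<dots> = (\<integral>p. low p + up p \<partial>(?m \<Otimes>\<^sub>M ?m))"
    by (rule Bochner_Integration.integral_cong[OF refl]) (simp add: low_def up_def)
  also have "\<dots> = (\<integral>p. low p \<partial>(?m \<Otimes>\<^sub>M ?m)) + (\<integral>p. up p \<partial>(?m \<Otimes>\<^sub>M ?m))"
    by (rule Bochner_Integration.integral_add[OF lowi upi])
  also have "(\<integral>p. low p \<partial>(?m \<Otimes>\<^sub>M ?m)) = (\<integral>s. \<integral>r. low (s, r) \<partial>?m \<partial>?m)"
    by (rule TT.integral_fst'[OF lowi, symmetric])
  also have "\<dots> = (\<integral>s. (\<integral>r. indicator {..s} r * a r \<partial>?m) * c s \<partial>?m)"
  proof (rule Bochner_Integration.integral_cong[OF refl])
    fix s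
    have "(\<integral>r. low (s, r) \<partial>?m) = (\<integral>r. (indicator {..s} r * a r) * c s \<partial>?m)"
      by (rule Bochner_Integration.integral_cong[OF refl]) (simp add: low_def split: split_indicator)
    then show "(\<integral>r. low (s, r) \<partial>?m) = (\<integral>r. indicator {..s} r * a r \<partial>?m) * c s" by simp
  qed
  also have "(\<integral>p. up p \<partial>(?m \<Otimes>\<^sub>M ?m)) = (\<integral>r. \<integral>s. up (s, r) \<partial>?m \<partial>?m)"
    using TT.integral_snd[of "\<lambda>s r. up (s, r)"] upi by simp
  also have "\<dots> = (\<integral>s. (\<integral>r. indicator {..s} r * c r \<partial>?m) * a s \<partial>?m)"
  proof (rule Bochner_Integration.integral_cong[OF refl])
    fix r
    have um: "(\<lambda>s. up (s, r)) \<in> borel_measurable ?m" if "r \<in> space ?m"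
      using measurable_compose[OF measurable_Pair2'[OF that] borel_measurable_integrable[OF upi]] .
    assume r: "r \<in> space ?m"
    have "(\<integral>s. up (s, r) \<partial>?m) = (\<integral>s. (indicator {..r} s * c s) * a r \<partial>?m)"
    proof (rule integral_cong_AE[OF um[OF r]])
      show "(\<lambda>s. indicator {..r} s * c s * a r) \<in> borel_measurable ?m"
        by (intro borel_measurable_times borel_measurable_const borel_measurable_integrable[OF c]
          measurable_time_measure_borel borel_measurable_indicator) simp
      show "AE s in ?m. up (s, r) = indicator {..r} s * c s * a r"
        using AE_time_measure_neq[of r t] by eventually_elim (auto simp: up_def split: split_indicator)
    qed
    then show "(\<integral>s. up (s, r) \<partial>?m) = (\<integral>s. indicator {..r} s * c s \<partial>?m) * a r" by simp
  qed
  finally show ?thesis .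
qed

text \<open>
  Each mixed product of drift and martingale is written with an increment \<open>m T - m s\<close> up to the
  horizon, the form that vanishes in expectation.
\<close>

lemma pathwise_product:
  fixes x y m n a c :: "real \<Rightarrow> real"
  assumes t: "t \<le> T"
    and a: "integrable (time_measure t) a" and c: "integrable (time_measure t) c"
    and cm: "integrable (time_measure t) (\<lambda>s. c s * m s)" and an: "integrable (time_measure t) (\<lambda>s. a s * n s)"
    and x: "\<And>s. s \<in> {t..T} \<Longrightarrow> x s = x t + (LBINT r:{t..s}. a r) + m s"
    and y: "\<And>s. s \<in> {t..T} \<Longrightarrow> y s = y t + (LBINT r:{t..s}. c r) + n s"
  shows "x T * y T - x t * y t = x t * n T + y t * m T + m T * n T
    + (\<integral>s. c s * (m T - m s) \<partial>time_measure t) + (\<integral>s. a s * (n T - n s) \<partial>time_measure t)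
    + (\<integral>s. x s * c s + y s * a s \<partial>time_measure t)"
proof -
  let ?m = "time_measure t"
  define A where "A s = (\<integral>r. indicator {..s} r * a r \<partial>?m)" for s
  define C where "C s = (\<integral>r. indicator {..s} r * c r \<partial>?m)" for s
  have x': "x s = x t + A s + m s" if "s \<in> {t..T}" for s
    using x[OF that] that primitive_time_measure[of s t a] unfolding A_def by simp
  have y': "y s = y t + C s + n s" if "s \<in> {t..T}" for s
    using y[OF that] that primitive_time_measure[of s t c] unfolding C_def by simp
  have AT: "A T = (\<integral>r. a r \<partial>?m)"
    unfolding A_def by (rule Bochner_Integration.integral_cong[OF refl]) simp
  have CT: "C T = (\<integral>r. c r \<partial>?m)"
    unfolding C_def by (rule Bochner_Integration.integral_cong[OF refl]) simp
  have Ac: "integrable ?m (\<lambda>s. A s * c s)" unfolding A_def by (rule primitive_mult_integrable[OF a c])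
  have Ca: "integrable ?m (\<lambda>s. C s * a s)" unfolding C_def by (rule primitive_mult_integrable[OF c a])
  have "(\<integral>s. x s * c s + y s * a s \<partial>?m)
    = (\<integral>s. (x t * c s + A s * c s + c s * m s) + (y t * a s + C s * a s + a s * n s) \<partial>?m)"
  proof (rule Bochner_Integration.integral_cong[OF refl])
    fix s assume "s \<in> space ?m"
    then have s: "s \<in> {t..T}" by simp
    show "x s * c s + y s * a s
      = (x t * c s + A s * c s + c s * m s) + (y t * a s + C s * a s + a s * n s)"
      unfolding x'[OF s] y'[OF s] by (simp add: algebra_simps)
  qed
  also have "\<dots> = x t * C T + (\<integral>s. A s * c s \<partial>?m) + (\<integral>s. c s * m s \<partial>?m)
    + (y t * A T + (\<integral>s. C s * a s \<partial>?m) + (\<integral>s. a s * n s \<partial>?m))"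
    using a c cm an Ac Ca by (simp add: AT CT)
  finally have 1: "(\<integral>s. x s * c s + y s * a s \<partial>?m) = \<dots>" .
  have 2: "(\<integral>s. c s * (m T - m s) \<partial>?m) = C T * m T - (\<integral>s. c s * m s \<partial>?m)"
    using c cm by (simp add: right_diff_distrib CT)
  have 3: "(\<integral>s. a s * (n T - n s) \<partial>?m) = A T * n T - (\<integral>s. a s * n s \<partial>?m)"
    using a an by (simp add: right_diff_distrib AT)
  have 4: "A T * C T = (\<integral>s. A s * c s \<partial>?m) + (\<integral>s. C s * a s \<partial>?m)"
    using integral_product_eq_primitives[OF a c] unfolding AT CT unfolding A_def C_def .
  have 5: "x T = x t + A T + m T" "y T = y t + C T + n T" using x'[of T] y'[of T] t by simp_all
  show ?thesis unfolding 1 2 3 using 4 unfolding 5 by (simp add: algebra_simps)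
qed

text \<open>
  This says that \<open>M r\<close> is the conditional expectation of \<open>M T\<close>, by testing against the
  square-integrable variables known at time \<open>r\<close>. In this form it passes to linear combinations.
\<close>

definition L2_martingale :: "real \<Rightarrow> (real \<Rightarrow> 'd path \<Rightarrow> real) \<Rightarrow> bool" where
  "L2_martingale t M \<longleftrightarrow>
     (\<forall>r\<in>{t..T}. M r \<in> borel_measurable (wiener_filtration P r) \<and> sqint (completion P) (M r)) \<and>
     (\<lambda>p. M (fst p) (snd p)) \<in> borel_measurable (time_path t) \<and>
     (\<forall>r\<in>{t..T}. \<forall>\<zeta>. \<zeta> \<in> borel_measurable (wiener_filtration P r) \<longrightarrow> sqint (completion P) \<zeta> \<longrightarrow>
        C.expectation (\<lambda>\<omega>. \<zeta> \<omega> * (M T \<omega> - M r \<omega>)) = 0)"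

lemma L2_martingaleD:
  assumes "L2_martingale t M" "t \<le> r" "r \<le> T"
  shows "M r \<in> borel_measurable (wiener_filtration P r)" "sqint (completion P) (M r)"
    "\<zeta> \<in> borel_measurable (wiener_filtration P r) \<Longrightarrow> sqint (completion P) \<zeta> \<Longrightarrow>
      C.expectation (\<lambda>\<omega>. \<zeta> \<omega> * (M T \<omega> - M r \<omega>)) = 0"
  using assms unfolding L2_martingale_def by simp_all

lemma ito_L2_martingale:
  assumes I: "has_ito_integral P t T H I" and t: "0 \<le> t" "t \<le> T"
  shows "L2_martingale t I"
  unfolding L2_martingale_def
proof (intro conjI ballI allI impI)
  have "adapted_continuous P t T I" using I unfolding has_ito_integral_def by simp
  then show "(\<lambda>p. I (fst p) (snd p)) \<in> borel_measurable (time_path t)"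
    by (rule adapted_continuous_measurable[OF _ t(2)])
next
  fix r assume r: "r \<in> {t..T}"
  show "I r \<in> borel_measurable (wiener_filtration P r)" using has_ito_integral_adapted[OF I] r by simp
  show "sqint (completion P) (I r)" using sqint_ito_integral[OF I t(1)] r by simp
  fix \<zeta> :: "'d path \<Rightarrow> real" assume "\<zeta> \<in> borel_measurable (wiener_filtration P r)" "sqint (completion P) \<zeta>"
  then show "C.expectation (\<lambda>\<omega>. \<zeta> \<omega> * (I T \<omega> - I r \<omega>)) = 0"
    using ito_martingale[OF I t(1)] r by simp
qed

lemma L2_martingale_scale_add:
  assumes M: "L2_martingale t M" and N: "L2_martingale t N"
  shows "L2_martingale t (\<lambda>r \<omega>. M r \<omega> + g * N r \<omega>)"
  unfolding L2_martingale_def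
proof (intro conjI ballI allI impI)
  show "(\<lambda>p. M (fst p) (snd p) + g * N (fst p) (snd p)) \<in> borel_measurable (time_path t)"
    using M N unfolding L2_martingale_def by (intro borel_measurable_add borel_measurable_times borel_measurable_const) simp_all
next
  fix r assume r: "r \<in> {t..T}"
  then have r': "t \<le> r" "r \<le> T" "t \<le> T" by auto
  note M' = L2_martingaleD[OF M r'(1,2)] and N' = L2_martingaleD[OF N r'(1,2)]
  show "(\<lambda>\<omega>. M r \<omega> + g * N r \<omega>) \<in> borel_measurable (wiener_filtration P r)"
    by (intro borel_measurable_add borel_measurable_times borel_measurable_const M'(1) N'(1))
  show "sqint (completion P) (\<lambda>\<omega>. M r \<omega> + g * N r \<omega>)"
    by (intro sqint_add sqint_cmult M'(2) N'(2))
  fix \<zeta> :: "'d path \<Rightarrow> real" assume z: "\<zeta> \<in> borel_measurable (wiener_filtration P r)" "sqint (completion P) \<zeta>"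
  have int: "integrable (completion P) (\<lambda>\<omega>. \<zeta> \<omega> * (M T \<omega> - M r \<omega>))" "integrable (completion P) (\<lambda>\<omega>. \<zeta> \<omega> * (N T \<omega> - N r \<omega>))"
    using r' by (auto intro!: sqint_integrable_mult z sqint_diff L2_martingaleD(2)[OF M] L2_martingaleD(2)[OF N])
  have "C.expectation (\<lambda>\<omega>. \<zeta> \<omega> * ((M T \<omega> + g * N T \<omega>) - (M r \<omega> + g * N r \<omega>)))
    = C.expectation (\<lambda>\<omega>. \<zeta> \<omega> * (M T \<omega> - M r \<omega>) + g * (\<zeta> \<omega> * (N T \<omega> - N r \<omega>)))"
    by (rule Bochner_Integration.integral_cong[OF refl]) (simp add: algebra_simps)
  also have "\<dots> = 0" using int M'(3)[OF z] N'(3)[OF z] by simp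
  finally show "C.expectation (\<lambda>\<omega>. \<zeta> \<omega> * ((M T \<omega> + g * N T \<omega>) - (M r \<omega> + g * N r \<omega>))) = 0" .
qed

lemma L2_martingale_zero: "L2_martingale t (\<lambda>r \<omega>. 0)"
  unfolding L2_martingale_def by simp

lemma L2_martingale_sum:
  assumes "finite I" "\<And>i. i \<in> I \<Longrightarrow> L2_martingale t (M i)"
  shows "L2_martingale t (\<lambda>r \<omega>. \<Sum>i\<in>I. g i * M i r \<omega>)"
  using assms
proof (induction I rule: finite_induct)
  case (insert i I)
  then have "L2_martingale t (\<lambda>r \<omega>. (\<Sum>i\<in>I. g i * M i r \<omega>) + g i * M i r \<omega>)"
    by (intro L2_martingale_scale_add) auto
  then show ?case using insert by (simp add: add.commute)
qed (simp add: L2_martingale_zero)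

text \<open>
  \<open>M r\<close> is orthogonal to \<open>M T - M r\<close>. The bound is uniform in \<open>r\<close>, which makes a martingale
  square-integrable over time and path together.
\<close>

lemma L2_martingale_second_moment_le:
  assumes M: "L2_martingale t M" and r: "t \<le> r" "r \<le> T"
  shows "C.expectation (\<lambda>\<omega>. (M r \<omega>)\<^sup>2) \<le> C.expectation (\<lambda>\<omega>. (M T \<omega>)\<^sup>2)"
proof -
  have tT: "t \<le> T" using r by simp
  note Mr = L2_martingaleD[OF M r] and MT = L2_martingaleD(2)[OF M tT order.refl]
  have D: "sqint (completion P) (\<lambda>\<omega>. M T \<omega> - M r \<omega>)" by (rule sqint_diff[OF MT Mr(2)])
  have int: "integrable (completion P) (\<lambda>\<omega>. (M r \<omega>)\<^sup>2)" "integrable (completion P) (\<lambda>\<omega>. M r \<omega> * (M T \<omega> - M r \<omega>))"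
    "integrable (completion P) (\<lambda>\<omega>. (M T \<omega> - M r \<omega>)\<^sup>2)"
    using sqint_integrable_norm_sq[OF Mr(2)] sqint_integrable_norm_sq[OF D] sqint_integrable_mult[OF Mr(2) D] by simp_all
  have "C.expectation (\<lambda>\<omega>. (M T \<omega>)\<^sup>2)
    = C.expectation (\<lambda>\<omega>. (M r \<omega>)\<^sup>2 + 2 * (M r \<omega> * (M T \<omega> - M r \<omega>)) + (M T \<omega> - M r \<omega>)\<^sup>2)"
    by (rule Bochner_Integration.integral_cong[OF refl]) (simp add: power2_eq_square algebra_simps)
  also have "\<dots> = C.expectation (\<lambda>\<omega>. (M r \<omega>)\<^sup>2) + 0 + C.expectation (\<lambda>\<omega>. (M T \<omega> - M r \<omega>)\<^sup>2)"
    using int Mr(3)[OF Mr(1,2)] by simp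
  finally show ?thesis by simp
qed

lemma L2_martingale_sqint_time_path:
  assumes M: "L2_martingale t M" and t: "t \<le> T"
  shows "sqint (time_path t) (\<lambda>p. M (fst p) (snd p))"
proof -
  have m: "(\<lambda>p. M (fst p) (snd p)) \<in> borel_measurable (time_path t)" using M unfolding L2_martingale_def by simp
  have "integrable (time_path t) (\<lambda>p. (M (fst p) (snd p))\<^sup>2)"
  proof (rule TP.Fubini_integrable)
    show mm: "(\<lambda>p. (M (fst p) (snd p))\<^sup>2) \<in> borel_measurable (time_path t)" using m by simp
    have i: "integrable (completion P) (\<lambda>\<omega>. (M r \<omega>)\<^sup>2)" if "r \<in> {t..T}" for r
      using sqint_integrable_norm_sq[OF L2_martingaleD(2)[OF M]] that by simp
    show "AE r in time_measure t. integrable (completion P) (\<lambda>\<omega>. (M (fst (r, \<omega>)) (snd (r, \<omega>)))\<^sup>2)"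
      using i by (intro AE_I2) simp
    show "integrable (time_measure t) (\<lambda>r. \<integral>\<omega>. norm ((M (fst (r, \<omega>)) (snd (r, \<omega>)))\<^sup>2) \<partial>completion P)"
    proof (rule TM.integrable_const_bound[where B="C.expectation (\<lambda>\<omega>. (M T \<omega>)\<^sup>2)"])
      show "AE r in time_measure t. norm (\<integral>\<omega>. norm ((M (fst (r, \<omega>)) (snd (r, \<omega>)))\<^sup>2) \<partial>completion P)
        \<le> C.expectation (\<lambda>\<omega>. (M T \<omega>)\<^sup>2)"
        using L2_martingale_second_moment_le[OF M] by (intro AE_I2) simp
      show "(\<lambda>r. \<integral>\<omega>. norm ((M (fst (r, \<omega>)) (snd (r, \<omega>)))\<^sup>2) \<partial>completion P) \<in> borel_measurable (time_measure t)"
        by (rule C.borel_measurable_lebesgue_integral) (use mm in \<open>simp add: case_prod_unfold\<close>)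
    qed
  qed
  then show ?thesis using m unfolding sqint_def by simp
qed

text \<open>
  By Fubini it is enough to look at a fixed time \<open>s\<close>, where \<open>1\<^sub>A c\<^sub>s\<close> is known. It is square-integrable
  only for almost every \<open>s\<close>.
\<close>

lemma martingale_drift_orthogonal:
  assumes M: "L2_martingale t M" and t: "t \<le> T" and A: "A \<in> sets (wiener_filtration P t)"
    and c: "sqint (time_path t) (\<lambda>p. c (fst p) (snd p))"
    and ca: "\<And>s. s \<in> {t..T} \<Longrightarrow> c s \<in> borel_measurable (wiener_filtration P s)"
  shows "(\<integral>p. indicator A (snd p) * (c (fst p) (snd p) * (M T (snd p) - M (fst p) (snd p))) \<partial>time_path t) = (0::real)"
    and "integrable (time_path t) (\<lambda>p. c (fst p) (snd p) * (M T (snd p) - M (fst p) (snd p)))"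
proof -
  have Am: "(indicator A :: _ \<Rightarrow> real) \<in> borel_measurable (completion P)"
    using subsetD[OF filtration_subset_completion[OF t] A] by simp
  have MT: "sqint (completion P) (M T)" by (rule L2_martingaleD(2)[OF M t order.refl])
  have MTQ: "sqint (time_path t) (\<lambda>p. M T (snd p))"
    unfolding sqint_def
  proof
    show "(\<lambda>p. M T (snd p)) \<in> borel_measurable (time_path t)"
      by (rule measurable_compose[OF measurable_snd sqint_measurable[OF MT]])
    have "integrable (time_measure t) (\<lambda>_. 1 :: real)" by simp
    from TP.integral_product_mult(1)[OF this sqint_integrable_norm_sq[OF MT]]
    show "integrable (time_path t) (\<lambda>p. (norm (M T (snd p)))\<^sup>2)" by simp
  qed
  show int: "integrable (time_path t) (\<lambda>p. c (fst p) (snd p) * (M T (snd p) - M (fst p) (snd p)))"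
    by (intro sqint_integrable_mult c sqint_diff MTQ L2_martingale_sqint_time_path[OF M t])
  have int': "integrable (time_path t) (\<lambda>p. indicator A (snd p) * (c (fst p) (snd p) * (M T (snd p) - M (fst p) (snd p))))"
    using integrable_weight[OF int measurable_compose[OF measurable_snd Am], of 1] by (simp split: split_indicator)
  have "(\<integral>p. indicator A (snd p) * (c (fst p) (snd p) * (M T (snd p) - M (fst p) (snd p))) \<partial>time_path t)
    = (\<integral>s. C.expectation (\<lambda>\<omega>. indicator A \<omega> * (c s \<omega> * (M T \<omega> - M s \<omega>))) \<partial>time_measure t)"
    using TP.integral_fst'[OF int'] by simp
  also have "\<dots> = (\<integral>s. 0 \<partial>time_measure t)"
  proof (rule integral_cong_AE)
    show "(\<lambda>s. C.expectation (\<lambda>\<omega>. indicator A \<omega> * (c s \<omega> * (M T \<omega> - M s \<omega>)))) \<in> borel_measurable (time_measure t)"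
      using borel_measurable_integrable[OF TP.integrable_fst'[OF int']] by simp
    have "AE s in time_measure t. integrable (completion P) (\<lambda>\<omega>. (c s \<omega>)\<^sup>2)"
      using TP.AE_integrable_fst'[OF sqint_integrable_norm_sq[OF c]] by simp
    then show "AE s in time_measure t. C.expectation (\<lambda>\<omega>. indicator A \<omega> * (c s \<omega> * (M T \<omega> - M s \<omega>))) = 0"
      using AE_space
    proof eventually_elim
      case (elim s)
      then have s: "s \<in> {t..T}" by simp
      have cs: "c s \<in> borel_measurable (wiener_filtration P s)" by (rule ca[OF s])
      have As: "A \<in> sets (wiener_filtration P s)" using A filtration_mono[of t s] s by auto
      have csq: "sqint (completion P) (c s)"
        using measurable_filtration_completion[OF cs] elim(1) s unfolding sqint_def by simp
      have "C.expectation (\<lambda>\<omega>. (indicator A \<omega> * c s \<omega>) * (M T \<omega> - M s \<omega>)) = 0"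
      proof (rule L2_martingaleD(3)[OF M])
        show "(\<lambda>\<omega>. indicator A \<omega> * c s \<omega>) \<in> borel_measurable (wiener_filtration P s)"
          by (intro borel_measurable_times cs indicator_event_measurable As)
        show "sqint (completion P) (\<lambda>\<omega>. indicator A \<omega> * c s \<omega>)"
          using sqint_weight[OF csq Am, of 1] by (simp split: split_indicator)
      qed (use s in auto)
      then show ?case by (simp add: mult.assoc)
    qed
  qed simp
  finally show "(\<integral>p. indicator A (snd p) * (c (fst p) (snd p) * (M T (snd p) - M (fst p) (snd p))) \<partial>time_path t) = (0::real)"
    by simp
qed

end

section \<open>The product formula in expectation\<close>

context wiener_measure_space begin

lemma expectation_time_integral:
  assumes A: "A \<in> sets (wiener_filtration P t)" and t: "t \<le> T"
    and g: "integrable (time_path t) (g :: _ \<Rightarrow> real)"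
  shows "integrable (completion P) (\<lambda>\<omega>. indicator A \<omega> * (\<integral>s. g (s, \<omega>) \<partial>time_measure t))"
    and "C.expectation (\<lambda>\<omega>. indicator A \<omega> * (\<integral>s. g (s, \<omega>) \<partial>time_measure t))
      = (\<integral>p. indicator A (snd p) * g p \<partial>time_path t)"
proof -
  have Am: "(indicator A :: _ \<Rightarrow> real) \<in> borel_measurable (completion P)"
    using subsetD[OF filtration_subset_completion[OF t] A] by simp
  have int: "integrable (time_path t) (\<lambda>p. indicator A (snd p) * g p)"
    using integrable_weight[OF g measurable_compose[OF measurable_snd Am], of 1] by (simp split: split_indicator)
  then have int': "integrable (time_path t) (case_prod (\<lambda>s \<omega>. indicator A \<omega> * g (s, \<omega>)))"
    by (simp add: case_prod_unfold)
  have eq: "(\<integral>s. indicator A \<omega> * g (s, \<omega>) \<partial>time_measure t) = indicator A \<omega> * (\<integral>s. g (s, \<omega>) \<partial>time_measure t)" for \<omega>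
    by simp
  show "integrable (completion P) (\<lambda>\<omega>. indicator A \<omega> * (\<integral>s. g (s, \<omega>) \<partial>time_measure t))"
    using TP.integrable_snd[OF int'] unfolding eq .
  show "C.expectation (\<lambda>\<omega>. indicator A \<omega> * (\<integral>s. g (s, \<omega>) \<partial>time_measure t))
      = (\<integral>p. indicator A (snd p) * g p \<partial>time_path t)"
    using TP.integral_snd[OF int'] unfolding eq by (simp add: case_prod_unfold)
qed

lemma AE_integrable_time_section:
  assumes g: "integrable (time_path t) (g :: _ \<Rightarrow> 'b::{banach, second_countable_topology})"
  shows "AE \<omega> in completion P. integrable (time_measure t) (\<lambda>s. g (s, \<omega>))"
  using TP.AE_integrable_snd[of t "\<lambda>s \<omega>. g (s, \<omega>)"] g by simp

text \<open>
  Taking expectations over \<open>A\<close> in \<open>pathwise_product\<close> removes every term that contains a martingale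
  increment except \<open>m T n T\<close>, whose expectation is given by \<open>h\<close>.
\<close>

lemma expected_product_formula:
  fixes x y a c m n :: "real \<Rightarrow> 'd path \<Rightarrow> real"
  assumes t: "0 \<le> t" "t \<le> T" and A: "A \<in> sets (wiener_filtration P t)"
    and x: "sqint (time_path t) (\<lambda>p. x (fst p) (snd p))" "sqint (completion P) (x t)" "sqint (completion P) (x T)"
      "x t \<in> borel_measurable (wiener_filtration P t)"
    and y: "sqint (time_path t) (\<lambda>p. y (fst p) (snd p))" "sqint (completion P) (y t)" "sqint (completion P) (y T)"
      "y t \<in> borel_measurable (wiener_filtration P t)"
    and a: "sqint (time_path t) (\<lambda>p. a (fst p) (snd p))" "\<And>s. s \<in> {t..T} \<Longrightarrow> a s \<in> borel_measurable (wiener_filtration P s)"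
    and c: "sqint (time_path t) (\<lambda>p. c (fst p) (snd p))" "\<And>s. s \<in> {t..T} \<Longrightarrow> c s \<in> borel_measurable (wiener_filtration P s)"
    and m: "L2_martingale t m" and n: "L2_martingale t n"
    and h: "integrable (time_path t) h"
      "C.expectation (\<lambda>\<omega>. indicator A \<omega> * (m T \<omega> * n T \<omega>)) = (\<integral>p. indicator A (snd p) * h p \<partial>time_path t)"
    and eq: "AE \<omega> in completion P. \<forall>s\<in>{t..T}.
      x s \<omega> = x t \<omega> + (LBINT r:{t..s}. a r \<omega>) + m s \<omega> \<and> y s \<omega> = y t \<omega> + (LBINT r:{t..s}. c r \<omega>) + n s \<omega>"
  shows "C.expectation (\<lambda>\<omega>. indicator A \<omega> * (x T \<omega> * y T \<omega> - x t \<omega> * y t \<omega>))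
    = (\<integral>p. indicator A (snd p) * (x (fst p) (snd p) * c (fst p) (snd p) + y (fst p) (snd p) * a (fst p) (snd p) + h p) \<partial>time_path t)"
proof -
  let ?w = "indicator A :: 'd path \<Rightarrow> real"
  let ?Q = "\<lambda>g. \<integral>p. ?w (snd p) * g p \<partial>time_path t"
  have Am: "?w \<in> borel_measurable (completion P)"
    using subsetD[OF filtration_subset_completion[OF t(2)] A] by simp
  have wint: "integrable (completion P) (\<lambda>\<omega>. ?w \<omega> * g \<omega>)" if "integrable (completion P) g" for g
    using integrable_weight[OF that Am, of 1] by (simp split: split_indicator)
  have wintQ: "integrable (time_path t) (\<lambda>p. ?w (snd p) * g p)" if "integrable (time_path t) g" for g
    using integrable_weight[OF that measurable_compose[OF measurable_snd Am], of 1] by (simp split: split_indicator)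
  have mT: "sqint (completion P) (m T)" and nT: "sqint (completion P) (n T)"
    and mt: "sqint (completion P) (m t)" and nt: "sqint (completion P) (n t)"
    using L2_martingaleD(2)[OF m] L2_martingaleD(2)[OF n] t by auto
  define gc where "gc p = c (fst p) (snd p) * (m T (snd p) - m (fst p) (snd p))" for p
  define ga where "ga p = a (fst p) (snd p) * (n T (snd p) - n (fst p) (snd p))" for p
  define gd where "gd p = x (fst p) (snd p) * c (fst p) (snd p) + y (fst p) (snd p) * a (fst p) (snd p)" for p
  have gci: "integrable (time_path t) gc" unfolding gc_def by (rule martingale_drift_orthogonal(2)[OF m t(2) A c])
  have gai: "integrable (time_path t) ga" unfolding ga_def by (rule martingale_drift_orthogonal(2)[OF n t(2) A a])
  have gc0: "?Q gc = 0" unfolding gc_def by (rule martingale_drift_orthogonal(1)[OF m t(2) A c])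
  have ga0: "?Q ga = 0" unfolding ga_def by (rule martingale_drift_orthogonal(1)[OF n t(2) A a])
  have gdi: "integrable (time_path t) gd"
    unfolding gd_def by (intro Bochner_Integration.integrable_add sqint_integrable_mult x y a c)
  have cm: "integrable (time_path t) (\<lambda>p. c (fst p) (snd p) * m (fst p) (snd p))"
    by (intro sqint_integrable_mult c L2_martingale_sqint_time_path[OF m t(2)])
  have an: "integrable (time_path t) (\<lambda>p. a (fst p) (snd p) * n (fst p) (snd p))"
    by (intro sqint_integrable_mult a L2_martingale_sqint_time_path[OF n t(2)])
  have path: "AE \<omega> in completion P. x T \<omega> * y T \<omega> - x t \<omega> * y t \<omega>
    = x t \<omega> * (n T \<omega> - n t \<omega>) + y t \<omega> * (m T \<omega> - m t \<omega>) + m T \<omega> * n T \<omega>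
    + (\<integral>s. gc (s, \<omega>) \<partial>time_measure t) + (\<integral>s. ga (s, \<omega>) \<partial>time_measure t) + (\<integral>s. gd (s, \<omega>) \<partial>time_measure t)"
    using eq AE_integrable_time_section[OF cm] AE_integrable_time_section[OF an]
      AE_integrable_time_section[OF Q.sqint_integrable[OF a(1)]] AE_integrable_time_section[OF Q.sqint_integrable[OF c(1)]]
  proof eventually_elim
    case (elim \<omega>)
    have e: "x s \<omega> = x t \<omega> + (LBINT r:{t..s}. a r \<omega>) + m s \<omega>"
      "y s \<omega> = y t \<omega> + (LBINT r:{t..s}. c r \<omega>) + n s \<omega>" if "s \<in> {t..T}" for s using elim(1) that by blast+
    have z: "(LBINT r:{t..t}. q r) = 0" for q :: "real \<Rightarrow> real"
      unfolding set_lebesgue_integral_def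
      by (rule integral_eq_zero_AE, rule eventually_mono[OF AE_lborel_singleton[of t]]) (simp split: split_indicator)
    have 0: "m t \<omega> = 0" "n t \<omega> = 0" using e[of t] z t by auto
    have int: "integrable (time_measure t) (\<lambda>s. c s \<omega> * m s \<omega>)" "integrable (time_measure t) (\<lambda>s. a s \<omega> * n s \<omega>)"
      "integrable (time_measure t) (\<lambda>s. a s \<omega>)" "integrable (time_measure t) (\<lambda>s. c s \<omega>)"
      using elim(2-5) by simp_all
    show ?case
      using pathwise_product[where x="\<lambda>s. x s \<omega>" and y="\<lambda>s. y s \<omega>", OF t(2) int(3,4,1,2) e] 0
      by (simp add: gc_def ga_def gd_def)
  qed
  have xn: "integrable (completion P) (\<lambda>\<omega>. x t \<omega> * (n T \<omega> - n t \<omega>))" by (intro sqint_integrable_mult x sqint_diff nT nt)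
  have ym: "integrable (completion P) (\<lambda>\<omega>. y t \<omega> * (m T \<omega> - m t \<omega>))" by (intro sqint_integrable_mult y sqint_diff mT mt)
  have mn: "integrable (completion P) (\<lambda>\<omega>. m T \<omega> * n T \<omega>)" by (intro sqint_integrable_mult mT nT)
  have orth: "C.expectation (\<lambda>\<omega>. ?w \<omega> * (\<zeta> \<omega> * (M T \<omega> - M t \<omega>))) = 0"
    if M: "L2_martingale t M" and z: "\<zeta> \<in> borel_measurable (wiener_filtration P t)" "sqint (completion P) \<zeta>" for M \<zeta>
  proof -
    have "C.expectation (\<lambda>\<omega>. (?w \<omega> * \<zeta> \<omega>) * (M T \<omega> - M t \<omega>)) = 0"
    proof (rule L2_martingaleD(3)[OF M order.refl t(2)])
      show "(\<lambda>\<omega>. ?w \<omega> * \<zeta> \<omega>) \<in> borel_measurable (wiener_filtration P t)"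
        by (intro borel_measurable_times z indicator_event_measurable A)
      show "sqint (completion P) (\<lambda>\<omega>. ?w \<omega> * \<zeta> \<omega>)"
        using sqint_weight[OF z(2) Am, of 1] by (simp split: split_indicator)
    qed
    then show ?thesis by (simp add: mult.assoc)
  qed
  have "C.expectation (\<lambda>\<omega>. ?w \<omega> * (x T \<omega> * y T \<omega> - x t \<omega> * y t \<omega>))
    = C.expectation (\<lambda>\<omega>. ?w \<omega> * (x t \<omega> * (n T \<omega> - n t \<omega>)) + ?w \<omega> * (y t \<omega> * (m T \<omega> - m t \<omega>)) + ?w \<omega> * (m T \<omega> * n T \<omega>)
      + ?w \<omega> * (\<integral>s. gc (s, \<omega>) \<partial>time_measure t) + ?w \<omega> * (\<integral>s. ga (s, \<omega>) \<partial>time_measure t) + ?w \<omega> * (\<integral>s. gd (s, \<omega>) \<partial>time_measure t))"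
    (is "_ = C.expectation ?R")
  proof (rule integral_cong_AE)
    have "integrable (completion P) (\<lambda>\<omega>. x T \<omega> * y T \<omega> - x t \<omega> * y t \<omega>)"
      by (intro Bochner_Integration.integrable_diff sqint_integrable_mult x y)
    from borel_measurable_integrable[OF wint[OF this]]
    show "(\<lambda>\<omega>. ?w \<omega> * (x T \<omega> * y T \<omega> - x t \<omega> * y t \<omega>)) \<in> borel_measurable (completion P)" .
    show "?R \<in> borel_measurable (completion P)"
      by (intro borel_measurable_integrable Bochner_Integration.integrable_add wint xn ym mn
        expectation_time_integral(1)[OF A t(2)] gci gai gdi)
    show "AE \<omega> in completion P. ?w \<omega> * (x T \<omega> * y T \<omega> - x t \<omega> * y t \<omega>) = ?R \<omega>"
      using path by eventually_elim (simp only: distrib_left)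
  qed
  also have "\<dots> = C.expectation (\<lambda>\<omega>. ?w \<omega> * (x t \<omega> * (n T \<omega> - n t \<omega>))) + C.expectation (\<lambda>\<omega>. ?w \<omega> * (y t \<omega> * (m T \<omega> - m t \<omega>)))
      + C.expectation (\<lambda>\<omega>. ?w \<omega> * (m T \<omega> * n T \<omega>)) + ?Q gc + ?Q ga + ?Q gd"
    using wint[OF xn] wint[OF ym] wint[OF mn] expectation_time_integral[OF A t(2) gci]
      expectation_time_integral[OF A t(2) gai] expectation_time_integral[OF A t(2) gdi] by simp
  also have "\<dots> = ?Q h + ?Q gd"
    unfolding gc0 ga0 h(2) orth[OF n x(4,2)] orth[OF m y(4,2)] by simp
  also have "\<dots> = ?Q (\<lambda>p. gd p + h p)"
    using wintQ[OF h(1)] wintQ[OF gdi] by (simp add: distrib_left)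
  finally show ?thesis unfolding gd_def .
qed

text \<open>
  The conclusion of the isometry, detached from Ito integrals so that it can be extended to linear
  combinations. Sums of Ito integrals are not treated as Ito integrals, because the approximating
  simple integrands live on different partitions.
\<close>

definition isometric :: "real \<Rightarrow> 'd path set \<Rightarrow> (real \<times> 'd path \<Rightarrow> real^'d) \<Rightarrow> ('d path \<Rightarrow> real)
    \<Rightarrow> (real \<times> 'd path \<Rightarrow> real^'d) \<Rightarrow> ('d path \<Rightarrow> real) \<Rightarrow> bool" where
  "isometric t A H M H' N \<longleftrightarrow>
     sqint (time_path t) H \<and> sqint (time_path t) H' \<and> sqint (completion P) M \<and> sqint (completion P) N \<and>
     C.expectation (\<lambda>\<omega>. indicator A \<omega> * (M \<omega> * N \<omega>)) = (\<integral>p. indicator A (snd p) * (H p \<bullet> H' p) \<partial>time_path t)"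

lemma isometric_sym: "isometric t A H M H' N \<Longrightarrow> isometric t A H' N H M"
  unfolding isometric_def by (simp add: mult.commute inner_commute)

lemma ito_isometric:
  assumes "has_ito_integral P t T H I" "has_ito_integral P t T H' I'" "0 \<le> t" "t \<le> T"
    "A \<in> sets (wiener_filtration P t)"
  shows "isometric t A (\<lambda>p. H (fst p) (snd p)) (I T) (\<lambda>p. H' (fst p) (snd p)) (I' T)"
  unfolding isometric_def
  using ito_isometry[OF assms] sqint_ito_integral[OF assms(1,3,4)] sqint_ito_integral[OF assms(2,3,4)]
    has_ito_integral_sqint_integrand[OF assms(1,4)] has_ito_integral_sqint_integrand[OF assms(2,4)]
  by simp

lemma isometric_add:
  assumes t: "t \<le> T" and A: "A \<in> sets (wiener_filtration P t)"
    and 1: "isometric t A F1 M1 H' N" and 2: "isometric t A F2 M2 H' N"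
  shows "isometric t A (\<lambda>p. F1 p + g *\<^sub>R F2 p) (\<lambda>\<omega>. M1 \<omega> + g * M2 \<omega>) H' N"
proof -
  note s1 = 1[unfolded isometric_def] and s2 = 2[unfolded isometric_def]
  have Am: "(indicator A :: 'd path \<Rightarrow> real) \<in> borel_measurable (completion P)"
    using subsetD[OF filtration_subset_completion[OF t] A] by simp
  have w: "integrable (completion P) (\<lambda>\<omega>. indicator A \<omega> * (F \<omega> * N \<omega>))" if "sqint (completion P) F" for F
    using integrable_weight[OF sqint_integrable_mult[OF that] Am, of N 1] s1 by (simp split: split_indicator)
  have wQ: "integrable (time_path t) (\<lambda>p. indicator A (snd p) * (F p \<bullet> H' p))" if "sqint (time_path t) F" for F
    using integrable_weight[OF sqint_integrable_inner[OF that] measurable_compose[OF measurable_snd Am], of H' 1] s1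
    by (simp split: split_indicator)
  have "C.expectation (\<lambda>\<omega>. indicator A \<omega> * ((M1 \<omega> + g * M2 \<omega>) * N \<omega>))
    = C.expectation (\<lambda>\<omega>. indicator A \<omega> * (M1 \<omega> * N \<omega>) + g * (indicator A \<omega> * (M2 \<omega> * N \<omega>)))"
    by (rule Bochner_Integration.integral_cong[OF refl]) (simp add: algebra_simps)
  also have "\<dots> = (\<integral>p. indicator A (snd p) * (F1 p \<bullet> H' p) \<partial>time_path t) + g * (\<integral>p. indicator A (snd p) * (F2 p \<bullet> H' p) \<partial>time_path t)"
    using s1 s2 w by simp
  also have "\<dots> = (\<integral>p. indicator A (snd p) * (F1 p \<bullet> H' p) + g * (indicator A (snd p) * (F2 p \<bullet> H' p)) \<partial>time_path t)"
    using s1 s2 wQ by simp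
  also have "\<dots> = (\<integral>p. indicator A (snd p) * ((F1 p + g *\<^sub>R F2 p) \<bullet> H' p) \<partial>time_path t)"
    by (rule Bochner_Integration.integral_cong[OF refl]) (simp add: algebra_simps inner_add_left)
  finally show ?thesis
    unfolding isometric_def using s1 s2 by (auto intro!: sqint_add sqint_scaleR sqint_cmult)
qed

lemma isometric_diff:
  assumes "t \<le> T" "A \<in> sets (wiener_filtration P t)" "isometric t A F1 M1 H' N" "isometric t A F2 M2 H' N"
  shows "isometric t A (\<lambda>p. F1 p - F2 p) (\<lambda>\<omega>. M1 \<omega> - M2 \<omega>) H' N"
  using isometric_add[OF assms, of "-1"] by simp

lemma isometric_sum:
  assumes t: "t \<le> T" "A \<in> sets (wiener_filtration P t)" and "finite I"
    and H': "sqint (time_path t) H'" "sqint (completion P) N"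
    and "\<And>i. i \<in> I \<Longrightarrow> isometric t A (H i) (M i) H' N"
  shows "isometric t A (\<lambda>p. \<Sum>i\<in>I. g i *\<^sub>R H i p) (\<lambda>\<omega>. \<Sum>i\<in>I. g i * M i \<omega>) H' N"
  using assms(3,6)
proof (induction I rule: finite_induct)
  case (insert i I)
  then have "isometric t A (\<lambda>p. (\<Sum>i\<in>I. g i *\<^sub>R H i p) + g i *\<^sub>R H i p) (\<lambda>\<omega>. (\<Sum>i\<in>I. g i * M i \<omega>) + g i * M i \<omega>) H' N"
    by (intro isometric_add[OF t]) auto
  then show ?case using insert by (simp add: add.commute)
qed (use H' in \<open>simp add: isometric_def\<close>)

end

section \<open>Monotonicity of the cost and of the value\<close>

lemma row_matrix_vector: "(G *v v) $ 1 = G $ 1 \<bullet> v" for G :: "real^'n::finite^1"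
  by (simp add: matrix_vector_mult_def inner_vec_def)

text \<open>
  The right-hand side is the drift of \<open>G (X - X') (Y - Y')\<close>.
\<close>

lemma coeff_A_inner:
  fixes G :: "real^'n::finite^1"
  shows "(coeff_A G b \<sigma> f t (x, y, z) u - coeff_A G b \<sigma> f t (x', y', z') u) \<bullet> ((x, y, z) - (x', y', z'))
    = (y - y') * (G $ 1 \<bullet> (b t x y z u - b t x' y' z' u)) - (f t x y z u - f t x' y' z' u) * (G $ 1 \<bullet> (x - x'))
      + (\<Sum>i\<in>UNIV. G $ 1 $ i *\<^sub>R (\<sigma> t x y z u $ i - \<sigma> t x' y' z' u $ i)) \<bullet> (z - z')"
proof -
  have f: "transpose G *v vec k = k *\<^sub>R G $ 1" for k
    by (simp add: vec_eq_iff matrix_vector_mult_def transpose_def sum_1)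
  have s: "(G ** S) $ 1 = (\<Sum>i\<in>UNIV. G $ 1 $ i *\<^sub>R S $ i)" for S :: "real^'d::finite^'n"
    by (simp add: vec_eq_iff matrix_matrix_mult_def)
  show ?thesis
    unfolding coeff_A_def prod.case f s row_matrix_vector
    by (simp add: inner_diff_left inner_diff_right sum_subtractf scaleR_diff_right algebra_simps)
qed

context wiener_measure_space begin

text \<open>
  The linear growth of the coefficient dominates it by the processes.
\<close>

lemma coefficient_along_processes:
  fixes \<beta> :: "real \<Rightarrow> real^'n::finite \<Rightarrow> real \<Rightarrow> real^'d \<Rightarrow> 'u::metric_space \<Rightarrow> 'v::euclidean_space"
  assumes U: "compact U" "U \<noteq> {}" and K: "K \<ge> 0" and L: "lipschitz_xyz T U K \<beta>"
    and c: "\<And>x y z. continuous_on ({0..T} \<times> U) (\<lambda>(t, u). \<beta> t x y z u)"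
    and t: "0 \<le> t" "t \<le> T" and u: "u \<in> controls P U t T"
    and X: "X \<in> S2 P t T" and Y: "Y \<in> S2 P t T" and Z: "Z \<in> H2 P t T"
  shows "sqint (time_path t) (\<lambda>p. \<beta> (fst p) (X (fst p) (snd p)) (Y (fst p) (snd p)) (Z (fst p) (snd p)) (u (fst p) (snd p)))"
    and "s \<in> {t..T} \<Longrightarrow> (\<lambda>\<omega>. \<beta> s (X s \<omega>) (Y s \<omega>) (Z s \<omega>) (u s \<omega>)) \<in> borel_measurable (wiener_filtration P s)"
proof -
  have up: "progressive P t T u" and uU: "\<And>r \<omega>. r \<in> {t..T} \<Longrightarrow> \<omega> \<in> space P \<Longrightarrow> u r \<omega> \<in> U"
    using u unfolding controls_def by simp_all
  note sq = S2_sqint_time_path[OF X t(2)] S2_sqint_time_path[OF Y t(2)] H2_sqint[OF Z t(2)]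
  obtain C where C: "C \<ge> 0" "\<And>t x y z v. t \<in> {0..T} \<Longrightarrow> v \<in> U \<Longrightarrow>
    norm (\<beta> t x y z v) \<le> C + K * (norm x + \<bar>y\<bar> + norm z)"
    by (rule coefficient_linear_growth[OF U(1) L c]) blast
  have sp: "fst p \<in> {t..T}" "snd p \<in> space P" if "p \<in> space (time_path t)" for p
    using that by (auto simp: space_pair_measure)
  have "(\<lambda>r. r) \<in> borel_measurable (time_measure t)"
    by (intro measurable_time_measure_borel measurable_ident_sets refl)
  then have fm: "fst \<in> borel_measurable (time_path t)" by (rule measurable_compose[OF measurable_fst])
  show "sqint (time_path t) (\<lambda>p. \<beta> (fst p) (X (fst p) (snd p)) (Y (fst p) (snd p)) (Z (fst p) (snd p)) (u (fst p) (snd p)))"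
  proof (rule sqint_bound)
    show "sqint (time_path t) (\<lambda>p. C + K * (norm (X (fst p) (snd p)) + norm (Y (fst p) (snd p)) + norm (Z (fst p) (snd p))))"
      by (intro sqint_add Q.sqint_const sqint_cmult sqint_norm sq)
    show "(\<lambda>p. \<beta> (fst p) (X (fst p) (snd p)) (Y (fst p) (snd p)) (Z (fst p) (snd p)) (u (fst p) (snd p))) \<in> borel_measurable (time_path t)"
    proof (rule coefficient_measurable[OF U L c fm sqint_measurable[OF sq(1)] sqint_measurable[OF sq(2)] sqint_measurable[OF sq(3)]
        _ progressive_measurable_time_path[OF up t(2)]])
      show "\<And>p. p \<in> space (time_path t) \<Longrightarrow> fst p \<in> {0..T}" using sp(1) t by fastforce
      show "\<And>p. p \<in> space (time_path t) \<Longrightarrow> u (fst p) (snd p) \<in> U" by (rule uU[OF sp])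
    qed
    show "AE p in time_path t. norm (\<beta> (fst p) (X (fst p) (snd p)) (Y (fst p) (snd p)) (Z (fst p) (snd p)) (u (fst p) (snd p)))
      \<le> norm (C + K * (norm (X (fst p) (snd p)) + norm (Y (fst p) (snd p)) + norm (Z (fst p) (snd p))))"
    proof (rule AE_I2)
      fix p assume p: "p \<in> space (time_path t)"
      then have "fst p \<in> {0..T}" using sp(1)[OF p] t by simp
      from C(2)[OF this uU[OF sp[OF p]]]
      have "norm (\<beta> (fst p) (X (fst p) (snd p)) (Y (fst p) (snd p)) (Z (fst p) (snd p)) (u (fst p) (snd p)))
        \<le> C + K * (norm (X (fst p) (snd p)) + \<bar>Y (fst p) (snd p)\<bar> + norm (Z (fst p) (snd p)))" .
      then show "norm (\<beta> (fst p) (X (fst p) (snd p)) (Y (fst p) (snd p)) (Z (fst p) (snd p)) (u (fst p) (snd p)))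
        \<le> norm (C + K * (norm (X (fst p) (snd p)) + norm (Y (fst p) (snd p)) + norm (Z (fst p) (snd p))))"
        by simp
    qed
  qed
  show "(\<lambda>\<omega>. \<beta> s (X s \<omega>) (Y s \<omega>) (Z s \<omega>) (u s \<omega>)) \<in> borel_measurable (wiener_filtration P s)" if s: "s \<in> {t..T}"
  proof (rule coefficient_measurable[OF U L c borel_measurable_const])
    have s': "t \<le> s" "s \<le> T" using s by auto
    show "X s \<in> borel_measurable (wiener_filtration P s)" "Y s \<in> borel_measurable (wiener_filtration P s)"
      using X Y s unfolding S2_def adapted_continuous_def by simp_all
    have "progressive P t T Z" using Z unfolding H2_def by simp
    then show "Z s \<in> borel_measurable (wiener_filtration P s)" by (rule progressive_section[OF _ s'])
    show "u s \<in> borel_measurable (wiener_filtration P s)" by (rule progressive_section[OF up s'])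
    show "\<And>p. p \<in> space (wiener_filtration P s) \<Longrightarrow> s \<in> {0..T}" using s t by simp
    show "\<And>p. p \<in> space (wiener_filtration P s) \<Longrightarrow> u s p \<in> U" using uU[OF s] by simp
  qed
qed

lemma set_integral_inner_diff:
  fixes v v' :: "real \<Rightarrow> 'b::euclidean_space"
  assumes v: "integrable (time_measure t) v" and v': "integrable (time_measure t) v'" and s: "s \<le> T"
  shows "(LBINT r:{t..s}. g \<bullet> (v r - v' r)) = g \<bullet> (LBINT r:{t..s}. v r) - g \<bullet> (LBINT r:{t..s}. v' r)"
proof -
  have si: "set_integrable lborel {t..s} w" if "integrable (time_measure t) w" for w :: "real \<Rightarrow> 'b"
  proof (rule set_integrable_subset)
    show "set_integrable lborel {t..T} w"
      using that unfolding time_measure_def set_integrable_def by (subst (asm) integrable_restrict_space) simp_all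
  qed (use s in auto)
  have "(LBINT r:{t..s}. g \<bullet> (v r - v' r)) = g \<bullet> (LBINT r:{t..s}. v r - v' r)"
    using set_integral_diff(1)[OF si[OF v] si[OF v']]
    unfolding set_lebesgue_integral_def set_integrable_def by (subst integral_inner_right[symmetric]) auto
  also have "(LBINT r:{t..s}. v r - v' r) = (LBINT r:{t..s}. v r) - (LBINT r:{t..s}. v' r)"
    by (rule set_integral_diff(2)[OF si[OF v] si[OF v']])
  finally show ?thesis by (simp add: inner_diff_right)
qed

text \<open>
  Tested on the event that \<open>\<zeta>\<close> is negative, the hypothesis makes that event null.
\<close>

lemma AE_nonneg_of_event_expectations:
  assumes F: "\<zeta> \<in> borel_measurable (wiener_filtration P t)" "t \<le> T" and int: "integrable (completion P) \<zeta>"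
    and pos: "\<And>A. A \<in> sets (wiener_filtration P t) \<Longrightarrow> C.expectation (\<lambda>\<omega>. indicator A \<omega> * \<zeta> \<omega>) \<ge> (0::real)"
  shows "AE \<omega> in completion P. \<zeta> \<omega> \<ge> 0"
proof -
  define A where "A = {\<omega> \<in> space P. \<zeta> \<omega> < 0}"
  have "{\<omega> \<in> space (wiener_filtration P t). \<zeta> \<omega> < 0} \<in> sets (wiener_filtration P t)"
    by (rule borel_measurable_less[OF F(1) borel_measurable_const])
  then have A: "A \<in> sets (wiener_filtration P t)" unfolding A_def by simp
  then have AC: "A \<in> sets (completion P)" using filtration_subset_completion[OF F(2)] by auto
  have i: "integrable (completion P) (\<lambda>\<omega>. - (indicator A \<omega> * \<zeta> \<omega>))"
    using integrable_mult_indicator[OF AC int] by simp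
  have nn: "AE \<omega> in completion P. 0 \<le> - (indicator A \<omega> * \<zeta> \<omega>)"
    by (rule AE_I2) (simp add: A_def split: split_indicator)
  have "C.expectation (\<lambda>\<omega>. - (indicator A \<omega> * \<zeta> \<omega>)) \<ge> 0" by (rule integral_nonneg_AE[OF nn])
  with pos[OF A] have "C.expectation (\<lambda>\<omega>. - (indicator A \<omega> * \<zeta> \<omega>)) = 0" by simp
  then have "AE \<omega> in completion P. - (indicator A \<omega> * \<zeta> \<omega>) = 0"
    using integral_nonneg_eq_0_iff_AE[OF i nn] by simp
  then show ?thesis using AE_space by eventually_elim (auto simp: A_def split: split_indicator_asm)
qed

text \<open>
  The vector \<open>g\<close> stands for the row of \<open>G\<close>. The hypothesis on the coefficients says that the drift
  of \<open>g \<bullet> (X - X') * (Y - Y')\<close> is nonpositive, so the expectation of this product over any event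
  known at time \<open>t\<close> decreases from \<open>t\<close> to \<open>T\<close>, where it is nonnegative.
\<close>

lemma fbsde_solution_monotone:
  fixes b :: "real \<Rightarrow> real^'n::finite \<Rightarrow> real \<Rightarrow> real^'d \<Rightarrow> 'u::metric_space \<Rightarrow> real^'n"
    and \<sigma> :: "real \<Rightarrow> real^'n \<Rightarrow> real \<Rightarrow> real^'d \<Rightarrow> 'u \<Rightarrow> real^'d^'n"
    and f :: "real \<Rightarrow> real^'n \<Rightarrow> real \<Rightarrow> real^'d \<Rightarrow> 'u \<Rightarrow> real"
  assumes U: "compact U" "U \<noteq> {}" and K: "K \<ge> 0"
    and b: "lipschitz_xyz T U K b" "\<And>x y z. continuous_on ({0..T} \<times> U) (\<lambda>(t, u). b t x y z u)"
    and f: "lipschitz_xyz T U K f" "\<And>x y z. continuous_on ({0..T} \<times> U) (\<lambda>(t, u). f t x y z u)"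
    and mono: "\<And>r v x y z x' y' z'. r \<in> {0..T} \<Longrightarrow> v \<in> U \<Longrightarrow>
      (y - y') * (g \<bullet> (b r x y z v - b r x' y' z' v)) - (f r x y z v - f r x' y' z' v) * (g \<bullet> (x - x'))
      + (\<Sum>i\<in>UNIV. g $ i *\<^sub>R (\<sigma> r x y z v $ i - \<sigma> r x' y' z' v $ i)) \<bullet> (z - z') \<le> 0"
    and \<Phi>: "\<And>x x'. (\<Phi> x - \<Phi> x') * (g \<bullet> (x - x')) \<ge> 0"
    and t: "0 \<le> t" "t \<le> T" and u: "u \<in> controls P U t T"
    and sol: "fbsde_solution T P b \<sigma> f \<Phi> t x0 u X Y Z"
    and sol': "fbsde_solution T P b \<sigma> f \<Phi> t x0' u X' Y' Z'"
  shows "AE \<omega> in completion P. (Y t \<omega> - Y' t \<omega>) * (g \<bullet> (x0 - x0')) \<ge> 0"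
proof -
  note S = sol[unfolded fbsde_solution_def] and S' = sol'[unfolded fbsde_solution_def]
  have X: "X \<in> S2 P t T" "Y \<in> S2 P t T" "Z \<in> H2 P t T"
    and X': "X' \<in> S2 P t T" "Y' \<in> S2 P t T" "Z' \<in> H2 P t T" using S S' by blast+
  have init: "AE \<omega> in completion P. X t \<omega> = x0" "AE \<omega> in completion P. X' t \<omega> = x0'"
    and terminal: "AE \<omega> in completion P. Y T \<omega> = \<Phi> (X T \<omega>)" "AE \<omega> in completion P. Y' T \<omega> = \<Phi> (X' T \<omega>)"
    using S S' by blast+
  define bX where "bX r \<omega> = b r (X r \<omega>) (Y r \<omega>) (Z r \<omega>) (u r \<omega>)" for r \<omega>
  define bX' where "bX' r \<omega> = b r (X' r \<omega>) (Y' r \<omega>) (Z' r \<omega>) (u r \<omega>)" for r \<omega>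
  define fX where "fX r \<omega> = f r (X r \<omega>) (Y r \<omega>) (Z r \<omega>) (u r \<omega>)" for r \<omega>
  define fX' where "fX' r \<omega> = f r (X' r \<omega>) (Y' r \<omega>) (Z' r \<omega>) (u r \<omega>)" for r \<omega>
  define sX where "sX i r \<omega> = \<sigma> r (X r \<omega>) (Y r \<omega>) (Z r \<omega>) (u r \<omega>) $ i" for i r \<omega>
  define sX' where "sX' i r \<omega> = \<sigma> r (X' r \<omega>) (Y' r \<omega>) (Z' r \<omega>) (u r \<omega>) $ i" for i r \<omega>
  obtain I L where I: "\<And>i. has_ito_integral P t T (sX i) (I i)" and L: "has_ito_integral P t T Z L"
    and eq: "AE \<omega> in completion P. \<forall>s\<in>{t..T}.
      X s \<omega> = X t \<omega> + (LBINT r:{t..s}. bX r \<omega>) + (\<chi> i. I i s \<omega>) \<and> Y s \<omega> = Y t \<omega> - (LBINT r:{t..s}. fX r \<omega>) + L s \<omega>"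
    using S unfolding sX_def bX_def fX_def by blast
  obtain I' L' where I': "\<And>i. has_ito_integral P t T (sX' i) (I' i)" and L': "has_ito_integral P t T Z' L'"
    and eq': "AE \<omega> in completion P. \<forall>s\<in>{t..T}.
      X' s \<omega> = X' t \<omega> + (LBINT r:{t..s}. bX' r \<omega>) + (\<chi> i. I' i s \<omega>) \<and> Y' s \<omega> = Y' t \<omega> - (LBINT r:{t..s}. fX' r \<omega>) + L' s \<omega>"
    using S' unfolding sX'_def bX'_def fX'_def by blast
  note bs = coefficient_along_processes[OF U K b t u X, folded bX_def] coefficient_along_processes[OF U K b t u X', folded bX'_def]
  note fs = coefficient_along_processes[OF U K f t u X, folded fX_def] coefficient_along_processes[OF U K f t u X', folded fX'_def]
  define x where "x s \<omega> = g \<bullet> (X s \<omega> - X' s \<omega>)" for s \<omega>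
  define y where "y s \<omega> = Y s \<omega> - Y' s \<omega>" for s \<omega>
  define a where "a s \<omega> = g \<bullet> (bX s \<omega> - bX' s \<omega>)" for s \<omega>
  \<comment> \<open>The sign is written as an inner product, so that \<open>set_integral_inner_diff\<close> covers both drifts.\<close>
  define c where "c s \<omega> = (- 1) \<bullet> (fX s \<omega> - fX' s \<omega>)" for s \<omega>
  define m where "m s \<omega> = (\<Sum>i\<in>UNIV. g $ i * (I i s \<omega> - I' i s \<omega>))" for s \<omega>
  define n where "n s \<omega> = L s \<omega> - L' s \<omega>" for s \<omega>
  define hs where "hs p = (\<Sum>i\<in>UNIV. g $ i *\<^sub>R (sX i (fst p) (snd p) - sX' i (fst p) (snd p)))" for p
  define hz where "hz p = Z (fst p) (snd p) - Z' (fst p) (snd p)" for p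
  have sqg: "sqint M (\<lambda>\<omega>. g \<bullet> F \<omega>)" if "sqint M F" for M and F :: "_ \<Rightarrow> real^'n"
  proof (rule sqint_bound[OF sqint_scaleR[OF that, of "norm g"]])
    show "(\<lambda>\<omega>. g \<bullet> F \<omega>) \<in> borel_measurable M" by (intro borel_measurable_inner borel_measurable_const sqint_measurable[OF that])
    show "AE \<omega> in M. norm (g \<bullet> F \<omega>) \<le> norm (norm g *\<^sub>R F \<omega>)"
      by (rule AE_I2) (simp add: Cauchy_Schwarz_ineq2)
  qed
  have ad: "V r \<in> borel_measurable (wiener_filtration P r)" if "V \<in> S2 P t T" "r \<in> {t..T}" for V :: "real \<Rightarrow> 'd path \<Rightarrow> 'w::euclidean_space" and r
    using that unfolding S2_def adapted_continuous_def by simp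
  have sc: "sqint (completion P) (V r)" if "V \<in> S2 P t T" "r \<in> {t..T}" for V :: "real \<Rightarrow> 'd path \<Rightarrow> 'w::euclidean_space" and r
    using S2_sqint_section[OF that(1)] that(2) by simp
  have tm: "t \<in> {t..T}" "T \<in> {t..T}" using t by simp_all
  have x: "sqint (time_path t) (\<lambda>p. x (fst p) (snd p))" "sqint (completion P) (x t)" "sqint (completion P) (x T)"
      "x t \<in> borel_measurable (wiener_filtration P t)"
    unfolding x_def
    by (intro sqg sqint_diff S2_sqint_time_path X X' t sc borel_measurable_inner borel_measurable_const
      borel_measurable_diff ad tm)+
  have y: "sqint (time_path t) (\<lambda>p. y (fst p) (snd p))" "sqint (completion P) (y t)" "sqint (completion P) (y T)"
      "y t \<in> borel_measurable (wiener_filtration P t)"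
    unfolding y_def
    by (intro sqint_diff S2_sqint_time_path X X' t sc borel_measurable_diff ad tm)+
  have a: "sqint (time_path t) (\<lambda>p. a (fst p) (snd p))" "\<And>s. s \<in> {t..T} \<Longrightarrow> a s \<in> borel_measurable (wiener_filtration P s)"
    unfolding a_def by (intro sqg sqint_diff bs borel_measurable_inner borel_measurable_const borel_measurable_diff; assumption)+
  have c: "sqint (time_path t) (\<lambda>p. c (fst p) (snd p))" "\<And>s. s \<in> {t..T} \<Longrightarrow> c s \<in> borel_measurable (wiener_filtration P s)"
    unfolding c_def inner_real_def
    by (intro sqint_cmult sqint_diff fs borel_measurable_times borel_measurable_const borel_measurable_diff; assumption)+
  have mm: "L2_martingale t m"
  proof -
    have "L2_martingale t (\<lambda>s \<omega>. I i s \<omega> - I' i s \<omega>)" for i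
      using L2_martingale_scale_add[OF ito_L2_martingale[OF I t] ito_L2_martingale[OF I' t], where g="-1"] by simp
    from L2_martingale_sum[OF finite_class.finite_UNIV this] show ?thesis unfolding m_def[abs_def] .
  qed
  have nm: "L2_martingale t n"
    using L2_martingale_scale_add[OF ito_L2_martingale[OF L t] ito_L2_martingale[OF L' t], where g="-1"]
    unfolding n_def[abs_def] by simp
  have iso: "isometric t A hs (m T) hz (n T)" if A: "A \<in> sets (wiener_filtration P t)" for A
  proof -
    have k: "isometric t A (\<lambda>p. H (fst p) (snd p)) (J T) hz (n T)" if J: "has_ito_integral P t T H J" for H J
      unfolding hz_def[abs_def] n_def[abs_def]
      by (rule isometric_sym[OF isometric_diff[OF t(2) A isometric_sym[OF ito_isometric[OF J L t A]] isometric_sym[OF ito_isometric[OF J L' t A]]]])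
    then have N: "sqint (time_path t) hz" "sqint (completion P) (n T)" using I[of undefined] unfolding isometric_def by blast+
    show ?thesis
      unfolding hs_def[abs_def] m_def[abs_def]
      by (rule isometric_sum[OF t(2) A finite_class.finite_UNIV N isometric_diff[OF t(2) A k[OF I] k[OF I']]])
  qed
  have h: "integrable (time_path t) (\<lambda>p. hs p \<bullet> hz p)"
    using iso[OF sets.empty_sets] unfolding isometric_def by (intro sqint_integrable_inner) simp_all
  have eqs: "AE \<omega> in completion P. \<forall>s\<in>{t..T}.
      x s \<omega> = x t \<omega> + (LBINT r:{t..s}. a r \<omega>) + m s \<omega> \<and> y s \<omega> = y t \<omega> + (LBINT r:{t..s}. c r \<omega>) + n s \<omega>"
    using eq eq' AE_integrable_time_section[OF Q.sqint_integrable[OF bs(1)]] AE_integrable_time_section[OF Q.sqint_integrable[OF bs(3)]]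
      AE_integrable_time_section[OF Q.sqint_integrable[OF fs(1)]] AE_integrable_time_section[OF Q.sqint_integrable[OF fs(3)]]
  proof eventually_elim
    case (elim \<omega>)
    show ?case
    proof (intro ballI conjI)
      fix s assume s: "s \<in> {t..T}"
      then have sT: "s \<le> T" by simp
      have int: "integrable (time_measure t) (\<lambda>r. bX r \<omega>)" "integrable (time_measure t) (\<lambda>r. bX' r \<omega>)"
        "integrable (time_measure t) (\<lambda>r. fX r \<omega>)" "integrable (time_measure t) (\<lambda>r. fX' r \<omega>)"
        using elim(3-6) by simp_all
      have e: "X s \<omega> = X t \<omega> + (LBINT r:{t..s}. bX r \<omega>) + (\<chi> i. I i s \<omega>)" "Y s \<omega> = Y t \<omega> - (LBINT r:{t..s}. fX r \<omega>) + L s \<omega>"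
        "X' s \<omega> = X' t \<omega> + (LBINT r:{t..s}. bX' r \<omega>) + (\<chi> i. I' i s \<omega>)" "Y' s \<omega> = Y' t \<omega> - (LBINT r:{t..s}. fX' r \<omega>) + L' s \<omega>"
        using elim(1,2) s by blast+
      have ms: "m s \<omega> = g \<bullet> ((\<chi> i. I i s \<omega>) - (\<chi> i. I' i s \<omega>))"
        unfolding m_def by (simp add: inner_vec_def)
      show "x s \<omega> = x t \<omega> + (LBINT r:{t..s}. a r \<omega>) + m s \<omega>"
        unfolding a_def set_integral_inner_diff[OF int(1,2) sT] ms x_def[of s] x_def[of t] e(1,3)
        by (simp add: inner_add_right inner_diff_right)
      show "y s \<omega> = y t \<omega> + (LBINT r:{t..s}. c r \<omega>) + n s \<omega>"
        unfolding c_def set_integral_inner_diff[OF int(3,4) sT] n_def y_def[of s] y_def[of t] e(2,4)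
        by simp
    qed
  qed
  have "C.expectation (\<lambda>\<omega>. indicator A \<omega> * (x t \<omega> * y t \<omega>)) \<ge> 0" if A: "A \<in> sets (wiener_filtration P t)" for A
  proof -
    have AC: "A \<in> sets (completion P)" using A filtration_subset_completion[OF t(2)] by auto
    have it: "integrable (completion P) (\<lambda>\<omega>. indicator A \<omega> * (x t \<omega> * y t \<omega>))"
      "integrable (completion P) (\<lambda>\<omega>. indicator A \<omega> * (x T \<omega> * y T \<omega>))"
      using integrable_mult_indicator[OF AC sqint_integrable_mult[OF x(2) y(2)]]
        integrable_mult_indicator[OF AC sqint_integrable_mult[OF x(3) y(3)]] by simp_all
    have "C.expectation (\<lambda>\<omega>. indicator A \<omega> * (x T \<omega> * y T \<omega> - x t \<omega> * y t \<omega>))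
      = (\<integral>p. indicator A (snd p) * (x (fst p) (snd p) * c (fst p) (snd p) + y (fst p) (snd p) * a (fst p) (snd p) + hs p \<bullet> hz p) \<partial>time_path t)"
    proof (rule expected_product_formula[OF t A x y a c mm nm h _ eqs])
      show "C.expectation (\<lambda>\<omega>. indicator A \<omega> * (m T \<omega> * n T \<omega>)) = (\<integral>p. indicator A (snd p) * (hs p \<bullet> hz p) \<partial>time_path t)"
        using iso[OF A] unfolding isometric_def by blast
    qed
    also have "\<dots> \<le> (\<integral>p. 0 \<partial>time_path t)"
    proof (rule integral_mono')
      fix p assume "p \<in> space (time_path t)"
      then have p: "fst p \<in> {t..T}" "snd p \<in> space P" by (auto simp: space_pair_measure)
      then have "fst p \<in> {0..T}" "u (fst p) (snd p) \<in> U" using t u unfolding controls_def by auto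
      from mono[OF this]
      have "x (fst p) (snd p) * c (fst p) (snd p) + y (fst p) (snd p) * a (fst p) (snd p) + hs p \<bullet> hz p \<le> 0"
        unfolding x_def y_def a_def c_def hs_def hz_def bX_def bX'_def fX_def fX'_def sX_def sX'_def
        by (simp add: algebra_simps)
      then show "indicator A (snd p) * (x (fst p) (snd p) * c (fst p) (snd p) + y (fst p) (snd p) * a (fst p) (snd p) + hs p \<bullet> hz p) \<le> 0"
        by (simp split: split_indicator)
    qed simp_all
    finally have "C.expectation (\<lambda>\<omega>. indicator A \<omega> * (x T \<omega> * y T \<omega>)) \<le> C.expectation (\<lambda>\<omega>. indicator A \<omega> * (x t \<omega> * y t \<omega>))"
      using it by (simp add: right_diff_distrib)
    moreover have "C.expectation (\<lambda>\<omega>. indicator A \<omega> * (x T \<omega> * y T \<omega>)) \<ge> 0"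
    proof (rule integral_nonneg_AE)
      show "AE \<omega> in completion P. 0 \<le> indicator A \<omega> * (x T \<omega> * y T \<omega>)"
        using terminal
      proof eventually_elim
        case (elim \<omega>)
        then have "0 \<le> x T \<omega> * y T \<omega>" using \<Phi>[of "X T \<omega>" "X' T \<omega>"] unfolding x_def y_def by (simp add: mult.commute)
        then show ?case by (simp split: split_indicator)
      qed
    qed
    ultimately show ?thesis by linarith
  qed
  moreover have "(\<lambda>\<omega>. x t \<omega> * y t \<omega>) \<in> borel_measurable (wiener_filtration P t)" by (intro borel_measurable_times x y)
  ultimately have "AE \<omega> in completion P. x t \<omega> * y t \<omega> \<ge> 0"
    by (intro AE_nonneg_of_event_expectations[OF _ t(2) sqint_integrable_mult[OF x(2) y(2)]])
  then show ?thesis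
    using init by eventually_elim (simp add: x_def y_def mult.commute)
qed

end

lemma is_ess_sup_mono:
  assumes \<eta>: "is_ess_sup M A \<xi> \<eta>" and \<eta>': "is_ess_sup M A \<xi>' \<eta>'"
    and le: "\<And>i. i \<in> A \<Longrightarrow> AE \<omega> in M. \<xi> i \<omega> \<le> \<xi>' i \<omega>"
  shows "AE \<omega> in M. \<eta> \<omega> \<le> \<eta>' \<omega>"
proof -
  have "AE \<omega> in M. \<xi> i \<omega> \<le> \<eta>' \<omega>" if "i \<in> A" for i
  proof -
    have "AE \<omega> in M. \<xi>' i \<omega> \<le> \<eta>' \<omega>" using \<eta>' that unfolding is_ess_sup_def by blast
    with le[OF that] show ?thesis by eventually_elim simp
  qed
  moreover have "\<eta>' \<in> borel_measurable M" using \<eta>' unfolding is_ess_sup_def by blast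
  ultimately show ?thesis using \<eta> unfolding is_ess_sup_def by blast
qed

theorem lemma3p3:
  fixes T :: real
    and P :: "('d::finite path) measure"
    and U :: "'u::metric_space set"
    and b :: "real \<Rightarrow> real^'n::finite \<Rightarrow> real \<Rightarrow> real^'d \<Rightarrow> 'u \<Rightarrow> real^'n"
    and \<sigma> :: "real \<Rightarrow> real^'n \<Rightarrow> real \<Rightarrow> real^'d \<Rightarrow> 'u \<Rightarrow> real^'d^'n"
    and f :: "real \<Rightarrow> real^'n \<Rightarrow> real \<Rightarrow> real^'d \<Rightarrow> 'u \<Rightarrow> real"
    and \<Phi> :: "real^'n \<Rightarrow> real"
    and G :: "real^'n^1"
    and \<beta>\<^sub>1 \<beta>\<^sub>2 \<mu>\<^sub>1 K :: real
    and X :: "real \<Rightarrow> real^'n \<Rightarrow> (real \<Rightarrow> 'd path \<Rightarrow> 'u) \<Rightarrow> real \<Rightarrow> 'd path \<Rightarrow> real^'n"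
    and Y :: "real \<Rightarrow> real^'n \<Rightarrow> (real \<Rightarrow> 'd path \<Rightarrow> 'u) \<Rightarrow> real \<Rightarrow> 'd path \<Rightarrow> real"
    and Z :: "real \<Rightarrow> real^'n \<Rightarrow> (real \<Rightarrow> 'd path \<Rightarrow> 'u) \<Rightarrow> real \<Rightarrow> 'd path \<Rightarrow> real^'d"
    and W :: "real \<Rightarrow> real^'n \<Rightarrow> real"
  assumes T_pos: "T > 0"
    and wiener: "wiener_measure T P"
    and U_compact: "compact U" and U_nonempty: "U \<noteq> {}"
    and G_full_rank: "rank G = 1"
    and b_cont: "\<And>x y z. continuous_on ({0..T} \<times> U) (\<lambda>(t, u). b t x y z u)"
    and \<sigma>_cont: "\<And>x y z. continuous_on ({0..T} \<times> U) (\<lambda>(t, u). \<sigma> t x y z u)"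
    and f_cont: "\<And>x y z. continuous_on ({0..T} \<times> U) (\<lambda>(t, u). f t x y z u)"
    and A_lipschitz: "\<And>u. u \<in> U \<Longrightarrow>
      \<exists>C. \<forall>t\<in>{0..T}. C-lipschitz_on UNIV (\<lambda>v. coeff_A G b \<sigma> f t v u)"
    and A_H2: "\<And>u v. u \<in> U \<Longrightarrow> (\<lambda>t \<omega>. coeff_A G b \<sigma> f t v u) \<in> H2 P 0 T"
    and K_nonneg: "K \<ge> 0"
    and b_lipschitz: "lipschitz_xyz T U K b"
    and \<sigma>_lipschitz: "lipschitz_xyz T U K \<sigma>"
    and f_lipschitz: "lipschitz_xyz T U K f"
    and \<Phi>_lipschitz: "K-lipschitz_on UNIV \<Phi>"
    and A_monotone: "\<And>t u x y z x' y' z'. t \<in> {0..T} \<Longrightarrow> u \<in> U \<Longrightarrow>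
      (coeff_A G b \<sigma> f t (x, y, z) u - coeff_A G b \<sigma> f t (x', y', z') u)
          \<bullet> ((x, y, z) - (x', y', z'))
        \<le> - \<beta>\<^sub>1 * (norm (G *v (x - x')))\<^sup>2
          - \<beta>\<^sub>2 * ((norm (transpose G *v vec (y - y')))\<^sup>2
                + (norm (transpose G ** (rowvector (z - z') :: real^'d^1)))\<^sup>2)"
    and \<Phi>_monotone: "\<And>x x'.
      (\<Phi> x - \<Phi> x') \<bullet> (G *v (x - x')) $ 1 \<ge> \<mu>\<^sub>1 * (norm (G *v (x - x')))\<^sup>2"
    and nonneg: "\<beta>\<^sub>1 \<ge> 0" "\<beta>\<^sub>2 \<ge> 0" "\<mu>\<^sub>1 \<ge> 0"
    and pos: "\<beta>\<^sub>1 + \<beta>\<^sub>2 > 0" "\<beta>\<^sub>2 + \<mu>\<^sub>1 > 0" "CARD('n) > 1 \<Longrightarrow> \<beta>\<^sub>2 > 0"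
    and solution: "\<And>t x u. t \<in> {0..T} \<Longrightarrow> u \<in> controls P U t T \<Longrightarrow>
      fbsde_solution T P b \<sigma> f \<Phi> t x u (X t x u) (Y t x u) (Z t x u)"
    and value_function: "\<And>t x. t \<in> {0..T} \<Longrightarrow>
      is_ess_sup (completion P) (controls P U t T) (cost_functional Y t x) (\<lambda>_. W t x)"
  shows "(\<forall>t\<in>{0..T}. \<forall>x x'. \<forall>u\<in>controls P U t T.
            AE \<omega> in completion P.
              (cost_functional Y t x u \<omega> - cost_functional Y t x' u \<omega>) \<bullet> (G *v (x - x')) $ 1 \<ge> 0)
       \<and> (\<forall>t\<in>{0..T}. \<forall>x x'. (W t x - W t x') \<bullet> (G *v (x - x')) $ 1 \<ge> 0)"
proof -
  interpret wiener_measure_space T P by unfold_locales (rule wiener)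
  define g where "g = G $ 1"
  have drift: "(y - y') * (g \<bullet> (b r x y z v - b r x' y' z' v)) - (f r x y z v - f r x' y' z' v) * (g \<bullet> (x - x'))
      + (\<Sum>i\<in>UNIV. g $ i *\<^sub>R (\<sigma> r x y z v $ i - \<sigma> r x' y' z' v $ i)) \<bullet> (z - z') \<le> 0"
    if "r \<in> {0..T}" "v \<in> U" for r v x y z x' y' z'
  proof -
    have "0 \<le> \<beta>\<^sub>1 * (norm (G *v (x - x')))\<^sup>2"
      "0 \<le> \<beta>\<^sub>2 * ((norm (transpose G *v vec (y - y')))\<^sup>2 + (norm (transpose G ** (rowvector (z - z') :: real^'d^1)))\<^sup>2)"
      using nonneg by simp_all
    then show ?thesis
      using A_monotone[OF that, of x y z x' y' z'] unfolding coeff_A_inner g_def by linarith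
  qed
  have terminal: "(\<Phi> x - \<Phi> x') * (g \<bullet> (x - x')) \<ge> 0" for x x'
  proof -
    have "0 \<le> \<mu>\<^sub>1 * (norm (G *v (x - x')))\<^sup>2" using nonneg by simp
    then show ?thesis using \<Phi>_monotone[of x x'] unfolding row_matrix_vector g_def by simp
  qed
  have cost: "AE \<omega> in completion P. (cost_functional Y t x u \<omega> - cost_functional Y t x' u \<omega>) * (g \<bullet> (x - x')) \<ge> 0"
    if t: "t \<in> {0..T}" and u: "u \<in> controls P U t T" for t x x' u
  proof -
    have t': "0 \<le> t" "t \<le> T" using t by simp_all
    show ?thesis
      unfolding cost_functional_def
      by (rule fbsde_solution_monotone[OF U_compact U_nonempty K_nonneg b_lipschitz b_cont f_lipschitz f_cont
          drift terminal t' u solution[OF t u] solution[OF t u]])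
  qed
  \<comment> \<open>For a fixed sign of \<open>g \<bullet> (x - x')\<close> the costs are ordered for every control, so their essential
    suprema are. These are constants, and an almost sure inequality between constants holds.\<close>
  have value_le: "W t x' \<le> W t x" if t: "t \<in> {0..T}" and gt: "g \<bullet> (x - x') > 0" for t x x'
  proof -
    have "AE \<omega> in completion P. cost_functional Y t x' u \<omega> \<le> cost_functional Y t x u \<omega>"
      if u: "u \<in> controls P U t T" for u
      using cost[OF t u, of x x'] by eventually_elim (use gt in \<open>simp add: zero_le_mult_iff\<close>)
    then have "AE \<omega> in completion P. W t x' \<le> W t x"
      by (rule is_ess_sup_mono[OF value_function[OF t] value_function[OF t]])
    then show ?thesis by (simp add: C.AE_const)
  qed
  have "(W t x - W t x') * (g \<bullet> (x - x')) \<ge> 0" if t: "t \<in> {0..T}" for t x x'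
  proof (cases "g \<bullet> (x - x')" "0::real" rule: linorder_cases)
    case less
    then have "g \<bullet> (x' - x) > 0" by (simp add: inner_diff_right)
    from value_le[OF t this] less show ?thesis by (simp add: zero_le_mult_iff)
  next
    case greater
    with value_le[OF t this] show ?thesis by simp
  qed simp
  with cost show ?thesis unfolding row_matrix_vector g_def by simp
qed

end
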